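(* For each nonzero $c\in\mathbb{C}$ there exists on $\mathbb{C}P^1$ a structure of a commutative involutive regular six-valued algebraic coset group $\mathbb{G}_{6,c}(\mathbb{C}P^1)$ with neutral element $0$ and multiplication defined by the symmetric polynomial $$\begin{aligned} p_{6,c}(z;x,y)&=\sigma_1^6-2^2\cdot3\,\sigma_1^4\sigma_2+2^4\cdot3\,\sigma_1^2\sigma_2^2-2^6\sigma_2^3-2\cdot3^4\cdot17\,\sigma_1^3\sigma_3\\ &-2^3\cdot3^4\cdot19\,\sigma_1\sigma_2\sigma_3+3^3\cdot19^3\sigma_3^2\\ &-2^5\cdot3^2\cdot11\,c\,\sigma_1^4\sigma_3-2^2\cdot3^3\cdot5\,c^2\sigma_1^5\sigma_3-2^4\cdot3^2\cdot211\,c\,\sigma_1^2\sigma_2\sigma_3\\ &-2^2\cdot3^3\cdot197\,c^2\sigma_1^3\sigma_2\sigma_3-2^3\cdot3^5c^3\sigma_1^4\sigma_2\sigma_3-2^6\cdot3^2\cdot5^2c\,\sigma_2^2\sigma_3\\ &-2^4\cdot3^3\cdot107\,c^2\sigma_1\sigma_2^2\sigma_3-2^4\cdot3^7c^3\sigma_1^2\sigma_2^2\sigma_3-2\cdot3^6c^4\sigma_1^3\sigma_2^2\sigma_3\\ &-2^6\cdot3^5c^3\sigma_2^3\sigma_3-2^3\cdot3^7c^4\sigma_1\sigma_2^3\sigma_3+2^4\cdot3^3\cdot7^2\cdot19\,c\,\sigma_1\sigma_3^2\\ &+2^2\cdot3^3\cdot47\cdot53\,c^2\sigma_1^2\sigma_3^2+2^3\cdot3^5\cdot61\,c^3\sigma_1^3\sigma_3^2+2\cdot3^7\cdot17\,c^4\sigma_1^4\sigma_3^2\\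 &+2^2\cdot3^4\cdot701\,c^2\sigma_2\sigma_3^2+2^3\cdot3^6\cdot7\cdot13\,c^3\sigma_1\sigma_2\sigma_3^2+2^{10}\cdot3^6c^4\sigma_1^2\sigma_2\sigma_3^2\\ &+2^4\cdot3^8\cdot5\,c^5\sigma_1^3\sigma_2\sigma_3^2+2\cdot3^7\cdot5\cdot17\,c^4\sigma_2^2\sigma_3^2+2^5\cdot3^8\cdot7\,c^5\sigma_1\sigma_2^2\sigma_3^2\\ &+2^2\cdot3^9\cdot17\,c^6\sigma_1^2\sigma_2^2\sigma_3^2+2^2\cdot3^9\cdot11\,c^6\sigma_2^3\sigma_3^2+2^3\cdot3^{11}c^7\sigma_1\sigma_2^3\sigma_3^2\\ &+3^{12}c^8\sigma_2^4\sigma_3^2-2^3\cdot3^{12}c^3\sigma_3^3-2\cdot3^9\cdot5\cdot47\,c^4\sigma_1\sigma_3^3\\ &-2^4\cdot3^9\cdot17\,c^5\sigma_1^2\sigma_3^3-2^2\cdot3^9\cdot5\,c^6\sigma_1^3\sigma_3^3-2^6\cdot3^{11}c^5\sigma_2\sigma_3^3\\ &-2^2\cdot3^{10}\cdot5\cdot11\,c^6\sigma_1\sigma_2\sigma_3^3-2^3\cdot3^{11}c^7\sigma_1^2\sigma_2\sigma_3^3-2^3\cdot3^{11}\cdot5\,c^7\sigma_2^2\sigma_3^3\\ &-2\cdot3^{12}c^8\sigma_1\sigma_2^2\sigma_3^3-2^3\cdot3^{12}c^6\sigma_3^4-2^3\cdot3^{12}c^7\sigma_1\sigma_3^4\\ &+3^{12}c^8\sigma_1^2\sigma_3^4-2^2\cdot3^{13}c^8\sigma_2\sigma_3^4,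 \end{aligned}$$ where $\sigma_k$ is the $k$-th elementary symmetric function of $x,y,z$. All such six-valued groups ($c\ne0$) are coset-isomorphic.
   Context: $\mathbb{C}P^1=\mathbb{C}\cup\{\infty\}$, $x=x_1/x_0$ for $(x_1:x_0)$, $\infty=(1:0)$. $\mathrm{Sym}^n(X)=X^n/\Sigma_n$; elements are multisets $[z_1,\dots,z_n]$. An algebraic $n$-valued group is an algebraic variety $X$ with a rational morphism $\ast:X\times X\to\mathrm{Sym}^n(X)$ which is associative (the $n^2$-multisets $[x\ast w\mid w\in y\ast z]$ and $[w\ast z\mid w\in x\ast y]$ coincide), a neutral element $e$ with $x\ast e=e\ast x=[x,\dots,x]$ for all $x$, and a rational morphism $\mathrm{inv}:X\to X$ such that, whenever $\mathrm{inv}(x)$ exists, $x\ast\mathrm{inv}(x)$ and $\mathrm{inv}(x)\ast x$ exist and contain $e$. It is regular if $\ast$ is defined on all of $X\times X$ and $\mathrm{inv}$ on all of $X$; commutative if $x\ast y=y\ast x$; involutive if $\mathrm{inv}$ is uniquely determined and $\mathrm{inv}(x)=x$ for all $x$. The multiplication on $\mathbb{C}P^1$ defined by a polynomial $P(z;x,y)$ of degree at most $n$ in each variable: $(x_1:x_0)\ast(y_1:y_0)$ is the multiset of $n$ zeros (with multiplicity) in $(z_1:z_0)$ of the form $(x_0y_0z_0)^nP(z_1/z_0;x_1/x_0,y_1/y_0)$. Coset construction: for a (1-valued) group $G$ and a subgroup $H\subset\mathrm{Aut}(G)$ of order $n$, with projection $\pi:G\to G/H$, the coset $n$-valued group $G_H$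 is $G/H$ with $\pi(u)\ast\pi(v)=[\pi(u\cdot h(v))\mid h\in H]$, neutral element $\pi(e)$, $\mathrm{inv}(\pi(u))=\pi(u^{-1})$. Here the coset structure on $\mathbb{G}_{6,c}(\mathbb{C}P^1)$ is that of the group of points of the elliptic curve $\mathcal{E}=\{\eta^2=\zeta^3+c\}$ (neutral element the point $\infty$) and the order-$6$ group generated by $\phi_6:(\zeta,\eta)\mapsto(e^{2\pi i/3}\zeta,-\eta)$, $\infty\mapsto\infty$, the orbit space being identified with $\mathbb{C}P^1$ by $(\zeta,\eta)\mapsto-1/\eta^2$, $\infty\mapsto0$. Coset groups $M_A$ and $N_B$ ($A\subset\mathrm{Aut}(M)$, $B\subset\mathrm{Aut}(N)$ of order $n$) are coset-isomorphic if there exist isomorphisms $\widetilde\varphi:M\to N$ (of algebraic groups) and $\varphi:M/A\to N/B$ compatible with the projections $M\to M/A$, $N\to N/B$, with the maps $M\times M\to\mathrm{Sym}^n(M)$, $(m_1,m_2)\mapsto[m_1\cdot a(m_2)\mid a\in A]$ (and likewise for $N$), and with the $n$-valued multiplications on $M/A$, $N/B$. *)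

theory Defs
  imports "HOL-Analysis.Analysis" "HOL-Algebra.Bij" "HOL-Algebra.Generated_Groups"
    "HOL-Library.Multiset"
begin

section \<open>Spaces with regular functions\<close>

text \<open>
  A variety is treated as a topological space together with, for every open set, its regular
  functions. Values of functions outside the open set are irrelevant.
\<close>

record 'p fspace =
  ftop :: "'p topology"
  regfun :: "'p set \<Rightarrow> ('p \<Rightarrow> complex) set"

definition regular_on :: "'p fspace \<Rightarrow> 'p set \<Rightarrow> 'q fspace \<Rightarrow> ('p \<Rightarrow> 'q) \<Rightarrow> bool" where
  "regular_on X U Y f \<longleftrightarrow> openin (ftop X) U \<and> f ` U \<subseteq> topspace (ftop Y) \<and>
     (\<forall>V. openin (ftop Y) V \<longrightarrow> openin (ftop X) {x \<in> U. f x \<in> V} \<and>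
        (\<forall>g \<in> regfun Y V. g \<circ> f \<in> regfun X {x \<in> U. f x \<in> V}))"

definition morphism :: "'p fspace \<Rightarrow> 'q fspace \<Rightarrow> ('p \<Rightarrow> 'q) \<Rightarrow> bool" where
  "morphism X Y f \<longleftrightarrow> regular_on X (topspace (ftop X)) Y f"

text \<open>
  A rational morphism is a partial function whose domain is its full domain of definition: dense
  open, and not extendable to a regular map on a larger open set.
\<close>

definition rational_morphism :: "'p fspace \<Rightarrow> 'q fspace \<Rightarrow> ('p \<Rightarrow> 'q option) \<Rightarrow> bool" where
  "rational_morphism X Y f \<longleftrightarrow>
     regular_on X (dom f) Y (the \<circ> f) \<and>
     ftop X closure_of dom f = topspace (ftop X) \<and>
     (\<forall>U g. regular_on X U Y g \<and> dom f \<subseteq> U \<and> (\<forall>x \<in> dom f. f x = Some (g x)) \<longrightarrow> U = dom f)"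


section \<open>Projective varieties, their products and symmetric powers\<close>

text \<open>
  Polynomial functions in the variables \<open>v i j\<close>; the index \<open>i\<close> numbers the factors of a product of
  projective spaces and \<open>j\<close> the homogeneous coordinates on one factor.
\<close>

inductive poly_fun :: "((nat \<Rightarrow> nat \<Rightarrow> complex) \<Rightarrow> complex) \<Rightarrow> bool" where
  const: "poly_fun (\<lambda>v. a)"
| coord: "poly_fun (\<lambda>v. v i j)"
| add: "poly_fun A \<Longrightarrow> poly_fun B \<Longrightarrow> poly_fun (\<lambda>v. A v + B v)"
| mult: "poly_fun A \<Longrightarrow> poly_fun B \<Longrightarrow> poly_fun (\<lambda>v. A v * B v)"

definition multihomogeneous ::
  "(nat \<Rightarrow> nat) \<Rightarrow> ((nat \<Rightarrow> nat \<Rightarrow> complex) \<Rightarrow> complex) \<Rightarrow> bool" where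
  "multihomogeneous d A \<longleftrightarrow> poly_fun A \<and>
     (\<forall>v i t. A (v(i := (\<lambda>j. t * v i j))) = t ^ d i * A v)"

text \<open>Unused factors are filled with zero vectors.\<close>

definition coord_blocks :: "(nat \<Rightarrow> complex) list \<Rightarrow> nat \<Rightarrow> nat \<Rightarrow> complex" where
  "coord_blocks vs i = (if i < length vs then vs ! i else (\<lambda>j. 0))"

text \<open>
  The Zariski topology and the regular functions on a set \<open>S\<close> whose points have the lists of
  homogeneous coordinate vectors given by \<open>h\<close>. Multihomogeneous polynomials and their quotients
  of equal multidegree do not depend on the scaling of these vectors.
\<close>

definition zariski_space :: "'p set \<Rightarrow> ('p \<Rightarrow> (nat \<Rightarrow> complex) list) \<Rightarrow> 'p fspace" where
  "zariski_space S h =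
     \<lparr>ftop = topology_generated_by
        {{p \<in> S. A (coord_blocks (h p)) \<noteq> 0} |A. \<exists>d. multihomogeneous d A},
      regfun = (\<lambda>U. {f. \<forall>p \<in> U. \<exists>d A B. multihomogeneous d A \<and> multihomogeneous d B \<and>
        B (coord_blocks (h p)) \<noteq> 0 \<and>
        (\<forall>q \<in> U. B (coord_blocks (h q)) \<noteq> 0 \<longrightarrow>
           f q = A (coord_blocks (h q)) / B (coord_blocks (h q)))})\<rparr>"

record 'a proj_set =
  points :: "'a set"
  hcoord :: "'a \<Rightarrow> nat \<Rightarrow> complex"

definition projective_variety :: "'a proj_set \<Rightarrow> bool" where
  "projective_variety X \<longleftrightarrow>
     (\<forall>p \<in> points X. \<forall>q \<in> points X. \<forall>t. hcoord X p = (\<lambda>j. t * hcoord X q j) \<longrightarrow> p = q) \<and>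
     (\<exists>N F. (\<forall>A \<in> F. \<exists>d. multihomogeneous d A) \<and>
       (\<forall>v. (\<exists>p \<in> points X. \<exists>t. t \<noteq> 0 \<and> v = (\<lambda>j. t * hcoord X p j)) \<longleftrightarrow>
            v \<noteq> (\<lambda>j. 0) \<and> (\<forall>j > N. v j = 0) \<and> (\<forall>A \<in> F. A (coord_blocks [v]) = 0)))"

definition var_space :: "'a proj_set \<Rightarrow> 'a fspace" where
  "var_space X = zariski_space (points X) (\<lambda>p. [hcoord X p])"

definition square_space :: "'a proj_set \<Rightarrow> ('a \<times> 'a) fspace" where
  "square_space X =
     zariski_space (points X \<times> points X) (\<lambda>(p, q). [hcoord X p, hcoord X q])"

definition power_space :: "nat \<Rightarrow> 'a proj_set \<Rightarrow> 'a list fspace" where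
  "power_space n X =
     zariski_space {ps. length ps = n \<and> set ps \<subseteq> points X} (map (hcoord X))"

text \<open>
  \<open>Sym\<^sup>n(X) = X\<^sup>n / \<Sigma>\<^sub>n\<close>: quotient topology, and the regular functions are those whose pullback
  along \<open>mset\<close> is regular.
\<close>

definition sym_space :: "nat \<Rightarrow> 'a proj_set \<Rightarrow> 'a multiset fspace" where
  "sym_space n X =
     \<lparr>ftop = topology (\<lambda>V. V \<subseteq> mset ` topspace (ftop (power_space n X)) \<and>
        openin (ftop (power_space n X)) {ps \<in> topspace (ftop (power_space n X)). mset ps \<in> V}),
      regfun = (\<lambda>V. {g. g \<circ> mset \<in>
        regfun (power_space n X) {ps \<in> topspace (ftop (power_space n X)). mset ps \<in> V}})\<rparr>"

lemma openin_sym_space: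
  "openin (ftop (sym_space n X)) V \<longleftrightarrow> V \<subseteq> mset ` topspace (ftop (power_space n X)) \<and>
     openin (ftop (power_space n X)) {ps \<in> topspace (ftop (power_space n X)). mset ps \<in> V}"
proof -
  let ?T = "ftop (power_space n X)"
  let ?P = "\<lambda>V. V \<subseteq> mset ` topspace ?T \<and> openin ?T {ps \<in> topspace ?T. mset ps \<in> V}"
  have "istopology ?P"
    unfolding istopology_def
  proof (intro conjI allI impI)
    fix S T assume S: "?P S" and T: "?P T"
    show "S \<inter> T \<subseteq> mset ` topspace ?T" using S by blast
    have "{ps \<in> topspace ?T. mset ps \<in> S \<inter> T} =
        {ps \<in> topspace ?T. mset ps \<in> S} \<inter> {ps \<in> topspace ?T. mset ps \<in> T}"
      by blast
    then show "openin ?T {ps \<in> topspace ?T. mset ps \<in> S \<inter> T}" using S T by auto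
  next
    fix K assume K: "\<forall>S \<in> K. ?P S"
    show "\<Union>K \<subseteq> mset ` topspace ?T" using K by blast
    have "{ps \<in> topspace ?T. mset ps \<in> \<Union>K} = (\<Union>S \<in> K. {ps \<in> topspace ?T. mset ps \<in> S})"
      by blast
    then show "openin ?T {ps \<in> topspace ?T. mset ps \<in> \<Union>K}" using K by auto
  qed
  then show ?thesis by (simp add: sym_space_def)
qed


section \<open>Algebraic \<open>n\<close>-valued groups\<close>

record 'a nvgroup =
  nmult :: "'a \<Rightarrow> 'a \<Rightarrow> 'a multiset option"
  nunit :: 'a
  ninv :: "'a \<Rightarrow> 'a option"

definition nv_associative :: "'a proj_set \<Rightarrow> 'a nvgroup \<Rightarrow> bool" where
  "nv_associative X G \<longleftrightarrow>
     (\<forall>x \<in> points X. \<forall>y \<in> points X. \<forall>z \<in> points X. \<forall>M N.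
        nmult G y z = Some M \<and> nmult G x y = Some N \<and>
        (\<forall>w \<in># M. nmult G x w \<noteq> None) \<and> (\<forall>w \<in># N. nmult G w z \<noteq> None) \<longrightarrow>
        (\<Sum>w \<in># M. the (nmult G x w)) = (\<Sum>w \<in># N. the (nmult G w z)))"

definition nv_inverse_map :: "'a proj_set \<Rightarrow> 'a nvgroup \<Rightarrow> ('a \<Rightarrow> 'a option) \<Rightarrow> bool" where
  "nv_inverse_map X G j \<longleftrightarrow> rational_morphism (var_space X) (var_space X) j \<and>
     (\<forall>x y. j x = Some y \<longrightarrow>
        (\<exists>M M'. nmult G x y = Some M \<and> nunit G \<in># M \<and> nmult G y x = Some M' \<and> nunit G \<in># M'))"

definition algebraic_nvgroup :: "nat \<Rightarrow> 'a proj_set \<Rightarrow> 'a nvgroup \<Rightarrow> bool" where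
  "algebraic_nvgroup n X G \<longleftrightarrow>
     projective_variety X \<and>
     rational_morphism (square_space X) (sym_space n X) (\<lambda>(x, y). nmult G x y) \<and>
     nv_associative X G \<and>
     nunit G \<in> points X \<and>
     (\<forall>x \<in> points X. nmult G x (nunit G) = Some (replicate_mset n x) \<and>
        nmult G (nunit G) x = Some (replicate_mset n x)) \<and>
     nv_inverse_map X G (ninv G)"

definition nv_regular :: "'a proj_set \<Rightarrow> 'a nvgroup \<Rightarrow> bool" where
  "nv_regular X G \<longleftrightarrow>
     (\<forall>x \<in> points X. \<forall>y \<in> points X. nmult G x y \<noteq> None) \<and> (\<forall>x \<in> points X. ninv G x \<noteq> None)"

definition nv_commutative :: "'a proj_set \<Rightarrow> 'a nvgroup \<Rightarrow> bool" where
  "nv_commutative X G \<longleftrightarrow> (\<forall>x \<in> points X. \<forall>y \<in> points X. nmult G x y = nmult G y x)"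

definition nv_involutive :: "'a proj_set \<Rightarrow> 'a nvgroup \<Rightarrow> bool" where
  "nv_involutive X G \<longleftrightarrow>
     (\<forall>j. nv_inverse_map X G j \<longrightarrow> j = ninv G) \<and> (\<forall>x \<in> points X. ninv G x = Some x)"


section \<open>Algebraic coset groups\<close>

definition algebraic_group :: "'a proj_set \<Rightarrow> 'a monoid \<Rightarrow> bool" where
  "algebraic_group X M \<longleftrightarrow> projective_variety X \<and> group M \<and> carrier M = points X \<and>
     morphism (square_space X) (var_space X) (\<lambda>(u, v). u \<otimes>\<^bsub>M\<^esub> v) \<and>
     morphism (var_space X) (var_space X) (\<lambda>u. inv\<^bsub>M\<^esub> u)"

definition variety_iso :: "'a proj_set \<Rightarrow> 'b proj_set \<Rightarrow> ('a \<Rightarrow> 'b) \<Rightarrow> bool" where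
  "variety_iso X Y f \<longleftrightarrow> bij_betw f (points X) (points Y) \<and>
     morphism (var_space X) (var_space Y) f \<and>
     morphism (var_space Y) (var_space X) (inv_into (points X) f)"

text \<open>
  The orbit space of the group \<open>auts\<close> of automorphisms acting on the group \<open>cover\<close> is identified
  with the variety \<open>orbits\<close>; \<open>proj\<close> is the projection under this identification.
\<close>

record ('a, 'b) coset_data =
  cover_var :: "'a proj_set"
  cover :: "'a monoid"
  auts :: "('a \<Rightarrow> 'a) set"
  orbits :: "'b proj_set"
  proj :: "'a \<Rightarrow> 'b"

definition coset_group :: "nat \<Rightarrow> ('a, 'b) coset_data \<Rightarrow> 'b nvgroup \<Rightarrow> bool" where
  "coset_group n D G \<longleftrightarrow>
     algebraic_group (cover_var D) (cover D) \<and>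
     subgroup (auts D) (AutoGroup (cover D)) \<and> finite (auts D) \<and> card (auts D) = n \<and>
     (\<forall>h \<in> auts D. variety_iso (cover_var D) (cover_var D) h) \<and>
     morphism (var_space (cover_var D)) (var_space (orbits D)) (proj D) \<and>
     proj D ` carrier (cover D) = points (orbits D) \<and>
     (\<forall>u \<in> carrier (cover D). \<forall>v \<in> carrier (cover D).
        proj D u = proj D v \<longleftrightarrow> (\<exists>h \<in> auts D. v = h u)) \<and>
     (\<forall>u \<in> carrier (cover D). \<forall>v \<in> carrier (cover D).
        nmult G (proj D u) (proj D v) =
          Some {#proj D (u \<otimes>\<^bsub>cover D\<^esub> h v). h \<in># mset_set (auts D)#}) \<and>
     nunit G = proj D \<one>\<^bsub>cover D\<^esub> \<and>
     (\<forall>u \<in> carrier (cover D). ninv G (proj D u) = Some (proj D (inv\<^bsub>cover D\<^esub> u)))"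

definition coset_isomorphic ::
  "('a, 'b) coset_data \<Rightarrow> 'b nvgroup \<Rightarrow> ('c, 'd) coset_data \<Rightarrow> 'd nvgroup \<Rightarrow> bool" where
  "coset_isomorphic D G D' G' \<longleftrightarrow> (\<exists>f g.
     f \<in> iso (cover D) (cover D') \<and> variety_iso (cover_var D) (cover_var D') f \<and>
     variety_iso (orbits D) (orbits D') g \<and>
     (\<forall>u \<in> carrier (cover D). g (proj D u) = proj D' (f u)) \<and>
     (\<forall>u \<in> carrier (cover D). \<forall>v \<in> carrier (cover D).
        {#f (u \<otimes>\<^bsub>cover D\<^esub> a v). a \<in># mset_set (auts D)#} =
        {#f u \<otimes>\<^bsub>cover D'\<^esub> b (f v). b \<in># mset_set (auts D')#}) \<and>
     (\<forall>x \<in> points (orbits D). \<forall>y \<in> points (orbits D).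
        map_option (image_mset g) (nmult G x y) = nmult G' (g x) (g y)))"


section \<open>The projective line and multiplications defined by polynomials\<close>

datatype cp1 = Aff complex | Infty

text \<open>
  \<open>Aff x\<close> is \<open>(x\<^sub>1 : x\<^sub>0)\<close> with \<open>x = x\<^sub>1 / x\<^sub>0\<close>, and \<open>Infty\<close> is \<open>(1 : 0)\<close>.
\<close>

fun coord1 :: "cp1 \<Rightarrow> complex" where
  "coord1 (Aff x) = x"
| "coord1 Infty = 1"

fun coord0 :: "cp1 \<Rightarrow> complex" where
  "coord0 (Aff x) = 1"
| "coord0 Infty = 0"

definition CP1 :: "cp1 proj_set" where
  "CP1 = \<lparr>points = UNIV,
     hcoord = (\<lambda>p j. if j = 0 then coord0 p else if j = 1 then coord1 p else 0)\<rparr>"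

text \<open>
  \<open>M\<close> is the multiset of the \<open>n\<close> zeros, with multiplicity, of the nonzero binary form
  \<open>F(z\<^sub>1, z\<^sub>0)\<close> of degree \<open>n\<close>.
\<close>

definition form_zeros :: "nat \<Rightarrow> (complex \<Rightarrow> complex \<Rightarrow> complex) \<Rightarrow> cp1 multiset \<Rightarrow> bool" where
  "form_zeros n F M \<longleftrightarrow> size M = n \<and>
     (\<exists>k. k \<noteq> 0 \<and> (\<forall>z1 z0. F z1 z0 = k * (\<Prod>p \<in># M. z1 * coord0 p - z0 * coord1 p)))"

text \<open>
  The coefficients \<open>a i j k\<close> of a polynomial function \<open>P(z; x, y)\<close> are unique, and the last clause
  contains the form \<open>(x\<^sub>0y\<^sub>0z\<^sub>0)\<^sup>n P(z\<^sub>1/z\<^sub>0; x\<^sub>1/x\<^sub>0, y\<^sub>1/y\<^sub>0)\<close> written as a polynomial, so that it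
  makes sense when some of \<open>x\<^sub>0\<close>, \<open>y\<^sub>0\<close>, \<open>z\<^sub>0\<close> vanish.
\<close>

definition mult_defined_by ::
  "nat \<Rightarrow> (complex \<Rightarrow> complex \<Rightarrow> complex \<Rightarrow> complex) \<Rightarrow> cp1 nvgroup \<Rightarrow> bool" where
  "mult_defined_by n P G \<longleftrightarrow> (\<exists>a.
     (\<forall>z x y. P z x y = (\<Sum>i\<le>n. \<Sum>j\<le>n. \<Sum>k\<le>n. a i j k * z ^ i * x ^ j * y ^ k)) \<and>
     (\<forall>p q. \<exists>M. nmult G p q = Some M \<and>
        form_zeros n
          (\<lambda>z1 z0. \<Sum>i\<le>n. \<Sum>j\<le>n. \<Sum>k\<le>n. a i j k * (z1 ^ i * z0 ^ (n - i)) *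
             (coord1 p ^ j * coord0 p ^ (n - j)) * (coord1 q ^ k * coord0 q ^ (n - k))) M))"


section \<open>The curves \<open>\<eta>\<^sup>2 = \<zeta>\<^sup>3 + c\<close> and their automorphism of order six\<close>

datatype ecpoint = Pt complex complex | EInf

definition ec_points :: "complex \<Rightarrow> ecpoint set" where
  "ec_points c = insert EInf {Pt \<zeta> \<eta> |\<zeta> \<eta>. \<eta>\<^sup>2 = \<zeta> ^ 3 + c}"

fun ec_coord :: "ecpoint \<Rightarrow> nat \<Rightarrow> complex" where
  "ec_coord (Pt \<zeta> \<eta>) j = (if j = 0 then 1 else if j = 1 then \<zeta> else if j = 2 then \<eta> else 0)"
| "ec_coord EInf j = (if j = 2 then 1 else 0)"

definition ec_var :: "complex \<Rightarrow> ecpoint proj_set" where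
  "ec_var c = \<lparr>points = ec_points c, hcoord = ec_coord\<rparr>"

text \<open>The chord and tangent law; \<open>m\<close> is the slope.\<close>

fun ec_add :: "ecpoint \<Rightarrow> ecpoint \<Rightarrow> ecpoint" where
  "ec_add EInf Q = Q"
| "ec_add P EInf = P"
| "ec_add (Pt \<zeta> \<eta>) (Pt \<zeta>' \<eta>') =
     (if \<zeta> = \<zeta>' \<and> \<eta> = - \<eta>' then EInf
      else let m = (if \<zeta> = \<zeta>' then 3 * \<zeta>\<^sup>2 / (2 * \<eta>) else (\<eta>' - \<eta>) / (\<zeta>' - \<zeta>));
               \<zeta>'' = m\<^sup>2 - \<zeta> - \<zeta>'
           in Pt \<zeta>'' (m * (\<zeta> - \<zeta>'') - \<eta>))"

definition ec_group :: "complex \<Rightarrow> ecpoint monoid" where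
  "ec_group c = \<lparr>carrier = ec_points c, mult = ec_add, one = EInf\<rparr>"

fun phi6 :: "ecpoint \<Rightarrow> ecpoint" where
  "phi6 (Pt \<zeta> \<eta>) = Pt (exp (2 * pi * \<i> / 3) * \<zeta>) (- \<eta>)"
| "phi6 EInf = EInf"

fun ec_proj :: "ecpoint \<Rightarrow> cp1" where
  "ec_proj (Pt \<zeta> \<eta>) = (if \<eta> = 0 then Infty else Aff (- 1 / \<eta>\<^sup>2))"
| "ec_proj EInf = Aff 0"

text \<open>Elements of \<open>AutoGroup\<close> are extensional functions, hence the \<open>restrict\<close>.\<close>

definition ec_coset_data :: "complex \<Rightarrow> (ecpoint, cp1) coset_data" where
  "ec_coset_data c =
     \<lparr>cover_var = ec_var c, cover = ec_group c,
      auts = generate (AutoGroup (ec_group c)) {restrict phi6 (ec_points c)},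
      orbits = CP1, proj = ec_proj\<rparr>"


definition p6 :: "complex \<Rightarrow> complex \<Rightarrow> complex \<Rightarrow> complex \<Rightarrow> complex" where
  "p6 c z x y = (let s1 = x + y + z; s2 = x * y + y * z + z * x; s3 = x * y * z in
     s1^6 - 2^2 * 3 * s1^4 * s2 + 2^4 * 3 * s1^2 * s2^2 - 2^6 * s2^3
     - 2 * 3^4 * 17 * s1^3 * s3 - 2^3 * 3^4 * 19 * s1 * s2 * s3 + 3^3 * 19^3 * s3^2
     - 2^5 * 3^2 * 11 * c * s1^4 * s3 - 2^2 * 3^3 * 5 * c^2 * s1^5 * s3
     - 2^4 * 3^2 * 211 * c * s1^2 * s2 * s3 - 2^2 * 3^3 * 197 * c^2 * s1^3 * s2 * s3
     - 2^3 * 3^5 * c^3 * s1^4 * s2 * s3 - 2^6 * 3^2 * 5^2 * c * s2^2 * s3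
     - 2^4 * 3^3 * 107 * c^2 * s1 * s2^2 * s3 - 2^4 * 3^7 * c^3 * s1^2 * s2^2 * s3
     - 2 * 3^6 * c^4 * s1^3 * s2^2 * s3 - 2^6 * 3^5 * c^3 * s2^3 * s3
     - 2^3 * 3^7 * c^4 * s1 * s2^3 * s3 + 2^4 * 3^3 * 7^2 * 19 * c * s1 * s3^2
     + 2^2 * 3^3 * 47 * 53 * c^2 * s1^2 * s3^2 + 2^3 * 3^5 * 61 * c^3 * s1^3 * s3^2
     + 2 * 3^7 * 17 * c^4 * s1^4 * s3^2 + 2^2 * 3^4 * 701 * c^2 * s2 * s3^2
     + 2^3 * 3^6 * 7 * 13 * c^3 * s1 * s2 * s3^2 + 2^10 * 3^6 * c^4 * s1^2 * s2 * s3^2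
     + 2^4 * 3^8 * 5 * c^5 * s1^3 * s2 * s3^2 + 2 * 3^7 * 5 * 17 * c^4 * s2^2 * s3^2
     + 2^5 * 3^8 * 7 * c^5 * s1 * s2^2 * s3^2 + 2^2 * 3^9 * 17 * c^6 * s1^2 * s2^2 * s3^2
     + 2^2 * 3^9 * 11 * c^6 * s2^3 * s3^2 + 2^3 * 3^11 * c^7 * s1 * s2^3 * s3^2
     + 3^12 * c^8 * s2^4 * s3^2 - 2^3 * 3^12 * c^3 * s3^3 - 2 * 3^9 * 5 * 47 * c^4 * s1 * s3^3
     - 2^4 * 3^9 * 17 * c^5 * s1^2 * s3^3 - 2^2 * 3^9 * 5 * c^6 * s1^3 * s3^3
     - 2^6 * 3^11 * c^5 * s2 * s3^3 - 2^2 * 3^10 * 5 * 11 * c^6 * s1 * s2 * s3^3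
     - 2^3 * 3^11 * c^7 * s1^2 * s2 * s3^3 - 2^3 * 3^11 * 5 * c^7 * s2^2 * s3^3
     - 2 * 3^12 * c^8 * s1 * s2^2 * s3^3 - 2^3 * 3^12 * c^6 * s3^4
     - 2^3 * 3^12 * c^7 * s1 * s3^4 + 3^12 * c^8 * s1^2 * s3^4 - 2^2 * 3^13 * c^8 * s2 * s3^4)"

definition is_G6 :: "complex \<Rightarrow> cp1 nvgroup \<Rightarrow> bool" where
  "is_G6 c G \<longleftrightarrow>
     algebraic_nvgroup 6 CP1 G \<and> nv_regular CP1 G \<and> nv_commutative CP1 G \<and>
     nv_involutive CP1 G \<and> coset_group 6 (ec_coset_data c) G \<and>
     nunit G = Aff 0 \<and> mult_defined_by 6 (p6 c) G"

end

theory Submission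
  imports Defs "HOL-Combinatorics.Permutations"
    "HOL-Computational_Algebra.Fundamental_Theorem_Algebra"
begin

text \<open>
  The multiplication of orbits, \<open>\<pi>(u) * \<pi>(v) = [\<pi>(u + h(v)) | h]\<close> with \<open>h\<close> in the group of order
  six, inherits associativity, commutativity, the neutral element and the inverse from the group of
  points of the curve \<open>\<eta>\<^sup>2 = \<zeta>\<^sup>3 + c\<close>. It remains to see that the curve is an algebraic group, that
  the six points \<open>\<pi>(u + h(v))\<close> are the zeros of \<open>p6\<close>, and that they depend regularly on
  \<open>(\<pi>(u), \<pi>(v))\<close>.

  The group law. Two addition laws of bidegree \<open>(2, 2)\<close> without common zero describe the addition by
  polynomials in homogeneous coordinates, so addition is a morphism. In particular translations are
  polynomial maps, and two polynomial maps of the curve to itself that agree off a finite set agree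
  at all affine points (\<open>ec_polynomial_maps_eqI\<close>). Therefore associativity (\<open>ec_add_assoc\<close>) has to be
  computed only when all sums are formed by chords, where it reduces to an identity between sums of
  two slopes (\<open>ec_add_assoc_chords\<close>).

  The polynomial. The group of order six is generated by \<open>-1\<close> and the multiplication of \<open>\<zeta>\<close> by a
  cube root of unity. The points \<open>\<pi>(u + v)\<close> and \<open>\<pi>(u - v)\<close> are the zeros of a quadratic form, the
  coefficients of which are polynomials in the \<open>\<zeta>\<close>-coordinates of \<open>u\<close> and \<open>v\<close> (\<open>pair_form_zeros\<close>). The
  product of this form over the three multiples of the \<open>\<zeta>\<close>-coordinate of \<open>v\<close> by cube roots of unity
  is a norm, hence a polynomial in the squares of the \<open>\<eta>\<close>-coordinates, and this polynomial is the
  homogenization of \<open>p6\<close> (\<open>prod_pair_form\<close>).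

  Regularity. So the six points are the zeros of a binary form, the coefficients of which are
  bihomogeneous polynomials in the coordinates of \<open>\<pi>(u)\<close> and \<open>\<pi>(v)\<close>. A symmetrized multihomogeneous
  polynomial in the zeros is, by Ryser's formula, a linear combination of products of the values of
  one binary form at all the zeros. That form is a product of linear forms, and the product of the
  values of a linear form at all the zeros is, up to a common factor, a value of the form with these
  zeros. Thus symmetric functions of the zeros are polynomials in the parameters
  (\<open>transfers_symmetrized\<close>), which yields a morphism to the symmetric power
  (\<open>regular_on_form_zeros_map\<close>).

  The coset groups for \<open>c\<close> and \<open>c'\<close> correspond under \<open>(\<zeta>, \<eta>) \<mapsto> (t\<^sup>2\<zeta>, t\<^sup>3\<eta>)\<close> with \<open>t\<^sup>6 = c' / c\<close>
  (\<open>coset_isomorphic_ec\<close>).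
\<close>

section \<open>Multihomogeneous polynomials and the Zariski topology\<close>

lemma poly_fun_subst:
  assumes "poly_fun A" "\<And>i j. poly_fun (\<lambda>v. s v i j)"
  shows "poly_fun (\<lambda>v. A (s v))"
  using assms(1) by induction (auto intro: poly_fun.intros assms(2))

lemma multihomogeneous_poly_fun: "multihomogeneous d A \<Longrightarrow> poly_fun A"
  by (simp add: multihomogeneous_def)

lemma multihomogeneous_scale:
  "multihomogeneous d A \<Longrightarrow> A (v(i := (\<lambda>j. t * v i j))) = t ^ d i * A v"
  by (simp add: multihomogeneous_def)

lemma multihomogeneous_const: "multihomogeneous (\<lambda>i. 0) (\<lambda>v. a)"
  by (simp add: multihomogeneous_def poly_fun.const)

lemma multihomogeneous_zero: "multihomogeneous d (\<lambda>v. 0)"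
  by (simp add: multihomogeneous_def poly_fun.const)

lemma multihomogeneous_coord: "multihomogeneous (\<lambda>k. if k = i then 1 else 0) (\<lambda>v. v i j)"
  by (simp add: multihomogeneous_def poly_fun.coord)

lemma multihomogeneous_mult:
  "multihomogeneous d A \<Longrightarrow> multihomogeneous e B \<Longrightarrow>
    multihomogeneous (\<lambda>i. d i + e i) (\<lambda>v. A v * B v)"
  by (auto simp: multihomogeneous_def power_add intro: poly_fun.mult)

lemma multihomogeneous_add:
  "multihomogeneous d A \<Longrightarrow> multihomogeneous d B \<Longrightarrow> multihomogeneous d (\<lambda>v. A v + B v)"
  by (auto simp: multihomogeneous_def distrib_left intro: poly_fun.add)

lemma multihomogeneous_cmult: "multihomogeneous d A \<Longrightarrow> multihomogeneous d (\<lambda>v. a * A v)"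
  using multihomogeneous_mult[OF multihomogeneous_const[of a]] by simp

lemma multihomogeneous_diff:
  "multihomogeneous d A \<Longrightarrow> multihomogeneous d B \<Longrightarrow> multihomogeneous d (\<lambda>v. A v - B v)"
  using multihomogeneous_add[of d A "\<lambda>v. (-1) * B v"] multihomogeneous_cmult[of d B "-1"] by simp

lemma multihomogeneous_power:
  "multihomogeneous d A \<Longrightarrow> multihomogeneous (\<lambda>i. n * d i) (\<lambda>v. A v ^ n)"
proof (induction n)
  case 0
  then show ?case using multihomogeneous_const[of 1] by simp
next
  case (Suc n)
  then show ?case using multihomogeneous_mult[of d A "\<lambda>i. n * d i" "\<lambda>v. A v ^ n"] by simp
qed

lemma multihomogeneous_sum:
  "finite I \<Longrightarrow> (\<And>i. i \<in> I \<Longrightarrow> multihomogeneous d (A i)) \<Longrightarrow>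
    multihomogeneous d (\<lambda>v. \<Sum>i\<in>I. A i v)"
  by (induction I rule: finite_induct) (auto intro: multihomogeneous_add multihomogeneous_zero)

lemma multihomogeneous_prod:
  "finite I \<Longrightarrow> (\<And>i. i \<in> I \<Longrightarrow> multihomogeneous (d i) (A i)) \<Longrightarrow>
    multihomogeneous (\<lambda>k. \<Sum>i\<in>I. d i k) (\<lambda>v. \<Prod>i\<in>I. A i v)"
proof (induction I rule: finite_induct)
  case empty
  then show ?case using multihomogeneous_const[of 1] by simp
next
  case (insert i I)
  then show ?case
    using multihomogeneous_mult[of "d i" "A i" "\<lambda>k. \<Sum>i\<in>I. d i k" "\<lambda>v. \<Prod>i\<in>I. A i v"] by simp
qed

lemma multihomogeneous_cong:
  "multihomogeneous d A \<Longrightarrow> (\<And>i. d i = e i) \<Longrightarrow> (\<And>v. A v = B v) \<Longrightarrow> multihomogeneous e B"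
  by (simp add: multihomogeneous_def ext[of d e] ext[of A B])

text \<open>
  Multihomogeneous polynomials are closed under products, so the sets where one of them does not
  vanish are not only a subbase but a base of the topology.
\<close>

lemma openin_zariski_space:
  "openin (ftop (zariski_space S h)) U \<longleftrightarrow> U \<subseteq> S \<and>
     (\<forall>p\<in>U. \<exists>d A. multihomogeneous d A \<and> A (coord_blocks (h p)) \<noteq> 0 \<and>
        (\<forall>q\<in>S. A (coord_blocks (h q)) \<noteq> 0 \<longrightarrow> q \<in> U))" (is "?O \<longleftrightarrow> ?R U")
proof
  let ?\<B> = "{{p \<in> S. A (coord_blocks (h p)) \<noteq> 0} |A. \<exists>d. multihomogeneous d A}"
  assume ?O
  then have "generate_topology_on ?\<B> U"
    by (simp add: zariski_space_def openin_topology_generated_by)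
  then show "?R U"
  proof induction
    case (Int a b)
    show ?case
    proof (intro conjI ballI)
      fix p assume p: "p \<in> a \<inter> b"
      obtain d A where A: "multihomogeneous d A" "A (coord_blocks (h p)) \<noteq> 0"
        "\<forall>q\<in>S. A (coord_blocks (h q)) \<noteq> 0 \<longrightarrow> q \<in> a" using Int p by blast
      obtain e B where B: "multihomogeneous e B" "B (coord_blocks (h p)) \<noteq> 0"
        "\<forall>q\<in>S. B (coord_blocks (h q)) \<noteq> 0 \<longrightarrow> q \<in> b" using Int p by blast
      show "\<exists>d A. multihomogeneous d A \<and> A (coord_blocks (h p)) \<noteq> 0 \<and>
        (\<forall>q\<in>S. A (coord_blocks (h q)) \<noteq> 0 \<longrightarrow> q \<in> a \<inter> b)"
      proof (intro exI conjI ballI impI)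
        show "multihomogeneous (\<lambda>i. d i + e i) (\<lambda>v. A v * B v)"
          by (rule multihomogeneous_mult[OF A(1) B(1)])
      qed (use A B in auto)
    next
      show "a \<inter> b \<subseteq> S" using Int by blast
    qed
  next
    case (UN K)
    have "\<exists>d A. multihomogeneous d A \<and> A (coord_blocks (h p)) \<noteq> 0 \<and>
        (\<forall>q\<in>S. A (coord_blocks (h q)) \<noteq> 0 \<longrightarrow> q \<in> \<Union>K)" if p: "p \<in> \<Union>K" for p
    proof -
      obtain k where k: "k \<in> K" "p \<in> k" using p by blast
      then obtain d A where A: "multihomogeneous d A" "A (coord_blocks (h p)) \<noteq> 0"
        "\<forall>q\<in>S. A (coord_blocks (h q)) \<noteq> 0 \<longrightarrow> q \<in> k" using UN.IH by blast
      show ?thesis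
        by (rule exI[of _ d], rule exI[of _ A]) (use A k in auto)
    qed
    moreover have "\<Union>K \<subseteq> S" using UN.IH by blast
    ultimately show ?case by simp
  next
    case (Basis s)
    then obtain d A where A: "multihomogeneous d A" and s: "s = {p \<in> S. A (coord_blocks (h p)) \<noteq> 0}"
      by blast
    have "\<exists>d A. multihomogeneous d A \<and> A (coord_blocks (h p)) \<noteq> 0 \<and>
        (\<forall>q\<in>S. A (coord_blocks (h q)) \<noteq> 0 \<longrightarrow> q \<in> s)" if "p \<in> s" for p
      by (rule exI[of _ d], rule exI[of _ A]) (use A that in \<open>simp add: s\<close>)
    moreover have "s \<subseteq> S" by (simp add: s)
    ultimately show ?case by simp
  qed simp
next
  assume R: "?R U"
  define K where "K = {{p \<in> S. A (coord_blocks (h p)) \<noteq> 0} |A.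
    (\<exists>d. multihomogeneous d A) \<and> (\<forall>q\<in>S. A (coord_blocks (h q)) \<noteq> 0 \<longrightarrow> q \<in> U)}"
  have "U = \<Union>K"
  proof
    show "U \<subseteq> \<Union>K"
    proof
      fix p assume "p \<in> U"
      then obtain d A where "multihomogeneous d A" "A (coord_blocks (h p)) \<noteq> 0" "p \<in> S"
        "\<forall>q\<in>S. A (coord_blocks (h q)) \<noteq> 0 \<longrightarrow> q \<in> U" using R by blast
      then show "p \<in> \<Union>K" unfolding K_def by blast
    qed
  qed (auto simp: K_def)
  moreover have "openin (ftop (zariski_space S h)) (\<Union>K)"
    by (rule openin_Union)
      (auto simp: K_def zariski_space_def intro!: topology_generated_by_Basis)
  ultimately show ?O by simp
qed

lemma topspace_zariski_space: "topspace (ftop (zariski_space S h)) = S"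
proof -
  have "openin (ftop (zariski_space S h)) S"
    unfolding openin_zariski_space
  proof (intro conjI ballI exI impI)
    show "multihomogeneous (\<lambda>i. 0) (\<lambda>v. 1)" by (rule multihomogeneous_const)
  qed auto
  then show ?thesis
    using openin_zariski_space[of S h] by (meson openin_subset openin_topspace subset_antisym)
qed

lemma regfun_zariski_space:
  "g \<in> regfun (zariski_space S h) U \<longleftrightarrow>
     (\<forall>p\<in>U. \<exists>d A B. multihomogeneous d A \<and> multihomogeneous d B \<and> B (coord_blocks (h p)) \<noteq> 0 \<and>
        (\<forall>q\<in>U. B (coord_blocks (h q)) \<noteq> 0 \<longrightarrow>
           g q = A (coord_blocks (h q)) / B (coord_blocks (h q))))"
  by (simp add: zariski_space_def)

text \<open>
  Maps to a projective variety are recognised as morphisms by homogeneous coordinates: near every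
  point, the coordinates of the image are polynomials of a common multidegree, up to a factor that
  may vanish only away from the point.
\<close>

definition polynomial_map_at ::
  "'p set \<Rightarrow> ('p \<Rightarrow> (nat \<Rightarrow> complex) list) \<Rightarrow> 'a proj_set \<Rightarrow> ('p \<Rightarrow> 'a) \<Rightarrow> 'p \<Rightarrow> bool" where
  "polynomial_map_at S h Y f p \<longleftrightarrow> (\<exists>d P. (\<forall>j. multihomogeneous d (P j)) \<and>
     (\<exists>j. P j (coord_blocks (h p)) \<noteq> 0) \<and>
     (\<forall>q\<in>S. \<exists>t. \<forall>j. P j (coord_blocks (h q)) = t * hcoord Y (f q) j))"

lemma coord_blocks_singleton: "coord_blocks [w] = (\<lambda>i j. 0)(0 := w)"
  by (auto simp: coord_blocks_def)

lemma multihomogeneous_scale_singleton: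
  "multihomogeneous d A \<Longrightarrow> A (coord_blocks [\<lambda>j. t * w j]) = t ^ d 0 * A (coord_blocks [w])"
  using multihomogeneous_scale[of d A "coord_blocks [w]" 0 t]
  by (simp add: coord_blocks_singleton)

lemma multihomogeneous_compose:
  assumes A: "multihomogeneous e A" and P: "\<And>j. multihomogeneous d (P j)"
  shows "multihomogeneous (\<lambda>i. d i * e 0) (\<lambda>v. A (coord_blocks [\<lambda>j. P j v]))"
  unfolding multihomogeneous_def
proof (intro conjI allI)
  show "poly_fun (\<lambda>v. A (coord_blocks [\<lambda>j. P j v]))"
  proof (rule poly_fun_subst[OF multihomogeneous_poly_fun[OF A]])
    fix i j
    show "poly_fun (\<lambda>v. coord_blocks [\<lambda>j. P j v] i j)"
      using multihomogeneous_poly_fun[OF P]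
        by (cases "i = 0") (simp_all add: coord_blocks_def poly_fun.const)
  qed
  fix v i t
  show "A (coord_blocks [\<lambda>j. P j (v(i := \<lambda>j. t * v i j))]) =
    t ^ (d i * e 0) * A (coord_blocks [\<lambda>j. P j v])"
    using multihomogeneous_scale_singleton[OF A] multihomogeneous_scale[OF P]
    by (simp add: power_mult)
qed

text \<open>
  Composition with the local coordinates \<open>P\<close> of the map multiplies the value of a form of degree \<open>e\<close> at
  the image point by \<open>t\<^sup>e\<close>, where \<open>t\<close> is the factor of proportionality. This factor cancels in quotients
  of forms of equal degree.
\<close>

lemma regular_on_polynomial_map:
  assumes map: "\<And>p. p \<in> S \<Longrightarrow> f p \<in> points Y"
    and loc: "\<And>p. p \<in> S \<Longrightarrow> polynomial_map_at S h Y f p"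
  shows "regular_on (zariski_space S h) S (var_space Y) f"
  unfolding regular_on_def
proof (intro conjI allI impI ballI)
  show "openin (ftop (zariski_space S h)) S"
    using openin_topspace[of "ftop (zariski_space S h)"] by (simp add: topspace_zariski_space)
  show "f ` S \<subseteq> topspace (ftop (var_space Y))"
    using map by (auto simp: var_space_def topspace_zariski_space)
next
  fix V assume "openin (ftop (var_space Y)) V"
  then have V: "V \<subseteq> points Y" "\<And>y. y \<in> V \<Longrightarrow> \<exists>d A. multihomogeneous d A \<and>
      A (coord_blocks [hcoord Y y]) \<noteq> 0 \<and>
      (\<forall>q\<in>points Y. A (coord_blocks [hcoord Y q]) \<noteq> 0 \<longrightarrow> q \<in> V)"
    by (auto simp: var_space_def openin_zariski_space)
  have pull: "\<exists>d' P. (\<forall>j. multihomogeneous d' (P j)) \<and>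
      (\<forall>q\<in>S. \<exists>t. \<forall>e A. multihomogeneous e A \<longrightarrow>
         A (coord_blocks [\<lambda>j. P j (coord_blocks (h q))]) = t ^ e 0 * A (coord_blocks [hcoord Y (f q)]))
      \<and> (\<forall>e A. multihomogeneous e A \<and> A (coord_blocks [hcoord Y (f p)]) \<noteq> 0 \<longrightarrow>
         A (coord_blocks [\<lambda>j. P j (coord_blocks (h p))]) \<noteq> 0)"
    if p: "p \<in> S" for p
  proof -
    obtain d P where P: "\<And>j. multihomogeneous d (P j)" "\<exists>j. P j (coord_blocks (h p)) \<noteq> 0"
      "\<And>q. q \<in> S \<Longrightarrow> \<exists>t. \<forall>j. P j (coord_blocks (h q)) = t * hcoord Y (f q) j"
      using loc[OF p] unfolding polynomial_map_at_def by blast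
    have eq: "A (coord_blocks [\<lambda>j. P j (coord_blocks (h q))]) =
        t ^ e 0 * A (coord_blocks [hcoord Y (f q)])"
      if "multihomogeneous e A" "\<forall>j. P j (coord_blocks (h q)) = t * hcoord Y (f q) j" for e A q t
      using multihomogeneous_scale_singleton[OF that(1), of t "hcoord Y (f q)"] that(2) by simp
    show ?thesis
    proof (intro exI[of _ d] exI[of _ P] conjI allI ballI impI)
      fix q assume "q \<in> S"
      then show "\<exists>t. \<forall>e A. multihomogeneous e A \<longrightarrow>
         A (coord_blocks [\<lambda>j. P j (coord_blocks (h q))]) = t ^ e 0 * A (coord_blocks [hcoord Y (f q)])"
        using eq P(3) by meson
    next
      fix e A assume A: "multihomogeneous e A \<and> A (coord_blocks [hcoord Y (f p)]) \<noteq> 0"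
      obtain t where t: "\<forall>j. P j (coord_blocks (h p)) = t * hcoord Y (f p) j" using P(3) p by blast
      then have "t \<noteq> 0" using P(2) by auto
      then show "A (coord_blocks [\<lambda>j. P j (coord_blocks (h p))]) \<noteq> 0"
        using eq[OF conjunct1[OF A] t] A by simp
    qed (rule P(1))
  qed
  show "openin (ftop (zariski_space S h)) {x \<in> S. f x \<in> V}"
    unfolding openin_zariski_space
  proof (intro conjI ballI)
    fix p assume "p \<in> {x \<in> S. f x \<in> V}"
    then have p: "p \<in> S" "f p \<in> V" by auto
    obtain e A where A: "multihomogeneous e A" "A (coord_blocks [hcoord Y (f p)]) \<noteq> 0"
      "\<forall>q\<in>points Y. A (coord_blocks [hcoord Y q]) \<noteq> 0 \<longrightarrow> q \<in> V" using V(2)[OF p(2)] by blast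
    obtain d P where P: "\<And>j. multihomogeneous d (P j)" and
      P2: "\<forall>q\<in>S. \<exists>t. \<forall>e A. multihomogeneous e A \<longrightarrow>
         A (coord_blocks [\<lambda>j. P j (coord_blocks (h q))]) = t ^ e 0 * A (coord_blocks [hcoord Y (f q)])"
      and P3: "\<forall>e A. multihomogeneous e A \<and> A (coord_blocks [hcoord Y (f p)]) \<noteq> 0 \<longrightarrow>
         A (coord_blocks [\<lambda>j. P j (coord_blocks (h p))]) \<noteq> 0"
      using pull[OF p(1)] by blast
    show "\<exists>d A. multihomogeneous d A \<and> A (coord_blocks (h p)) \<noteq> 0 \<and>
        (\<forall>q\<in>S. A (coord_blocks (h q)) \<noteq> 0 \<longrightarrow> q \<in> {x \<in> S. f x \<in> V})"
    proof (intro exI conjI ballI impI)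
      show "multihomogeneous (\<lambda>i. d i * e 0) (\<lambda>v. A (coord_blocks [\<lambda>j. P j v]))"
        by (rule multihomogeneous_compose[OF A(1) P])
      show "A (coord_blocks [\<lambda>j. P j (coord_blocks (h p))]) \<noteq> 0" using P3 A by blast
      fix q assume q: "q \<in> S" "A (coord_blocks [\<lambda>j. P j (coord_blocks (h q))]) \<noteq> 0"
      then have "A (coord_blocks [hcoord Y (f q)]) \<noteq> 0" using P2 A(1) by fastforce
      then show "q \<in> {x \<in> S. f x \<in> V}" using A(3) q(1) map by blast
    qed
  qed auto
  fix g assume g: "g \<in> regfun (var_space Y) V"
  show "g \<circ> f \<in> regfun (zariski_space S h) {x \<in> S. f x \<in> V}"
    unfolding regfun_zariski_space
  proof
    fix p assume "p \<in> {x \<in> S. f x \<in> V}"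
    then have p: "p \<in> S" "f p \<in> V" by auto
    obtain e A B where AB: "multihomogeneous e A" "multihomogeneous e B"
      "B (coord_blocks [hcoord Y (f p)]) \<noteq> 0"
      "\<forall>q\<in>V. B (coord_blocks [hcoord Y q]) \<noteq> 0 \<longrightarrow>
         g q = A (coord_blocks [hcoord Y q]) / B (coord_blocks [hcoord Y q])"
      using g p(2) unfolding var_space_def regfun_zariski_space by blast
    obtain d P where P: "\<And>j. multihomogeneous d (P j)" and
      P2: "\<forall>q\<in>S. \<exists>t. \<forall>e A. multihomogeneous e A \<longrightarrow>
         A (coord_blocks [\<lambda>j. P j (coord_blocks (h q))]) = t ^ e 0 * A (coord_blocks [hcoord Y (f q)])"
      and P3: "\<forall>e A. multihomogeneous e A \<and> A (coord_blocks [hcoord Y (f p)]) \<noteq> 0 \<longrightarrow>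
         A (coord_blocks [\<lambda>j. P j (coord_blocks (h p))]) \<noteq> 0"
      using pull[OF p(1)] by blast
    show "\<exists>d A B. multihomogeneous d A \<and> multihomogeneous d B \<and> B (coord_blocks (h p)) \<noteq> 0 \<and>
        (\<forall>q\<in>{x \<in> S. f x \<in> V}. B (coord_blocks (h q)) \<noteq> 0 \<longrightarrow>
           (g \<circ> f) q = A (coord_blocks (h q)) / B (coord_blocks (h q)))"
    proof (intro exI conjI ballI impI)
      show "multihomogeneous (\<lambda>i. d i * e 0) (\<lambda>v. A (coord_blocks [\<lambda>j. P j v]))"
        "multihomogeneous (\<lambda>i. d i * e 0) (\<lambda>v. B (coord_blocks [\<lambda>j. P j v]))"
        by (rule multihomogeneous_compose[OF _ P], fact)+
      show "B (coord_blocks [\<lambda>j. P j (coord_blocks (h p))]) \<noteq> 0" using P3 AB by blast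
      fix q assume q: "q \<in> {x \<in> S. f x \<in> V}" "B (coord_blocks [\<lambda>j. P j (coord_blocks (h q))]) \<noteq> 0"
      then obtain t where t: "\<And>e A. multihomogeneous e A \<Longrightarrow>
         A (coord_blocks [\<lambda>j. P j (coord_blocks (h q))]) = t ^ e 0 * A (coord_blocks [hcoord Y (f q)])"
        using P2 by blast
      show "(g \<circ> f) q = A (coord_blocks [\<lambda>j. P j (coord_blocks (h q))]) /
          B (coord_blocks [\<lambda>j. P j (coord_blocks (h q))])"
        using AB(4) q t[OF AB(1)] t[OF AB(2)] by auto
    qed
  qed
qed

lemma poly_fun_cmult: "poly_fun A \<Longrightarrow> poly_fun (\<lambda>v. a * A v)"
  by (intro poly_fun.mult poly_fun.const)

lemma poly_fun_diff:
  assumes "poly_fun A" "poly_fun B" shows "poly_fun (\<lambda>v. A v - B v)"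
  using poly_fun.add[OF assms(1) poly_fun_cmult[OF assms(2), of "-1"]] by simp

lemma poly_fun_tendsto:
  assumes "poly_fun A" "\<And>i j. (\<lambda>k. v k i j) \<longlonglongrightarrow> l i j"
  shows "(\<lambda>k. A (v k)) \<longlonglongrightarrow> A l"
  using assms(1) by induction (auto intro!: tendsto_intros assms(2))

lemma polynomial_map_at_compose:
  assumes f: "polynomial_map_at S h Y f p" "f ` S \<subseteq> points Y" "p \<in> S"
    and g: "polynomial_map_at (points Y) (\<lambda>y. [hcoord Y y]) Z g (f p)"
  shows "polynomial_map_at S h Z (\<lambda>p. g (f p)) p"
proof -
  obtain d P where P: "\<And>j. multihomogeneous d (P j)" "\<exists>j. P j (coord_blocks (h p)) \<noteq> 0"
    "\<And>q. q \<in> S \<Longrightarrow> \<exists>t. \<forall>j. P j (coord_blocks (h q)) = t * hcoord Y (f q) j"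
    using f(1) unfolding polynomial_map_at_def by blast
  obtain e Q where Q: "\<And>j. multihomogeneous e (Q j)" "\<exists>j. Q j (coord_blocks [hcoord Y (f p)]) \<noteq> 0"
    "\<And>q. q \<in> points Y \<Longrightarrow> \<exists>t. \<forall>j. Q j (coord_blocks [hcoord Y q]) = t * hcoord Z (g q) j"
    using g unfolding polynomial_map_at_def by blast
  have eq: "Q j (coord_blocks [\<lambda>j. P j (coord_blocks (h q))]) =
      t ^ e 0 * Q j (coord_blocks [hcoord Y (f q)])"
    if "\<forall>j. P j (coord_blocks (h q)) = t * hcoord Y (f q) j" for j q t
    using multihomogeneous_scale_singleton[OF Q(1), of j t "hcoord Y (f q)"] that by simp
  show ?thesis
    unfolding polynomial_map_at_def
  proof (intro exI[of _ "\<lambda>i. d i * e 0"] exI[of _ "\<lambda>j v. Q j (coord_blocks [\<lambda>j. P j v])"]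
      conjI allI ballI)
    show "multihomogeneous (\<lambda>i. d i * e 0) (\<lambda>v. Q j (coord_blocks [\<lambda>j. P j v]))" for j
      by (rule multihomogeneous_compose[OF Q(1) P(1)])
    obtain t where t: "\<forall>j. P j (coord_blocks (h p)) = t * hcoord Y (f p) j" using P(3)[OF f(3)]
      by blast
    then have "t \<noteq> 0" using P(2) by auto
    then show "\<exists>j. Q j (coord_blocks [\<lambda>j. P j (coord_blocks (h p))]) \<noteq> 0"
      unfolding eq[OF t] using Q(2) by simp
    fix q assume q: "q \<in> S"
    obtain t where t: "\<forall>j. P j (coord_blocks (h q)) = t * hcoord Y (f q) j" using P(3)[OF q]
      by blast
    obtain t' where t': "\<forall>j. Q j (coord_blocks [hcoord Y (f q)]) = t' * hcoord Z (g (f q)) j"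
      using Q(3)[of "f q"] f(2) q by blast
    show "\<exists>t. \<forall>j. Q j (coord_blocks [\<lambda>j. P j (coord_blocks (h q))]) = t * hcoord Z (g (f q)) j"
      unfolding eq[OF t] using t' by (intro exI[of _ "t ^ e 0 * t'"]) simp
  qed
qed

lemma poly_fun_if: "poly_fun A \<Longrightarrow> poly_fun B \<Longrightarrow> poly_fun (\<lambda>v. if b then A v else B v)"
  by (cases b) simp_all

lemma regular_on_zariski_space_cong:
  assumes fg: "\<And>x. x \<in> U \<Longrightarrow> f x = g x" and f: "regular_on (zariski_space S h) U Y f"
  shows "regular_on (zariski_space S h) U Y g"
proof -
  have eq: "{x \<in> U. g x \<in> V} = {x \<in> U. f x \<in> V}" "g ` U = f ` U" for V using fg by auto
  have "k \<circ> g \<in> regfun (zariski_space S h) W"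
    if "k \<circ> f \<in> regfun (zariski_space S h) W" "W \<subseteq> U" for k W
  proof -
    have "(k \<circ> g) q = (k \<circ> f) q" if "q \<in> W" for q using fg that \<open>W \<subseteq> U\<close> by auto
    then show ?thesis using that(1) unfolding regfun_zariski_space by simp
  qed
  then show ?thesis using f unfolding regular_on_def eq by blast
qed

section \<open>Morphisms to symmetric powers of the projective line\<close>

text \<open>
  Ryser's formula for the permanent: it polarizes the symmetrization of a product of different
  functions into products of values of one function.
\<close>

lemma sum_permutations_prod_eq_Ryser:
  fixes g :: "nat \<Rightarrow> nat \<Rightarrow> 'a :: comm_ring_1"
  shows "(\<Sum>\<sigma> | \<sigma> permutes {..<n}. \<Prod>i<n. g i (\<sigma> i)) =
    (\<Sum>X\<in>Pow {..<n}. (-1) ^ card ({..<n} - X) * (\<Prod>i<n. \<Sum>j\<in>X. g i j))"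
proof -
  define I where "I = {..<n}"
  have fin: "finite I" "finite (PiE I (\<lambda>i. I))" by (simp_all add: I_def finite_PiE)
  \<comment> \<open>The sign-weighted number of sets between the range of a map and \<open>I\<close> detects surjectivity.\<close>
  have sign: "(\<Sum>X\<in>Pow I. if \<phi> ` I \<subseteq> X then (-1) ^ card (I - X) else 0) =
      (if \<phi> ` I = I then 1 else (0::'a))" if \<phi>: "\<phi> \<in> PiE I (\<lambda>i. I)" for \<phi>
  proof -
    have "(\<Sum>X\<in>Pow I. if \<phi> ` I \<subseteq> X then (-1) ^ card (I - X) else 0) =
        (\<Sum>X\<in>Pow I. (\<Prod>j\<in>X. 1) * (\<Prod>j\<in>I - X. if j \<in> \<phi> ` I then 0 else (-1 :: 'a)))"
    proof (rule sum.cong[OF refl])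
      fix X assume X: "X \<in> Pow I"
      show "(if \<phi> ` I \<subseteq> X then (-1) ^ card (I - X) else 0) =
        (\<Prod>j\<in>X. 1) * (\<Prod>j\<in>I - X. if j \<in> \<phi> ` I then 0 else (-1 :: 'a))"
      proof (cases "\<phi> ` I \<subseteq> X")
        case True
        then have "(\<Prod>j\<in>I - X. if j \<in> \<phi> ` I then 0 else (-1 :: 'a)) = (\<Prod>j\<in>I - X. -1)"
          by (intro prod.cong) auto
        then show ?thesis using True by simp
      next
        case False
        then obtain j where "j \<in> \<phi> ` I" "j \<in> I - X" using \<phi> by blast
        then have "(\<Prod>j\<in>I - X. if j \<in> \<phi> ` I then 0 else (-1 :: 'a)) = 0"
          using fin by (intro prod_zero) auto
        then show ?thesis using False by simp
      qed
    qed
    also have "\<dots> = (\<Prod>j\<in>I. 1 + (if j \<in> \<phi> ` I then 0 else -1))"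
      by (rule prod_add[OF fin(1), symmetric])
    also have "\<dots> = (if \<phi> ` I = I then 1 else 0)"
    proof (cases "\<phi> ` I = I")
      case True
      then show ?thesis by simp
    next
      case False
      then obtain j where "j \<in> I" "j \<notin> \<phi> ` I" using \<phi> by blast
      then show ?thesis using False fin by (auto intro!: prod_zero)
    qed
    finally show ?thesis .
  qed
  have "(\<Sum>X\<in>Pow I. (-1) ^ card (I - X) * (\<Prod>i\<in>I. \<Sum>j\<in>X. g i j)) =
      (\<Sum>X\<in>Pow I. \<Sum>\<phi>\<in>PiE I (\<lambda>i. I).
        (if \<phi> ` I \<subseteq> X then (-1) ^ card (I - X) else 0) * (\<Prod>i\<in>I. g i (\<phi> i)))"
  proof (rule sum.cong[OF refl])
    fix X assume X: "X \<in> Pow I"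
    have sub: "{\<phi> \<in> PiE I (\<lambda>i. I). \<phi> ` I \<subseteq> X} = PiE I (\<lambda>i. X)"
      using X by (auto simp: PiE_def Pi_def)
    have "(\<Prod>i\<in>I. \<Sum>j\<in>X. g i j) = (\<Sum>\<phi>\<in>PiE I (\<lambda>i. X). \<Prod>i\<in>I. g i (\<phi> i))"
      using X fin(1) by (intro prod_sum_PiE) (auto intro: finite_subset)
    also have "\<dots> = (\<Sum>\<phi>\<in>PiE I (\<lambda>i. I). if \<phi> ` I \<subseteq> X then \<Prod>i\<in>I. g i (\<phi> i) else 0)"
      unfolding sub[symmetric] using fin(2) by (simp add: sum.inter_filter)
    finally show "(-1) ^ card (I - X) * (\<Prod>i\<in>I. \<Sum>j\<in>X. g i j) = (\<Sum>\<phi>\<in>PiE I (\<lambda>i. I).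
        (if \<phi> ` I \<subseteq> X then (-1) ^ card (I - X) else 0) * (\<Prod>i\<in>I. g i (\<phi> i)))"
      by (simp add: sum_distrib_left) (auto intro!: sum.cong)
  qed
  also have "\<dots> = (\<Sum>\<phi>\<in>PiE I (\<lambda>i. I). if \<phi> ` I = I then \<Prod>i\<in>I. g i (\<phi> i) else 0)"
    by (subst sum.swap, rule sum.cong) (auto simp: sign simp flip: sum_distrib_right)
  also have "\<dots> = (\<Sum>\<phi>\<in>{\<phi> \<in> PiE I (\<lambda>i. I). \<phi> ` I = I}. \<Prod>i\<in>I. g i (\<phi> i))"
    using fin(2) by (simp add: sum.inter_filter)
  also have "\<dots> = (\<Sum>\<sigma> | \<sigma> permutes I. \<Prod>i\<in>I. g i (\<sigma> i))"
  proof (rule sum.reindex_bij_witness[where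
        i = "\<lambda>\<sigma>. restrict \<sigma> I" and j = "\<lambda>\<phi> i. if i \<in> I then \<phi> i else i"])
    fix \<phi> assume "\<phi> \<in> {\<phi> \<in> PiE I (\<lambda>i. I). \<phi> ` I = I}"
    then have \<phi>: "\<phi> \<in> PiE I (\<lambda>i. I)" "\<phi> ` I = I" by auto
    then show "restrict (\<lambda>i. if i \<in> I then \<phi> i else i) I = \<phi>"
      by (auto simp: fun_eq_iff PiE_def extensional_def)
    have "bij_betw \<phi> I I" using \<phi>(2) fin(1)
      by (simp add: bij_betw_def finite_surj_inj)
    then have "bij_betw (\<lambda>i. if i \<in> I then \<phi> i else i) I I"
      by (subst bij_betw_cong[of I _ \<phi>]) auto
    then show "(\<lambda>i. if i \<in> I then \<phi> i else i) \<in> {\<sigma>. \<sigma> permutes I}"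
      by (auto intro: bij_imp_permutes)
  next
    fix \<sigma> assume "\<sigma> \<in> {\<sigma>. \<sigma> permutes I}"
    then have \<sigma>: "\<sigma> permutes I" by simp
    show "(\<lambda>i. if i \<in> I then restrict \<sigma> I i else i) = \<sigma>"
      using permutes_not_in[OF \<sigma>] by auto
    have "restrict \<sigma> I ` I = I" using permutes_image[OF \<sigma>] by simp
    moreover have "restrict \<sigma> I \<in> PiE I (\<lambda>i. I)"
      using permutes_in_image[OF \<sigma>] by auto
    ultimately show "restrict \<sigma> I \<in> {\<phi> \<in> PiE I (\<lambda>i. I). \<phi> ` I = I}" by simp
  qed simp
  finally show ?thesis by (simp add: I_def)
qed

lemma sum_permutations_prod_transpose:
  fixes g :: "nat \<Rightarrow> nat \<Rightarrow> 'a :: comm_ring_1"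
  shows "(\<Sum>\<sigma> | \<sigma> permutes {..<n}. \<Prod>i<n. g i (\<sigma> i)) =
    (\<Sum>\<sigma> | \<sigma> permutes {..<n}. \<Prod>i<n. g (\<sigma> i) i)"
proof -
  have "(\<Sum>\<sigma> | \<sigma> permutes {..<n}. \<Prod>i<n. g i (\<sigma> i)) =
      (\<Sum>\<sigma> | \<sigma> permutes {..<n}. \<Prod>i<n. g i (inv_into UNIV \<sigma> i))"
    by (rule sum_permutations_inverse)
  also have "\<dots> = (\<Sum>\<sigma> | \<sigma> permutes {..<n}. \<Prod>i<n. g (\<sigma> i) i)"
  proof (rule sum.cong[OF refl])
    fix \<sigma> assume "\<sigma> \<in> {\<sigma>. \<sigma> permutes {..<n}}"
    then have \<sigma>: "\<sigma> permutes {..<n}" by simp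
    show "(\<Prod>i<n. g i (inv_into UNIV \<sigma> i)) = (\<Prod>i<n. g (\<sigma> i) i)"
      using prod.permute[OF \<sigma>, of "\<lambda>i. g i (inv_into UNIV \<sigma> i)"] permutes_inverses[OF \<sigma>]
        by (simp add: o_def)
  qed
  finally show ?thesis .
qed

text \<open>
  If all these power sums were zero, then so would be the sum of \<open>a\<^sub>i\<^sup>2 p(a\<^sub>i)\<close> for every polynomial \<open>p\<close>.
  The lemma makes a symmetrized power of a polynomial nonzero at a given point. Exponents
  from two on are needed for the numerators of quotients \<open>A / B\<close>, where a power of \<open>B\<close>
  with positive exponent remains.
\<close>

lemma power_sum_nonzero:
  fixes a :: "'b \<Rightarrow> complex"
  assumes "finite I" "i \<in> I" "a i \<noteq> 0"
  shows "\<exists>k\<ge>2. (\<Sum>i\<in>I. a i ^ k) \<noteq> 0"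
proof (rule ccontr)
  assume "\<not> ?thesis"
  then have zero: "(\<Sum>i\<in>I. a i ^ (k + 2)) = 0" for k by (metis le_add2)
  have lin: "(\<Sum>j\<in>I. a j ^ 2 * poly p (a j)) = 0" for p
  proof -
    have "(\<Sum>j\<in>I. a j ^ 2 * poly p (a j)) = (\<Sum>j\<in>I. \<Sum>k\<le>degree p. coeff p k * a j ^ (k + 2))"
      by (simp add: poly_altdef sum_distrib_left power_add mult_ac power2_eq_square)
    also have "\<dots> = (\<Sum>k\<le>degree p. coeff p k * (\<Sum>j\<in>I. a j ^ (k + 2)))"
      unfolding sum_distrib_left by (rule sum.swap)
    finally show ?thesis unfolding zero by simp
  qed
  \<comment> \<open>\<open>p\<close> vanishes at all the values except \<open>a i\<close>.\<close>
  define p where "p = (\<Prod>b\<in>a ` I - {a i}. [:- b, 1:])"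
  have p0: "poly p (a j) = 0" if "j \<in> I" "a j \<noteq> a i" for j
    unfolding p_def poly_prod using that assms(1) by (intro prod_zero) auto
  have p1: "poly p (a i) \<noteq> 0"
    unfolding p_def poly_prod using assms(1) by (subst prod_zero_iff) auto
  have "0 = (\<Sum>j\<in>I. a j ^ 2 * poly p (a j))" by (simp add: lin)
  also have "\<dots> = (\<Sum>j\<in>I. if a j = a i then a i ^ 2 * poly p (a i) else 0)"
    by (rule sum.cong) (auto simp: p0)
  also have "\<dots> = of_nat (card {j \<in> I. a j = a i}) * (a i ^ 2 * poly p (a i))"
    using assms(1) by (simp add: sum.inter_filter[symmetric])
  finally have "card {j \<in> I. a j = a i} = 0" using p1 assms(3) by simp
  then show False using assms by (auto simp: card_eq_0_iff)
qed

text \<open>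
  At a list of \<open>n\<close> points of the projective line only two variables in each of the first \<open>n\<close> blocks
  can be nonzero, so polynomials are needed only at these arguments.
\<close>

definition line_blocks :: "nat \<Rightarrow> (nat \<Rightarrow> complex) \<Rightarrow> (nat \<Rightarrow> complex) \<Rightarrow> nat \<Rightarrow> nat \<Rightarrow> complex" where
  "line_blocks n s t = (\<lambda>i j. if i < n then if j = 0 then s i else if j = 1 then t i else 0 else 0)"

definition line_monomial ::
  "nat \<Rightarrow> (nat \<Rightarrow> nat \<times> nat) \<Rightarrow> (nat \<Rightarrow> complex) \<Rightarrow> (nat \<Rightarrow> complex) \<Rightarrow> complex" where
  "line_monomial n m s t = (\<Prod>i<n. s i ^ fst (m i) * t i ^ snd (m i))"

lemma line_monomial_mult:
  "line_monomial n m s t * line_monomial n m' s t =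
    line_monomial n (\<lambda>i. (fst (m i) + fst (m' i), snd (m i) + snd (m' i))) s t"
  by (simp add: line_monomial_def power_add mult_ac flip: prod.distrib)

lemma line_monomial_scale:
  assumes "i < n"
  shows "line_monomial n m (s(i := l * s i)) (t(i := l * t i)) =
    l ^ (fst (m i) + snd (m i)) * line_monomial n m s t"
proof -
  have "line_monomial n m (s(i := l * s i)) (t(i := l * t i)) =
      (\<Prod>k<n. (if k = i then l ^ (fst (m i) + snd (m i)) else 1) *
        (s k ^ fst (m k) * t k ^ snd (m k)))"
    unfolding line_monomial_def
    by (rule prod.cong) (auto simp: power_mult_distrib power_add mult_ac)
  then show ?thesis using assms by (simp add: prod.distrib line_monomial_def)
qed

lemma poly_fun_sum_monomials:
  assumes "poly_fun A"
  shows "\<exists>L. \<forall>s t. A (line_blocks n s t) = (\<Sum>(c, m)\<leftarrow>L. c * line_monomial n m s t)"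
  using assms
proof induction
  case (const a)
  show ?case
    by (rule exI[of _ "[(a, \<lambda>i. (0, 0))]"]) (simp add: line_monomial_def)
next
  case (coord i j)
  consider "i < n" "j = 0" | "i < n" "j = 1" | "i \<ge> n \<or> j > 1" by linarith
  then show ?case
  proof cases
    case 1
    then show ?thesis
      by (intro exI[of _ "[(1, (\<lambda>k. (if k = i then 1 else 0, 0)))]"])
        (simp add: line_monomial_def line_blocks_def if_distrib[of "power _"] cong: if_cong)
  next
    case 2
    then show ?thesis
      by (intro exI[of _ "[(1, (\<lambda>k. (0, if k = i then 1 else 0)))]"])
        (simp add: line_monomial_def line_blocks_def if_distrib[of "power _"] cong: if_cong)
  next
    case 3
    then show ?thesis by (intro exI[of _ "[]"]) (auto simp: line_blocks_def)
  qed
next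
  case (add A B)
  then obtain L L' where "\<forall>s t. A (line_blocks n s t) = (\<Sum>(c, m)\<leftarrow>L. c * line_monomial n m s t)"
    "\<forall>s t. B (line_blocks n s t) = (\<Sum>(c, m)\<leftarrow>L'. c * line_monomial n m s t)" by blast
  then show ?case by (intro exI[of _ "L @ L'"]) simp
next
  case (mult A B)
  then obtain L L' where L: "\<And>s t. A (line_blocks n s t) = (\<Sum>(c, m)\<leftarrow>L. c * line_monomial n m s t)"
    "\<And>s t. B (line_blocks n s t) = (\<Sum>(c, m)\<leftarrow>L'. c * line_monomial n m s t)" by blast
  define mul where "mul = (\<lambda>(c, m) (c', m').
    (c * c' :: complex, \<lambda>i :: nat. (fst (m i) + fst (m' i), snd (m i) + snd (m' i)) :: nat \<times> nat))"
  have single: "(\<Sum>(c, m)\<leftarrow>map (mul x) L'. c * line_monomial n m s t) =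
      (case x of (c, m) \<Rightarrow> c * line_monomial n m s t) * (\<Sum>(c, m)\<leftarrow>L'. c * line_monomial n m s t)"
    for x s t
    by (induction L')
      (auto simp: mul_def algebra_simps line_monomial_mult[symmetric] split: prod.splits)
  have "(\<Sum>(c, m)\<leftarrow>concat (map (\<lambda>x. map (mul x) L') L). c * line_monomial n m s t) =
      (\<Sum>(c, m)\<leftarrow>L. c * line_monomial n m s t) * (\<Sum>(c, m)\<leftarrow>L'. c * line_monomial n m s t)" for s t
    by (induction L) (simp_all add: single distrib_right del: map_map)
  then show ?case using L by (intro exI[of _ "concat (map (\<lambda>x. map (mul x) L') L)"]) simp
qed

text \<open>Comparing powers of the scaling factors selects the monomials of the right multidegree.\<close>

lemma multihomogeneous_sum_monomials:
  assumes A: "multihomogeneous d A"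
  shows "\<exists>L. (\<forall>(c, m)\<in>set L. \<forall>i<n. fst (m i) + snd (m i) = d i) \<and>
    (\<forall>s t. A (line_blocks n s t) = (\<Sum>(c, m)\<leftarrow>L. c * line_monomial n m s t))"
proof -
  have "\<exists>L. (\<forall>(c, m)\<in>set L. \<forall>i<r. fst (m i) + snd (m i) = d i) \<and>
    (\<forall>s t. A (line_blocks n s t) = (\<Sum>(c, m)\<leftarrow>L. c * line_monomial n m s t))" if "r \<le> n" for r
    using that
  proof (induction r)
    case 0
    then show ?case using poly_fun_sum_monomials[OF multihomogeneous_poly_fun[OF A]] by simp
  next
    case (Suc r)
    then obtain L where L: "\<forall>(c, m)\<in>set L. \<forall>i<r. fst (m i) + snd (m i) = d i"
      "\<And>s t. A (line_blocks n s t) = (\<Sum>(c, m)\<leftarrow>L. c * line_monomial n m s t)" by auto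
    define P where "P = (\<lambda>(c :: complex, m :: nat \<Rightarrow> nat \<times> nat). fst (m r) + snd (m r) = d r)"
    have "A (line_blocks n s t) = (\<Sum>(c, m)\<leftarrow>filter P L. c * line_monomial n m s t)" for s t
    proof -
      define p where "p = (\<Sum>(c, m)\<leftarrow>L. monom (c * line_monomial n m s t) (fst (m r) + snd (m r))) -
        monom (A (line_blocks n s t)) (d r)"
      have poly_sum: "poly (\<Sum>(c, m)\<leftarrow>L. monom (c * line_monomial n m s t) (fst (m r) + snd (m r))) l
          = (\<Sum>(c, m)\<leftarrow>L. c * line_monomial n m (s(r := l * s r)) (t(r := l * t r)))" for l
        using Suc.prems
        by (induction L) (auto simp: poly_monom line_monomial_scale mult_ac)
      have scale: "line_blocks n (s(r := l * s r)) (t(r := l * t r)) =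
          (line_blocks n s t)(r := (\<lambda>j. l * line_blocks n s t r j))" for l
        by (auto simp: line_blocks_def fun_eq_iff)
      have "poly p l = 0" for l
        unfolding p_def poly_diff poly_sum L(2)[symmetric] scale multihomogeneous_scale[OF A]
        by (simp add: poly_monom)
      then have "coeff p (d r) = 0" using poly_all_0_iff_0 by (metis coeff_0)
      moreover have "coeff (\<Sum>(c, m)\<leftarrow>L. monom (c * line_monomial n m s t) (fst (m r) + snd (m r))) (d r)
          = (\<Sum>(c, m)\<leftarrow>filter P L. c * line_monomial n m s t)"
        by (induction L) (auto simp: P_def)
      ultimately show ?thesis by (simp add: p_def)
    qed
    moreover have "\<forall>(c, m)\<in>set (filter P L). \<forall>i<Suc r. fst (m i) + snd (m i) = d i"
      using L(1) by (auto simp: P_def less_Suc_eq)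
    ultimately show ?case by blast
  qed
  then show ?thesis by blast
qed

text \<open>
  Dehomogenization may lower the degree; each missing root contributes a factor \<open>x0\<close>.
\<close>

lemma binary_form_factorization:
  fixes m :: "'i \<Rightarrow> nat \<times> nat"
  assumes "finite X" "\<And>i. i \<in> X \<Longrightarrow> fst (m i) + snd (m i) = D"
  shows "\<exists>\<kappa> \<alpha> \<beta>. \<forall>x0 x1 :: complex. (\<Sum>i\<in>X. x0 ^ fst (m i) * x1 ^ snd (m i)) =
    \<kappa> * (\<Prod>l<D. \<alpha> l * x0 + \<beta> l * x1)"
proof -
  define p :: "complex poly" where "p = (\<Sum>i\<in>X. monom 1 (snd (m i)))"
  have deg: "degree p \<le> D"
    unfolding p_def
  proof (rule degree_sum_le[OF assms(1)])
    fix i assume "i \<in> X"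
    then have "snd (m i) \<le> D" using assms(2)[of i] by simp
    then show "degree (monom (1 :: complex) (snd (m i))) \<le> D"
      using degree_monom_le order.trans by blast
  qed
  obtain root where root: "smult (lead_coeff p) (\<Prod>i<degree p. [:- root i, 1:]) = p"
    using complex_poly_decompose' by blast
  define \<alpha> where "\<alpha> l = (if l < degree p then - root l else 1)" for l
  define \<beta> :: "nat \<Rightarrow> complex" where "\<beta> l = (if l < degree p then 1 else 0)" for l
  have split: "(\<Prod>l<D. F l) = (\<Prod>l<degree p. F l) * (\<Prod>l=degree p..<D. F l)" for F :: "nat \<Rightarrow> complex"
    using prod.atLeastLessThan_concat[of 0 "degree p" D F] deg by (simp add: lessThan_atLeast0)
  have "(\<Sum>i\<in>X. x0 ^ fst (m i) * x1 ^ snd (m i)) = lead_coeff p * (\<Prod>l<D. \<alpha> l * x0 + \<beta> l * x1)"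
    for x0 x1 :: complex
  proof (cases "x0 = 0")
    case False
    have "(\<Sum>i\<in>X. x0 ^ fst (m i) * x1 ^ snd (m i)) = x0 ^ D * poly p (x1 / x0)"
      unfolding p_def poly_sum sum_distrib_left
    proof (rule sum.cong[OF refl])
      fix i assume "i \<in> X"
      then have "x0 ^ D = x0 ^ fst (m i) * x0 ^ snd (m i)"
        using assms(2) by (simp flip: power_add)
      then show "x0 ^ fst (m i) * x1 ^ snd (m i) = x0 ^ D * poly (monom 1 (snd (m i))) (x1 / x0)"
        using False by (simp add: poly_monom power_divide)
    qed
    also have "poly p (x1 / x0) = lead_coeff p * (\<Prod>l<degree p. x1 / x0 - root l)"
      by (subst root[symmetric]) (simp add: poly_prod)
    also have "x0 ^ D * (lead_coeff p * (\<Prod>l<degree p. x1 / x0 - root l)) =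
        lead_coeff p * ((\<Prod>l<degree p. x0 * (x1 / x0 - root l)) * x0 ^ (D - degree p))"
      using deg by (simp add: prod.distrib mult_ac flip: power_add)
    also have "\<dots> = lead_coeff p * (\<Prod>l<D. \<alpha> l * x0 + \<beta> l * x1)"
      unfolding split using False by (simp add: \<alpha>_def \<beta>_def algebra_simps)
    finally show ?thesis .
  next
    case True
    have "(\<Sum>i\<in>X. x0 ^ fst (m i) * x1 ^ snd (m i)) = (\<Sum>i\<in>X. (if snd (m i) = D then 1 else 0) * x1 ^ D)"
    proof (rule sum.cong[OF refl])
      fix i assume "i \<in> X"
      then have "fst (m i) + snd (m i) = D" using assms(2) by simp
      then show "x0 ^ fst (m i) * x1 ^ snd (m i) = (if snd (m i) = D then 1 else 0) * x1 ^ D"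
        using True by (cases "fst (m i) = 0") auto
    qed
    also have "\<dots> = coeff p D * x1 ^ D"
      by (simp add: p_def coeff_sum sum_distrib_right)
    also have "\<dots> = lead_coeff p * (\<Prod>l<D. \<alpha> l * x0 + \<beta> l * x1)"
    proof (cases "degree p = D")
      case False
      then have "degree p < D" using deg by simp
      then have "(\<Prod>l<D. \<alpha> l * x0 + \<beta> l * x1) = 0"
        using True by (intro prod_zero) (auto intro!: bexI[of _ "degree p"] simp: \<beta>_def)
      then show ?thesis using \<open>degree p < D\<close> by (simp add: coeff_eq_0)
    qed (use True in \<open>simp add: \<alpha>_def \<beta>_def\<close>)
    finally show ?thesis .
  qed
  then show ?thesis by blast
qed

lemma hcoord_CP1: "hcoord CP1 p j = (if j = 0 then coord0 p else if j = 1 then coord1 p else 0)"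
  by (simp add: CP1_def)

lemma points_CP1 [simp]: "points CP1 = UNIV"
  by (simp add: CP1_def)

lemma coord_blocks_CP1:
  "length ps = n \<Longrightarrow> coord_blocks (map (hcoord CP1) ps) =
    line_blocks n (\<lambda>i. coord0 (ps ! i)) (\<lambda>i. coord1 (ps ! i))"
  by (auto simp: coord_blocks_def line_blocks_def hcoord_CP1 fun_eq_iff)

text \<open>
  A setting in which a map to multisets is shown to be regular without reference to the curve: the
  multisets are the zeros of binary forms with polynomial coefficients.
\<close>

locale form_zeros_map =
  fixes S :: "'p set" and h :: "'p \<Rightarrow> (nat \<Rightarrow> complex) list" and f :: "'p \<Rightarrow> cp1 multiset"
    and n :: nat and e :: "nat \<Rightarrow> nat"
    and \<Phi> :: "complex \<Rightarrow> complex \<Rightarrow> (nat \<Rightarrow> nat \<Rightarrow> complex) \<Rightarrow> complex"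
  assumes multihomogeneous_form: "\<And>z1 z0. multihomogeneous e (\<Phi> z1 z0)"
    and form_zeros: "\<And>p. p \<in> S \<Longrightarrow> form_zeros n (\<lambda>z1 z0. \<Phi> z1 z0 (coord_blocks (h p))) (f p)"
begin

text \<open>
  The factor \<open>k\<close> is recorded because the normalized coordinates of the zeros determine the form only up
  to a factor.
\<close>

definition zero_list :: "'p \<Rightarrow> complex \<Rightarrow> cp1 list \<Rightarrow> bool" where
  "zero_list q k ps \<longleftrightarrow> mset ps = f q \<and> length ps = n \<and>
     (\<forall>z1 z0. \<Phi> z1 z0 (coord_blocks (h q)) = k * (\<Prod>w\<leftarrow>ps. z1 * coord0 w - z0 * coord1 w))"

lemma ex_zero_list:
  assumes "p \<in> S" "mset ps = f p"
  shows "\<exists>k. k \<noteq> 0 \<and> zero_list p k ps"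
proof -
  obtain k where "k \<noteq> 0" "size (f p) = n"
    "\<forall>z1 z0. \<Phi> z1 z0 (coord_blocks (h p)) = k * (\<Prod>w\<in>#f p. z1 * coord0 w - z0 * coord1 w)"
    using form_zeros[OF assms(1)] unfolding form_zeros_def by blast
  then show ?thesis
    unfolding zero_list_def assms(2)[symmetric]
    by (auto simp: prod_mset_prod_list simp flip: mset_map)
qed

text \<open>
  A function of the list of zeros, of degree \<open>D\<close> in each zero, that is a polynomial in the coordinates
  of the point which parametrizes the form. The basic example is the product of the values of a
  linear form at all zeros, which is a value of the form \<open>\<Phi>\<close>; the other cases are built from this one.
\<close>

definition transfers :: "nat \<Rightarrow> (cp1 list \<Rightarrow> complex) \<Rightarrow> bool" where
  "transfers D B \<longleftrightarrow> (\<exists>B'. multihomogeneous (\<lambda>i. D * e i) B' \<and>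
     (\<forall>q\<in>S. \<forall>k ps. zero_list q k ps \<longrightarrow> B' (coord_blocks (h q)) = k ^ D * B ps))"

lemma transfers_zero: "transfers D (\<lambda>ps. 0)"
  unfolding transfers_def using multihomogeneous_zero by (intro exI[of _ "\<lambda>v. 0"]) auto

lemma transfers_one: "transfers 0 (\<lambda>ps. 1)"
  unfolding transfers_def using multihomogeneous_const[of 1] by (intro exI[of _ "\<lambda>v. 1"]) auto

lemma transfers_add:
  assumes "transfers D A" "transfers D B" shows "transfers D (\<lambda>ps. A ps + B ps)"
proof -
  obtain A' B' where "multihomogeneous (\<lambda>i. D * e i) A'" "multihomogeneous (\<lambda>i. D * e i) B'"
    "\<forall>q\<in>S. \<forall>k ps. zero_list q k ps \<longrightarrow> A' (coord_blocks (h q)) = k ^ D * A ps"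
    "\<forall>q\<in>S. \<forall>k ps. zero_list q k ps \<longrightarrow> B' (coord_blocks (h q)) = k ^ D * B ps"
    using assms unfolding transfers_def by blast
  then show ?thesis unfolding transfers_def
    by (intro exI[of _ "\<lambda>v. A' v + B' v"]) (simp add: multihomogeneous_add distrib_left)
qed

lemma transfers_mult:
  assumes "transfers D A" "transfers E B" shows "transfers (D + E) (\<lambda>ps. A ps * B ps)"
proof -
  obtain A' B' where *: "multihomogeneous (\<lambda>i. D * e i) A'" "multihomogeneous (\<lambda>i. E * e i) B'"
    "\<forall>q\<in>S. \<forall>k ps. zero_list q k ps \<longrightarrow> A' (coord_blocks (h q)) = k ^ D * A ps"
    "\<forall>q\<in>S. \<forall>k ps. zero_list q k ps \<longrightarrow> B' (coord_blocks (h q)) = k ^ E * B ps"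
    using assms unfolding transfers_def by blast
  have "multihomogeneous (\<lambda>i. (D + E) * e i) (\<lambda>v. A' v * B' v)"
    using multihomogeneous_mult[OF *(1,2)] by (simp add: distrib_right)
  then show ?thesis unfolding transfers_def using *(3,4)
    by (intro exI[of _ "\<lambda>v. A' v * B' v"]) (simp add: power_add mult_ac)
qed

lemma transfers_cmult:
  assumes "transfers D A" shows "transfers D (\<lambda>ps. a * A ps)"
proof -
  obtain A' where "multihomogeneous (\<lambda>i. D * e i) A'"
    "\<forall>q\<in>S. \<forall>k ps. zero_list q k ps \<longrightarrow> A' (coord_blocks (h q)) = k ^ D * A ps"
    using assms unfolding transfers_def by blast
  then show ?thesis unfolding transfers_def
    by (intro exI[of _ "\<lambda>v. a * A' v"]) (simp add: multihomogeneous_cmult mult_ac)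
qed

lemma transfers_sum:
  "finite I \<Longrightarrow> (\<And>i. i \<in> I \<Longrightarrow> transfers D (A i)) \<Longrightarrow> transfers D (\<lambda>ps. \<Sum>i\<in>I. A i ps)"
  by (induction I rule: finite_induct) (auto intro: transfers_zero transfers_add)

lemma transfers_cong:
  assumes "transfers D A" "\<And>ps. length ps = n \<Longrightarrow> A ps = B ps"
  shows "transfers D B"
proof -
  obtain A' where "multihomogeneous (\<lambda>i. D * e i) A'"
    "\<forall>q\<in>S. \<forall>k ps. zero_list q k ps \<longrightarrow> A' (coord_blocks (h q)) = k ^ D * A ps"
    using assms(1) unfolding transfers_def by blast
  then show ?thesis unfolding transfers_def
    using assms(2) by (intro exI[of _ A']) (auto simp: zero_list_def)
qed

lemma transfers_linear: "transfers 1 (\<lambda>ps. \<Prod>i<n. a * coord0 (ps ! i) + b * coord1 (ps ! i))"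
  unfolding transfers_def
proof (intro exI conjI ballI allI impI)
  show "multihomogeneous (\<lambda>i. 1 * e i) (\<Phi> a (- b))"
    using multihomogeneous_form by simp
  fix q k ps assume "zero_list q k ps"
  then show "\<Phi> a (- b) (coord_blocks (h q)) =
      k ^ 1 * (\<Prod>i<n. a * coord0 (ps ! i) + b * coord1 (ps ! i))"
    by (auto simp: zero_list_def prod.list_conv_set_nth atLeast0LessThan)
qed

lemma transfers_prod_linear:
  "transfers D (\<lambda>ps. \<Prod>l<D. \<Prod>i<n. a l * coord0 (ps ! i) + b l * coord1 (ps ! i))"
proof (induction D)
  case (Suc D)
  show ?case using transfers_mult[OF Suc transfers_linear[of "a D" "b D"]] by (simp add: mult_ac)
qed (simp add: transfers_one)

text \<open>
  The function is the product over all zeros of the values of one binary form of degree \<open>D\<close>, which splits into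
  linear factors.
\<close>

lemma transfers_norm:
  assumes "finite X" "\<And>j. j \<in> X \<Longrightarrow> fst (m j) + snd (m j) = D"
  shows "transfers D (\<lambda>ps. \<Prod>i<n. \<Sum>j\<in>X. coord0 (ps ! i) ^ fst (m j) * coord1 (ps ! i) ^ snd (m j))"
proof -
  obtain \<kappa> \<alpha> \<beta> where f: "\<And>x0 x1 :: complex. (\<Sum>i\<in>X. x0 ^ fst (m i) * x1 ^ snd (m i)) =
      \<kappa> * (\<Prod>l<D. \<alpha> l * x0 + \<beta> l * x1)"
    using binary_form_factorization[of X m D] assms by blast
  have "transfers D (\<lambda>ps. \<kappa> ^ n * (\<Prod>l<D. \<Prod>i<n. \<alpha> l * coord0 (ps ! i) + \<beta> l * coord1 (ps ! i)))"
    by (intro transfers_cmult transfers_prod_linear)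
  moreover have "\<kappa> ^ n * (\<Prod>l<D. \<Prod>i<n. \<alpha> l * coord0 (ps ! i) + \<beta> l * coord1 (ps ! i)) =
      (\<Prod>i<n. \<kappa> * (\<Prod>l<D. \<alpha> l * coord0 (ps ! i) + \<beta> l * coord1 (ps ! i)))" for ps
    unfolding prod.distrib by (subst prod.swap) simp
  ultimately show ?thesis
    unfolding f by (simp only:)
qed

definition symmetrized :: "((nat \<Rightarrow> nat \<Rightarrow> complex) \<Rightarrow> complex) \<Rightarrow> cp1 list \<Rightarrow> complex" where
  "symmetrized A ps = (\<Sum>\<sigma> | \<sigma> permutes {..<n}. A (coord_blocks (map (hcoord CP1) (permute_list \<sigma> ps))))"

text \<open>
  The symmetrized monomial is a permanent, and Ryser's formula writes it in terms of the products
  in \<open>transfers_norm\<close>.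
\<close>

lemma transfers_symmetrized_monomial:
  assumes "\<And>i. i < n \<Longrightarrow> fst (m i) + snd (m i) = D"
  shows "transfers D (\<lambda>ps. \<Sum>\<sigma> | \<sigma> permutes {..<n}.
    line_monomial n m (\<lambda>i. coord0 (ps ! \<sigma> i)) (\<lambda>i. coord1 (ps ! \<sigma> i)))"
proof -
  define g where "g ps i j = coord0 (ps ! i) ^ fst (m j) * coord1 (ps ! i) ^ snd (m j)" for ps i j
  have "transfers D (\<lambda>ps. \<Sum>X\<in>Pow {..<n}. (-1) ^ card ({..<n} - X) * (\<Prod>i<n. \<Sum>j\<in>X. g ps i j))"
    unfolding g_def using assms
    by (intro transfers_sum transfers_cmult transfers_norm) (auto intro: finite_subset)
  then have "transfers D (\<lambda>ps. \<Sum>\<sigma> | \<sigma> permutes {..<n}. \<Prod>i<n. g ps (\<sigma> i) i)"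
    unfolding sum_permutations_prod_eq_Ryser[symmetric] sum_permutations_prod_transpose .
  then show ?thesis by (simp add: g_def line_monomial_def)
qed

lemma transfers_symmetrized:
  assumes A: "multihomogeneous d A" and d: "\<And>i. i < n \<Longrightarrow> d i = D"
  shows "transfers D (symmetrized A)"
proof -
  obtain L where L: "\<And>c m i. (c, m) \<in> set L \<Longrightarrow> i < n \<Longrightarrow> fst (m i) + snd (m i) = D"
    "\<And>s t. A (line_blocks n s t) = (\<Sum>(c, m)\<leftarrow>L. c * line_monomial n m s t)"
    using multihomogeneous_sum_monomials[OF A, of n] d by fastforce
  have "transfers D (\<lambda>ps. \<Sum>(c, m)\<leftarrow>L. c * (\<Sum>\<sigma> | \<sigma> permutes {..<n}.
      line_monomial n m (\<lambda>i. coord0 (ps ! \<sigma> i)) (\<lambda>i. coord1 (ps ! \<sigma> i))))"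
    using L(1)
  proof (induction L)
    case (Cons x L)
    obtain c m where x: "x = (c, m)" by (cases x)
    show ?case
      unfolding x using Cons x
      by (auto intro!: transfers_add transfers_cmult transfers_symmetrized_monomial)
  qed (simp add: transfers_zero)
  then show ?thesis
  proof (rule transfers_cong)
    fix ps :: "cp1 list" assume n: "length ps = n"
    have "(\<Sum>(c, m)\<leftarrow>L. c * (\<Sum>\<sigma> | \<sigma> permutes {..<n}.
        line_monomial n m (\<lambda>i. coord0 (ps ! \<sigma> i)) (\<lambda>i. coord1 (ps ! \<sigma> i)))) =
      (\<Sum>\<sigma> | \<sigma> permutes {..<n}. \<Sum>(c, m)\<leftarrow>L. c *
        line_monomial n m (\<lambda>i. coord0 (ps ! \<sigma> i)) (\<lambda>i. coord1 (ps ! \<sigma> i)))"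
      by (induction L) (auto simp: sum.distrib sum_distrib_left)
    also have "\<dots> = symmetrized A ps"
      unfolding symmetrized_def
    proof (rule sum.cong[OF refl])
      fix \<sigma> assume "\<sigma> \<in> {\<sigma>. \<sigma> permutes {..<n}}"
      then have "line_blocks n (\<lambda>i. coord0 (permute_list \<sigma> ps ! i)) (\<lambda>i. coord1 (permute_list \<sigma> ps ! i))
          = line_blocks n (\<lambda>i. coord0 (ps ! \<sigma> i)) (\<lambda>i. coord1 (ps ! \<sigma> i))"
        using n by (auto simp: line_blocks_def fun_eq_iff permute_list_nth)
      then show "(\<Sum>(c, m)\<leftarrow>L. c *
          line_monomial n m (\<lambda>i. coord0 (ps ! \<sigma> i)) (\<lambda>i. coord1 (ps ! \<sigma> i))) =
          A (coord_blocks (map (hcoord CP1) (permute_list \<sigma> ps)))"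
        using n by (simp add: coord_blocks_CP1[of _ n] L(2))
    qed
    finally show "(\<Sum>(c, m)\<leftarrow>L. c * (\<Sum>\<sigma> | \<sigma> permutes {..<n}.
        line_monomial n m (\<lambda>i. coord0 (ps ! \<sigma> i)) (\<lambda>i. coord1 (ps ! \<sigma> i)))) = symmetrized A ps" .
  qed
qed

lemma ex_linear_form_nonzero:
  assumes "finite W"
  shows "\<exists>r. \<forall>w\<in>W. coord0 w + r * coord1 w \<noteq> 0"
proof -
  have "infinite (UNIV - (\<lambda>w. - coord0 w / coord1 w) ` W :: complex set)"
    using assms by (intro Diff_infinite_finite) (auto simp: infinite_UNIV_char_0)
  then obtain r where r: "r \<notin> (\<lambda>w. - coord0 w / coord1 w) ` W" "r \<noteq> 0"
    by (metis (no_types, lifting) Diff_iff finite.emptyI finite_insert finite_subset insertCI subsetI)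
  have "coord0 w + r * coord1 w \<noteq> 0" if "w \<in> W" for w
  proof
    assume eq: "coord0 w + r * coord1 w = 0"
    show False
    proof (cases "coord1 w = 0")
      case True
      then show False using eq by (cases w) auto
    next
      case False
      then have "r = - coord0 w / coord1 w"
        using eq by (simp add: field_simps eq_neg_iff_add_eq_0 add.commute)
      then show False using r that by blast
    qed
  qed
  then show ?thesis by blast
qed

text \<open>
  The factor \<open>M\<close> is a product of powers of a linear form that vanishes at none of the points of \<open>ps\<close>. It
  depends only on the multidegree, so it cancels in quotients of forms of the same multidegree.
\<close>

lemma equalize_degrees:
  fixes ps :: "cp1 list"
  shows "\<exists>d' D M. (\<forall>i<n. d' i = D) \<and> (\<forall>A. multihomogeneous d A \<longrightarrow> multihomogeneous d' (\<lambda>v. A v * M v)) \<and>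
    (length ps = n \<longrightarrow> M (coord_blocks (map (hcoord CP1) ps)) \<noteq> (0 :: complex))"
proof -
  obtain r where r: "\<forall>w\<in>set ps. coord0 w + r * coord1 w \<noteq> 0"
    using ex_linear_form_nonzero[of "set ps"] by auto
  define D where "D = (\<Sum>i<n. d i)"
  have dD: "d i \<le> D" if "i < n" for i
    unfolding D_def by (rule member_le_sum) (use that in auto)
  define M where "M = (\<lambda>v :: nat \<Rightarrow> nat \<Rightarrow> complex. \<Prod>i<n. (v i 0 + r * v i 1) ^ (D - d i))"
  have "multihomogeneous (\<lambda>k. \<Sum>i<n. (D - d i) * (if k = i then 1 else 0)) M"
    unfolding M_def
    by (intro multihomogeneous_prod multihomogeneous_power multihomogeneous_add
        multihomogeneous_cmult multihomogeneous_coord) simp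
  then have M: "multihomogeneous (\<lambda>k. if k < n then D - d k else 0) M"
    by (rule multihomogeneous_cong) (simp_all add: if_distrib[of "(*) _"] cong: if_cong)
  show ?thesis
  proof (intro exI conjI allI impI)
    show "(\<lambda>i. d i + (if i < n then D - d i else 0)) i = D" if "i < n" for i
      using dD[OF that] that by simp
    show "multihomogeneous (\<lambda>i. d i + (if i < n then D - d i else 0)) (\<lambda>v. A v * M v)"
      if "multihomogeneous d A" for A
      by (rule multihomogeneous_mult[OF that M])
    show "M (coord_blocks (map (hcoord CP1) ps)) \<noteq> 0" if "length ps = n"
      using r that by (simp add: coord_blocks_CP1[OF that] M_def line_blocks_def)
  qed
qed

lemma symmetrized_power_nonzero:
  assumes "length ps = n" "A (coord_blocks (map (hcoord CP1) ps)) \<noteq> 0"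
  shows "\<exists>k\<ge>2. symmetrized (\<lambda>v. A v ^ k) ps \<noteq> 0"
  unfolding symmetrized_def
proof (rule power_sum_nonzero)
  show "finite {\<sigma>. \<sigma> permutes {..<n}}" by (rule finite_permutations) simp
  show "id \<in> {\<sigma>. \<sigma> permutes {..<n}}" by (simp add: permutes_id)
  show "A (coord_blocks (map (hcoord CP1) (permute_list id ps))) \<noteq> 0" using assms(2) by simp
qed

lemma topspace_power_space: "topspace (ftop (power_space n CP1)) = {ps. length ps = n}"
  by (simp add: power_space_def topspace_zariski_space)

text \<open>
  Open sets and regular functions on the symmetric power are given near a list \<open>ps\<close> by multihomogeneous
  polynomials \<open>A\<close> and quotients \<open>A / B\<close> that need not be symmetric. Replacing \<open>A\<close> by the symmetrized
  power \<open>A\<^sup>k\<close>, and \<open>A / B\<close> by the quotient of the symmetrized \<open>A B\<^bsup>k-1\<^esup>\<close> and \<open>B\<^sup>k\<close>, makes them symmetric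
  without losing anything: the domain is invariant under permutations, and at each permutation of the
  list the quotient has the same value or \<open>B\<close> vanishes.
\<close>

lemma regular_on_form_zeros_map: "regular_on (zariski_space S h) S (sym_space n CP1) f"
proof -
  define U where "U V = {ps. length ps = n \<and> mset ps \<in> V}" for V :: "cp1 multiset set"
  have perm_U: "permute_list \<sigma> ps \<in> U V \<longleftrightarrow> ps \<in> U V" if "\<sigma> permutes {..<n}" "length ps = n" for \<sigma> ps V
    using that by (simp add: U_def)
  have list: "\<exists>ps. length ps = n \<and> mset ps = f p" if "p \<in> S" for p
  proof -
    obtain ps where ps: "mset ps = f p" using ex_mset by blast
    have "size (mset ps) = n" using form_zeros[OF that] by (simp add: form_zeros_def ps)
    then have "length ps = n" by simp
    then show ?thesis using ps by (intro exI[of _ ps]) simp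
  qed
  have top: "topspace (ftop (zariski_space S h)) = S" by (rule topspace_zariski_space)
  have openV: "V \<subseteq> mset ` {ps. length ps = n}" "openin (ftop (power_space n CP1)) (U V)"
    if "openin (ftop (sym_space n CP1)) V" for V
    using that unfolding openin_sym_space topspace_power_space U_def by auto
  show ?thesis
    unfolding regular_on_def
  proof (intro conjI allI impI ballI)
    show "openin (ftop (zariski_space S h)) S" using openin_topspace top by metis
    have "openin (ftop (sym_space n CP1)) (mset ` {ps. length ps = n})"
    proof -
      have eq: "{ps \<in> {ps. length ps = n}. mset ps \<in> mset ` {ps. length ps = n}} = {ps. length ps = n}"
        by auto
      have "openin (ftop (power_space n CP1)) {ps. length ps = n}"
        using openin_topspace topspace_power_space by metis
      then show ?thesis unfolding openin_sym_space topspace_power_space eq by simp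
    qed
    then show "f ` S \<subseteq> topspace (ftop (sym_space n CP1))"
      using list openin_subset by (fastforce simp: image_iff)
  next
    fix V assume V: "openin (ftop (sym_space n CP1)) V"
    show "openin (ftop (zariski_space S h)) {x \<in> S. f x \<in> V}"
      unfolding openin_zariski_space
    proof (intro conjI ballI)
      fix p assume "p \<in> {x \<in> S. f x \<in> V}"
      then have p: "p \<in> S" "f p \<in> V" by auto
      obtain ps where ps: "length ps = n" "mset ps = f p" using list[OF p(1)] by blast
      then have "ps \<in> U V" using p by (simp add: U_def)
      then obtain d A where A: "multihomogeneous d A" "A (coord_blocks (map (hcoord CP1) ps)) \<noteq> 0"
        "\<And>qs. length qs = n \<Longrightarrow> A (coord_blocks (map (hcoord CP1) qs)) \<noteq> 0 \<Longrightarrow> qs \<in> U V"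
        using openV(2)[OF V] unfolding power_space_def openin_zariski_space by auto
      obtain d' D M where d': "\<And>i. i < n \<Longrightarrow> d' i = D"
        and M: "\<And>A. multihomogeneous d A \<Longrightarrow> multihomogeneous d' (\<lambda>v. A v * M v)"
          "M (coord_blocks (map (hcoord CP1) ps)) \<noteq> (0::complex)"
        using equalize_degrees[of d ps] ps(1) by blast
      obtain k where k: "k \<ge> 2" "symmetrized (\<lambda>v. (A v * M v) ^ k) ps \<noteq> 0"
        using symmetrized_power_nonzero[OF ps(1), of "\<lambda>v. A v * M v"] A(2) M(2) by auto
      have "transfers (k * D) (symmetrized (\<lambda>v. (A v * M v) ^ k))"
        by (rule transfers_symmetrized[OF multihomogeneous_power[OF M(1)[OF A(1)]]]) (simp add: d')
      then obtain B where B: "multihomogeneous (\<lambda>i. k * D * e i) B"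
        "\<And>q l qs. q \<in> S \<Longrightarrow> zero_list q l qs \<Longrightarrow>
          B (coord_blocks (h q)) = l ^ (k * D) * symmetrized (\<lambda>v. (A v * M v) ^ k) qs"
        unfolding transfers_def by blast
      show "\<exists>d A. multihomogeneous d A \<and> A (coord_blocks (h p)) \<noteq> 0 \<and>
          (\<forall>q\<in>S. A (coord_blocks (h q)) \<noteq> 0 \<longrightarrow> q \<in> {x \<in> S. f x \<in> V})"
      proof (intro exI conjI ballI impI)
        show "multihomogeneous (\<lambda>i. k * D * e i) B" by (rule B)
        obtain l where "l \<noteq> 0" "zero_list p l ps" using ex_zero_list[OF p(1) ps(2)] by blast
        then show "B (coord_blocks (h p)) \<noteq> 0" using B(2)[OF p(1)] k(2) by simp
        fix q assume q: "q \<in> S" "B (coord_blocks (h q)) \<noteq> 0"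
        obtain qs where qs: "length qs = n" "mset qs = f q" using list[OF q(1)] by blast
        obtain l where "l \<noteq> 0" "zero_list q l qs" using ex_zero_list[OF q(1) qs(2)] by blast
        then have "symmetrized (\<lambda>v. (A v * M v) ^ k) qs \<noteq> 0" using B(2)[OF q(1)] q(2) by auto
        then obtain \<sigma> where \<sigma>': "\<sigma> \<in> {\<sigma>. \<sigma> permutes {..<n}}"
          "(A (coord_blocks (map (hcoord CP1) (permute_list \<sigma> qs))) *
            M (coord_blocks (map (hcoord CP1) (permute_list \<sigma> qs)))) ^ k \<noteq> 0"
          unfolding symmetrized_def by (rule sum.not_neutral_contains_not_neutral)
        have \<sigma>: "\<sigma> permutes {..<n}" using \<sigma>'(1) by simp
        have "A (coord_blocks (map (hcoord CP1) (permute_list \<sigma> qs))) \<noteq> 0"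
          using \<sigma>'(2) k(1) by auto
        then have "permute_list \<sigma> qs \<in> U V" using A(3)[of "permute_list \<sigma> qs"] qs(1) by simp
        then have "qs \<in> U V" using perm_U[OF \<sigma> qs(1)] by simp
        then show "q \<in> {x \<in> S. f x \<in> V}" using q(1) qs(2) by (simp add: U_def)
      qed
    qed auto
    fix g assume g: "g \<in> regfun (sym_space n CP1) V"
    show "g \<circ> f \<in> regfun (zariski_space S h) {x \<in> S. f x \<in> V}"
      unfolding regfun_zariski_space
    proof
      fix p assume "p \<in> {x \<in> S. f x \<in> V}"
      then have p: "p \<in> S" "f p \<in> V" by auto
      obtain ps where ps: "length ps = n" "mset ps = f p" using list[OF p(1)] by blast
      then have psU: "ps \<in> U V" using p by (simp add: U_def)
      have "g \<circ> mset \<in> regfun (power_space n CP1) (U V)"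
        using g by (simp add: sym_space_def U_def topspace_power_space)
      from bspec[OF this[unfolded power_space_def regfun_zariski_space] psU] obtain d A0 B0 where AB0: "multihomogeneous d A0" "multihomogeneous d B0"
        "B0 (coord_blocks (map (hcoord CP1) ps)) \<noteq> 0"
        "\<forall>qs\<in>U V. B0 (coord_blocks (map (hcoord CP1) qs)) \<noteq> 0 \<longrightarrow> (g \<circ> mset) qs =
          A0 (coord_blocks (map (hcoord CP1) qs)) / B0 (coord_blocks (map (hcoord CP1) qs))"
        by blast
      obtain d' D M where d': "\<And>i. i < n \<Longrightarrow> d' i = D"
        and M: "\<And>A. multihomogeneous d A \<Longrightarrow> multihomogeneous d' (\<lambda>v. A v * M v)"
          "M (coord_blocks (map (hcoord CP1) ps)) \<noteq> (0::complex)"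
        using equalize_degrees[of d ps] ps(1) by blast
      define A B where "A v = A0 v * M v" and "B v = B0 v * M v" for v
      have A: "multihomogeneous d' A" and B: "multihomogeneous d' B"
        unfolding A_def B_def using M(1) AB0(1,2) by auto
      have gAB: "g (mset qs) * B (coord_blocks (map (hcoord CP1) qs)) =
            A (coord_blocks (map (hcoord CP1) qs))"
        if "qs \<in> U V" "B (coord_blocks (map (hcoord CP1) qs)) \<noteq> 0" for qs
        using AB0(4) that by (simp add: A_def B_def)
      obtain k where k: "k \<ge> 2" "symmetrized (\<lambda>v. B v ^ k) ps \<noteq> 0"
        using symmetrized_power_nonzero[OF ps(1), of B] AB0(3) M(2) by (auto simp: B_def)
      then obtain k' where k': "k = Suc k'" "k' > 0" by (cases k) auto
      have sym: "symmetrized (\<lambda>v. A v * B v ^ k') qs = g (mset qs) * symmetrized (\<lambda>v. B v ^ k) qs"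
        if qs: "qs \<in> U V" for qs
        unfolding symmetrized_def sum_distrib_left
      proof (rule sum.cong[OF refl])
        fix \<sigma> assume "\<sigma> \<in> {\<sigma>. \<sigma> permutes {..<n}}"
        then have \<sigma>: "\<sigma> permutes {..<length qs}" "permute_list \<sigma> qs \<in> U V"
          using qs perm_U by (auto simp: U_def)
        define b where "b = coord_blocks (map (hcoord CP1) (permute_list \<sigma> qs))"
        show "A b * B b ^ k' = g (mset qs) * B b ^ k"
        proof (cases "B b = 0")
          case False
          then have "A b = g (mset qs) * B b" using gAB[OF \<sigma>(2)] mset_permute_list[OF \<sigma>(1)]
            by (simp add: b_def)
          then show ?thesis by (simp add: k')
        qed (use k' in simp)
      qed
      have "multihomogeneous (\<lambda>i. d' i + k' * d' i) (\<lambda>v. A v * B v ^ k')"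
        by (rule multihomogeneous_mult[OF A multihomogeneous_power[OF B]])
      then have "transfers (k * D) (symmetrized (\<lambda>v. A v * B v ^ k'))"
        by (rule transfers_symmetrized) (simp add: d' k')
      moreover have "transfers (k * D) (symmetrized (\<lambda>v. B v ^ k))"
        by (rule transfers_symmetrized[OF multihomogeneous_power[OF B]]) (simp add: d')
      ultimately obtain A' B' where AB': "multihomogeneous (\<lambda>i. k * D * e i) A'"
        "multihomogeneous (\<lambda>i. k * D * e i) B'"
        "\<And>q l qs. q \<in> S \<Longrightarrow> zero_list q l qs \<Longrightarrow>
          A' (coord_blocks (h q)) = l ^ (k * D) * symmetrized (\<lambda>v. A v * B v ^ k') qs"
        "\<And>q l qs. q \<in> S \<Longrightarrow> zero_list q l qs \<Longrightarrow>
          B' (coord_blocks (h q)) = l ^ (k * D) * symmetrized (\<lambda>v. B v ^ k) qs"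
        unfolding transfers_def by blast
      show "\<exists>d A B. multihomogeneous d A \<and> multihomogeneous d B \<and> B (coord_blocks (h p)) \<noteq> 0 \<and>
          (\<forall>q\<in>{x \<in> S. f x \<in> V}. B (coord_blocks (h q)) \<noteq> 0 \<longrightarrow>
             (g \<circ> f) q = A (coord_blocks (h q)) / B (coord_blocks (h q)))"
      proof (intro exI conjI ballI impI)
        show "multihomogeneous (\<lambda>i. k * D * e i) A'" "multihomogeneous (\<lambda>i. k * D * e i) B'"
          by (rule AB')+
        obtain l where "l \<noteq> 0" "zero_list p l ps" using ex_zero_list[OF p(1) ps(2)] by blast
        then show "B' (coord_blocks (h p)) \<noteq> 0" using AB'(4)[OF p(1)] k(2) by simp
        fix q assume q: "q \<in> {x \<in> S. f x \<in> V}" "B' (coord_blocks (h q)) \<noteq> 0"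
        then have qS: "q \<in> S" by simp
        obtain qs where qs: "length qs = n" "mset qs = f q" using list[OF qS] by blast
        obtain l where l: "zero_list q l qs" using ex_zero_list[OF qS qs(2)] by blast
        have "qs \<in> U V" using q qs by (simp add: U_def)
        then have "A' (coord_blocks (h q)) = g (mset qs) * B' (coord_blocks (h q))"
          using sym AB'(3,4)[OF qS l] by simp
        then show "(g \<circ> f) q = A' (coord_blocks (h q)) / B' (coord_blocks (h q))"
          using q(2) qs(2) by simp
      qed
    qed
  qed
qed

end

section \<open>The group law on the curve\<close>

lemma EInf_ec_points [simp]: "EInf \<in> ec_points c"
  by (simp add: ec_points_def)

lemma Pt_ec_points [simp]: "Pt x y \<in> ec_points c \<longleftrightarrow> y^2 = x ^ 3 + c"
  by (simp add: ec_points_def)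

lemma ec_var_simps [simp]: "points (ec_var c) = ec_points c" "hcoord (ec_var c) = ec_coord"
  by (simp_all add: ec_var_def)

lemma ec_coord_inj:
  assumes "ec_coord p = (\<lambda>j. t * ec_coord q j)"
  shows "p = q"
  using fun_cong[OF assms, of 0] fun_cong[OF assms, of 1] fun_cong[OF assms, of 2]
  by (cases p; cases q) auto

lemma ec_coord_nonzero: "\<exists>j. ec_coord p j \<noteq> 0"
  by (cases p) (auto intro: exI[of _ 0] exI[of _ 2])

lemma projective_variety_ec_var: "projective_variety (ec_var c)"
proof -
  define A :: "(nat \<Rightarrow> nat \<Rightarrow> complex) \<Rightarrow> complex" where
    "A = (\<lambda>v. v 0 0 * (v 0 2)^2 - ((v 0 1) ^ 3 + c * (v 0 0) ^ 3))"
  have "multihomogeneous (\<lambda>k. if k = 0 then 3 else 0) (\<lambda>v. v 0 0 * (v 0 2)^2)"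
    by (rule multihomogeneous_cong[OF multihomogeneous_mult[OF multihomogeneous_coord[of 0 0]
        multihomogeneous_power[OF multihomogeneous_coord[of 0 2], of 2]]]) auto
  moreover have "multihomogeneous (\<lambda>k. if k = 0 then 3 else 0) (\<lambda>v. (v 0 j) ^ 3)" for j
    by (rule multihomogeneous_cong[OF multihomogeneous_power[OF multihomogeneous_coord[of 0 j], of 3]]) auto
  ultimately have A: "multihomogeneous (\<lambda>k. if k = 0 then 3 else 0) A"
    unfolding A_def by (intro multihomogeneous_diff multihomogeneous_add multihomogeneous_cmult)
  have "(\<exists>p\<in>ec_points c. \<exists>t. t \<noteq> 0 \<and> v = (\<lambda>j. t * ec_coord p j)) \<longleftrightarrow>
      v \<noteq> (\<lambda>j. 0) \<and> (\<forall>j>2. v j = 0) \<and> (\<forall>A\<in>{A}. A (coord_blocks [v]) = 0)" for v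
  proof
    assume "\<exists>p\<in>ec_points c. \<exists>t. t \<noteq> 0 \<and> v = (\<lambda>j. t * ec_coord p j)"
    then obtain p t where p: "p \<in> ec_points c" "t \<noteq> 0" and v: "v = (\<lambda>j. t * ec_coord p j)" by blast
    have "v \<noteq> (\<lambda>j. 0)" using ec_coord_nonzero[of p] p(2) unfolding v by (auto simp: fun_eq_iff)
    moreover have "\<forall>j>2. v j = 0" unfolding v by (cases p) auto
    moreover have "A (coord_blocks [v]) = 0"
    proof (cases p)
      case (Pt x y)
      then have "y^2 = x ^ 3 + c" using p(1) by simp
      then have "t * (t * y)^2 - ((t * x) ^ 3 + c * t ^ 3) = 0" by algebra
      then show ?thesis by (simp add: v A_def Pt coord_blocks_def)
    qed (simp add: v A_def coord_blocks_def)
    ultimately show "v \<noteq> (\<lambda>j. 0) \<and> (\<forall>j>2. v j = 0) \<and> (\<forall>A\<in>{A}. A (coord_blocks [v]) = 0)" by simp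
  next
    assume v: "v \<noteq> (\<lambda>j. 0) \<and> (\<forall>j>2. v j = 0) \<and> (\<forall>A\<in>{A}. A (coord_blocks [v]) = 0)"
    then have eq: "v 0 * (v 2)^2 = (v 1) ^ 3 + c * (v 0) ^ 3" by (simp add: A_def coord_blocks_def)
    have split: "j = 0 \<or> j = 1 \<or> j = 2 \<or> j > 2" for j :: nat by linarith
    show "\<exists>p\<in>ec_points c. \<exists>t. t \<noteq> 0 \<and> v = (\<lambda>j. t * ec_coord p j)"
    proof (cases "v 0 = 0")
      case True
      then have v1: "v 1 = 0" using eq by simp
      then have "v 2 \<noteq> 0" using v True split by (metis ext)
      moreover have "v = (\<lambda>j. v 2 * ec_coord EInf j)"
      proof
        fix j show "v j = v 2 * ec_coord EInf j" using split[of j] True v1 v by auto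
      qed
      ultimately show ?thesis using EInf_ec_points by blast
    next
      case False
      have "(v 2 / v 0)^2 = (v 1 / v 0) ^ 3 + c"
        using eq False by (simp add: field_simps power2_eq_square power3_eq_cube)
      then have "Pt (v 1 / v 0) (v 2 / v 0) \<in> ec_points c" by simp
      moreover have "v = (\<lambda>j. v 0 * ec_coord (Pt (v 1 / v 0) (v 2 / v 0)) j)"
      proof
        fix j show "v j = v 0 * ec_coord (Pt (v 1 / v 0) (v 2 / v 0)) j"
          using split[of j] False v by auto
      qed
      ultimately show ?thesis using False by blast
    qed
  qed
  then have "\<exists>N F. (\<forall>A\<in>F. \<exists>d. multihomogeneous d A) \<and>
       (\<forall>v. (\<exists>p\<in>ec_points c. \<exists>t. t \<noteq> 0 \<and> v = (\<lambda>j. t * ec_coord p j)) \<longleftrightarrow>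
            v \<noteq> (\<lambda>j. 0) \<and> (\<forall>j>N. v j = 0) \<and> (\<forall>A\<in>F. A (coord_blocks [v]) = 0))"
    using A by (intro exI[of _ 2] exI[of _ "{A}"]) blast
  then show ?thesis
    unfolding projective_variety_def using ec_coord_inj by simp
qed

text \<open>
  Chords and tangents are treated alike: the slope is characterized by two equations, the second
  of which is the quotient of the difference of the two curve equations by the first and which
  determines the slope of a tangent.
\<close>

lemma ec_add_slope_eq:
  assumes "y1^2 = x1 ^ 3 + c" "y2^2 = x2 ^ 3 + c"
    and "y2 - y1 = m * (x2 - x1)" "x1 \<noteq> x2 \<or> m * (y1 + y2) = x1^2 + x1 * x2 + x2^2"
    and "\<not> (x1 = x2 \<and> y1 = - y2)"
  shows "ec_add (Pt x1 y1) (Pt x2 y2) =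
    Pt (m^2 - x1 - x2) (m * (x1 - (m^2 - x1 - x2)) - y1)"
proof (cases "x1 = x2")
  case True
  then have y: "y2 = y1" using assms(3) by simp
  then have "y1 \<noteq> 0" using assms(5) True by simp
  moreover have "m * (y1 + y1) = 3 * x1^2"
    using assms(4) True y by (simp add: power2_eq_square)
  ultimately have "3 * x1^2 / (2 * y1) = m" by (simp add: field_simps)
  then show ?thesis using True y \<open>y1 \<noteq> 0\<close> by (simp add: Let_def)
next
  case False
  then have "(y2 - y1) / (x2 - x1) = m" using assms(3) by simp
  then show ?thesis using False by (simp add: Let_def)
qed

lemma ec_slope_exists:
  fixes x1 :: complex
  assumes "y1^2 = x1 ^ 3 + c" "y2^2 = x2 ^ 3 + c" "\<not> (x1 = x2 \<and> y1 = - y2)"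
  shows "\<exists>m. y2 - y1 = m * (x2 - x1) \<and> m * (y1 + y2) = x1^2 + x1 * x2 + x2^2"
proof (cases "x1 = x2")
  case True
  then have "y1^2 = y2^2" using assms(1,2) by simp
  then have "(y1 - y2) * (y1 + y2) = 0" by (simp add: power2_eq_square algebra_simps)
  moreover have "y1 + y2 \<noteq> 0" using assms(3) True by (simp add: add_eq_0_iff2)
  ultimately have y: "y2 = y1" by simp
  then have "y1 \<noteq> 0" using assms(3) True by auto
  then show ?thesis using True y
    by (intro exI[of _ "3 * x1^2 / (2 * y1)"]) (simp add: power2_eq_square)
next
  case False
  define m where "m = (y2 - y1) / (x2 - x1)"
  have m: "y2 - y1 = m * (x2 - x1)" using False by (simp add: m_def)
  have "(m * (y1 + y2) - (x1^2 + x1 * x2 + x2^2)) * (x2 - x1) = 0"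
    using assms(1,2) m by algebra
  then show ?thesis using m False by auto
qed

lemma ec_add_affine:
  assumes "y1^2 = x1 ^ 3 + c" "y2^2 = x2 ^ 3 + c" "\<not> (x1 = x2 \<and> y1 = - y2)"
  obtains m where "y2 - y1 = m * (x2 - x1)" "m * (y1 + y2) = x1^2 + x1 * x2 + x2^2"
    "ec_add (Pt x1 y1) (Pt x2 y2) = Pt (m^2 - x1 - x2) (m * (x1 - (m^2 - x1 - x2)) - y1)"
  using ec_slope_exists[OF assms] ec_add_slope_eq[OF assms(1,2) _ _ assms(3)] by blast

lemma ec_add_EInf_right [simp]: "ec_add P EInf = P"
  by (cases P) auto

declare ec_add.simps(3) [simp del]

lemma ec_add_opposite [simp]: "ec_add (Pt x y) (Pt x (- y)) = EInf" "ec_add (Pt x (- y)) (Pt x y) = EInf"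
  by (simp_all add: ec_add.simps)

text \<open>
  These maps multiply slopes by \<open>\<beta> / \<alpha>\<close>, so they respect chords and tangents. They comprise the powers
  of the automorphism of order six and isomorphisms between the curves for different \<open>c\<close>.
\<close>

fun ec_scale :: "complex \<Rightarrow> complex \<Rightarrow> ecpoint \<Rightarrow> ecpoint" where
  "ec_scale \<alpha> \<beta> (Pt x y) = Pt (\<alpha> * x) (\<beta> * y)"
| "ec_scale \<alpha> \<beta> EInf = EInf"

lemma ec_scale_points:
  assumes "\<alpha> ^ 3 = \<beta>^2" "c' = \<beta>^2 * c" "P \<in> ec_points c"
  shows "ec_scale \<alpha> \<beta> P \<in> ec_points c'"
  using assms by (cases P) (simp_all add: power_mult_distrib distrib_left)

lemma ec_scale_add:
  assumes \<alpha>: "\<alpha> ^ 3 = \<beta>^2" "\<beta> \<noteq> 0" and P: "P \<in> ec_points c" "Q \<in> ec_points c"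
  shows "ec_scale \<alpha> \<beta> (ec_add P Q) = ec_add (ec_scale \<alpha> \<beta> P) (ec_scale \<alpha> \<beta> Q)"
proof (cases P)
  case (Pt x1 y1)
  show ?thesis
  proof (cases Q)
    case Q: (Pt x2 y2)
    have \<alpha>0: "\<alpha> \<noteq> 0" using \<alpha> by auto
    show ?thesis
    proof (cases "x1 = x2 \<and> y1 = - y2")
      case True
      then show ?thesis by (simp add: Pt Q ec_add.simps)
    next
      case False
      have on: "y1^2 = x1 ^ 3 + c" "y2^2 = x2 ^ 3 + c" using P Pt Q by auto
      obtain m where m: "y2 - y1 = m * (x2 - x1)" "m * (y1 + y2) = x1^2 + x1 * x2 + x2^2"
        "ec_add (Pt x1 y1) (Pt x2 y2) = Pt (m^2 - x1 - x2) (m * (x1 - (m^2 - x1 - x2)) - y1)"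
        using ec_add_affine[OF on False] by blast
      define m' where "m' = \<beta> / \<alpha> * m"
      have m': "m' * \<alpha> = \<beta> * m" using \<alpha>0 by (simp add: m'_def)
      have m'2: "m'^2 = \<alpha> * m^2"
      proof -
        have "m'^2 * \<alpha>^2 = \<beta>^2 * m^2" using m' by (metis power_mult_distrib)
        also have "\<dots> = (\<alpha> * m^2) * \<alpha>^2" unfolding \<alpha>(1)[symmetric] by algebra
        finally have "m'^2 * \<alpha>^2 = (\<alpha> * m^2) * \<alpha>^2" .
        then show ?thesis using \<alpha>0 by simp
      qed
      have "(m' * (\<beta> * y1 + \<beta> * y2)) * \<alpha> = (m' * \<alpha>) * \<beta> * (y1 + y2)" by algebra
      also have "\<dots> = \<beta>^2 * (m * (y1 + y2))" unfolding m' by algebra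
      also have "\<dots> = ((\<alpha> * x1)^2 + (\<alpha> * x1) * (\<alpha> * x2) + (\<alpha> * x2)^2) * \<alpha>"
        unfolding m(2) \<alpha>(1)[symmetric] by algebra
      finally have "(m' * (\<beta> * y1 + \<beta> * y2)) * \<alpha> =
          ((\<alpha> * x1)^2 + (\<alpha> * x1) * (\<alpha> * x2) + (\<alpha> * x2)^2) * \<alpha>" .
      then have s2: "m' * (\<beta> * y1 + \<beta> * y2) = (\<alpha> * x1)^2 + (\<alpha> * x1) * (\<alpha> * x2) + (\<alpha> * x2)^2"
        using \<alpha>0 by simp
      have "\<beta> * y2 - \<beta> * y1 = \<beta> * (y2 - y1)" by algebra
      also have "\<dots> = m' * (\<alpha> * x2 - \<alpha> * x1)"
        unfolding m(1) using m' by (simp add: right_diff_distrib flip: mult.assoc)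
      finally have s1: "\<beta> * y2 - \<beta> * y1 = m' * (\<alpha> * x2 - \<alpha> * x1)" .
      have on': "(\<beta> * y1)^2 = (\<alpha> * x1) ^ 3 + \<beta>^2 * c" "(\<beta> * y2)^2 = (\<alpha> * x2) ^ 3 + \<beta>^2 * c"
        using on \<alpha>(1) by (simp_all add: power_mult_distrib distrib_left)
      have "\<not> (\<alpha> * x1 = \<alpha> * x2 \<and> \<beta> * y1 = - (\<beta> * y2))"
        using False \<alpha>0 \<alpha>(2) by (metis mult_cancel_left mult_minus_right)
      from ec_add_slope_eq[OF on' s1 disjI2[OF s2] this]
      have add: "ec_add (Pt (\<alpha> * x1) (\<beta> * y1)) (Pt (\<alpha> * x2) (\<beta> * y2)) =
          Pt (m'^2 - \<alpha> * x1 - \<alpha> * x2) (m' * (\<alpha> * x1 - (m'^2 - \<alpha> * x1 - \<alpha> * x2)) - \<beta> * y1)" .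
      have x3: "\<alpha> * (m^2 - x1 - x2) = m'^2 - \<alpha> * x1 - \<alpha> * x2" using m'2 by algebra
      have "m' * (\<alpha> * x1 - (m'^2 - \<alpha> * x1 - \<alpha> * x2)) - \<beta> * y1 =
          (m' * \<alpha>) * (x1 - (m^2 - x1 - x2)) - \<beta> * y1" unfolding m'2 by algebra
      also have "\<dots> = \<beta> * (m * (x1 - (m^2 - x1 - x2)) - y1)" unfolding m' by algebra
      finally have y3: "m' * (\<alpha> * x1 - (m'^2 - \<alpha> * x1 - \<alpha> * x2)) - \<beta> * y1 =
          \<beta> * (m * (x1 - (m^2 - x1 - x2)) - y1)" .
      show ?thesis unfolding Pt Q m(3) ec_scale.simps add x3 y3 ..
    qed
  qed (simp add: Pt)
qed simp

lemma ec_add_closed: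
  assumes "P \<in> ec_points c" "Q \<in> ec_points c"
  shows "ec_add P Q \<in> ec_points c"
proof (cases P)
  case (Pt x1 y1)
  show ?thesis
  proof (cases Q)
    case Q: (Pt x2 y2)
    have on: "y1^2 = x1 ^ 3 + c" "y2^2 = x2 ^ 3 + c" using assms Pt Q by auto
    show ?thesis
    proof (cases "x1 = x2 \<and> y1 = - y2")
      case False
      obtain m where m: "y2 - y1 = m * (x2 - x1)" "m * (y1 + y2) = x1^2 + x1 * x2 + x2^2"
        "ec_add (Pt x1 y1) (Pt x2 y2) = Pt (m^2 - x1 - x2) (m * (x1 - (m^2 - x1 - x2)) - y1)"
        using ec_add_affine[OF on False] by blast
      have "(m * (x1 - (m^2 - x1 - x2)) - y1)^2 = (m^2 - x1 - x2) ^ 3 + c"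
        using on(1) m(1,2) by algebra
      then show ?thesis by (simp add: Pt Q m(3))
    qed (simp add: Pt Q)
  qed (use assms Pt in simp)
qed (use assms in simp)

lemma ec_add_commute:
  assumes "P \<in> ec_points c" "Q \<in> ec_points c"
  shows "ec_add P Q = ec_add Q P"
proof (cases P)
  case (Pt x1 y1)
  show ?thesis
  proof (cases Q)
    case Q: (Pt x2 y2)
    have on: "y1^2 = x1 ^ 3 + c" "y2^2 = x2 ^ 3 + c" using assms Pt Q by auto
    show ?thesis
    proof (cases "x1 = x2 \<and> y1 = - y2")
      case False
      obtain m where m: "y2 - y1 = m * (x2 - x1)" "m * (y1 + y2) = x1^2 + x1 * x2 + x2^2"
        "ec_add (Pt x1 y1) (Pt x2 y2) = Pt (m^2 - x1 - x2) (m * (x1 - (m^2 - x1 - x2)) - y1)"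
        using ec_add_affine[OF on False] by blast
      have "y1 - y2 = m * (x1 - x2)" "m * (y2 + y1) = x2^2 + x2 * x1 + x1^2"
        using m(1,2) by algebra+
      then have "ec_add (Pt x2 y2) (Pt x1 y1) = Pt (m^2 - x2 - x1) (m * (x2 - (m^2 - x2 - x1)) - y2)"
        using on False by (intro ec_add_slope_eq) auto
      moreover have "m * (x1 - (m^2 - x1 - x2)) - y1 = m * (x2 - (m^2 - x2 - x1)) - y2"
        using m(1) by algebra
      ultimately show ?thesis by (simp add: Pt Q m(3))
    qed (auto simp add: Pt Q)
  qed (use Pt in simp)
qed simp

section \<open>Complete addition laws\<close>

text \<open>
  Two addition laws of bidegree \<open>(2, 2)\<close>. The coordinates of the sum given by the first one are not
  all zero off the diagonal, those given by the second one are not all zero on the diagonal.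
\<close>

definition ec_law1 :: "complex \<Rightarrow> (nat \<Rightarrow> complex) \<Rightarrow> (nat \<Rightarrow> complex) \<Rightarrow> nat \<Rightarrow> complex" where
  "ec_law1 c u v j =
    (if j = 0 then 3 * u 1 * v 1 * (u 1 * v 0 - v 1 * u 0)
        - (u 2 * v 0 + v 2 * u 0) * (u 2 * v 0 - v 2 * u 0)
     else if j = 1 then (u 1 * v 2 - v 1 * u 2) * (u 2 * v 0 + v 2 * u 0)
        + (u 1 * v 0 - v 1 * u 0) * (u 2 * v 2 - 3 * c * u 0 * v 0)
     else if j = 2 then - 3 * u 1 * v 1 * (u 1 * v 2 - v 1 * u 2)
        - (u 2 * v 0 - v 2 * u 0) * (u 2 * v 2 - 3 * c * u 0 * v 0)
     else 0)"

definition ec_law2 :: "complex \<Rightarrow> (nat \<Rightarrow> complex) \<Rightarrow> (nat \<Rightarrow> complex) \<Rightarrow> nat \<Rightarrow> complex" where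
  "ec_law2 c u v j =
    (if j = 0 then (u 2 * v 0 + v 2 * u 0) * (u 2 * v 2 + 3 * c * u 0 * v 0)
        + 3 * u 1 * v 1 * (u 1 * v 2 + v 1 * u 2)
     else if j = 1 then (u 1 * v 2 + v 1 * u 2) * (u 2 * v 2 - 3 * c * u 0 * v 0)
        - 3 * c * (u 2 * v 0 + v 2 * u 0) * (u 1 * v 0 + v 1 * u 0)
     else if j = 2 then (u 2 * v 2 + 3 * c * u 0 * v 0) * (u 2 * v 2 - 3 * c * u 0 * v 0)
        + 9 * c * u 1 * v 1 * (u 1 * v 0 + v 1 * u 0)
     else 0)"

lemma ec_law1_affine:
  "ec_law1 c (ec_coord (Pt x1 y1)) (ec_coord (Pt x2 y2)) 0 = 3 * x1 * x2 * (x1 - x2) - (y1 + y2) * (y1 - y2)"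
  "ec_law1 c (ec_coord (Pt x1 y1)) (ec_coord (Pt x2 y2)) 1 =
    (x1 * y2 - x2 * y1) * (y1 + y2) + (x1 - x2) * (y1 * y2 - 3 * c)"
  "ec_law1 c (ec_coord (Pt x1 y1)) (ec_coord (Pt x2 y2)) 2 =
    - 3 * x1 * x2 * (x1 * y2 - x2 * y1) - (y1 - y2) * (y1 * y2 - 3 * c)"
  by (simp_all add: ec_law1_def)

lemma ec_law2_affine:
  "ec_law2 c (ec_coord (Pt x1 y1)) (ec_coord (Pt x2 y2)) 0 =
    (y1 + y2) * (y1 * y2 + 3 * c) + 3 * x1 * x2 * (x1 * y2 + x2 * y1)"
  "ec_law2 c (ec_coord (Pt x1 y1)) (ec_coord (Pt x2 y2)) 1 =
    (x1 * y2 + x2 * y1) * (y1 * y2 - 3 * c) - 3 * c * (y1 + y2) * (x1 + x2)"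
  "ec_law2 c (ec_coord (Pt x1 y1)) (ec_coord (Pt x2 y2)) 2 =
    (y1 * y2 + 3 * c) * (y1 * y2 - 3 * c) + 9 * c * x1 * x2 * (x1 + x2)"
  by (simp_all add: ec_law2_def)

text \<open>
  On affine points that are not opposite, both laws follow from the two equations for the slope;
  with \<open>d = \<zeta>' - \<zeta>\<close> the second equation is monic in \<open>d\<close>, and division by it yields the cofactors.
\<close>

lemma ec_laws_slope:
  fixes x1 :: complex
  assumes on: "y1^2 = x1 ^ 3 + c"
    and m: "y2 - y1 = m * (x2 - x1)" "m * (y1 + y2) = x1^2 + x1 * x2 + x2^2"
    and x3: "x3 = m^2 - x1 - x2" and y3: "y3 = m * (x1 - x3) - y1"
    and u: "u = ec_coord (Pt x1 y1)" and v: "v = ec_coord (Pt x2 y2)"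
  shows "ec_law1 c u v 1 = ec_law1 c u v 0 * x3" "ec_law1 c u v 2 = ec_law1 c u v 0 * y3"
    "ec_law2 c u v 1 = ec_law2 c u v 0 * x3" "ec_law2 c u v 2 = ec_law2 c u v 0 * y3"
proof -
  define d where "d = x2 - x1"
  define r where "r = d^2 + 3 * x1 * d + 3 * x1^2 - m^2 * d - 2 * y1 * m"
  have x2: "x2 = x1 + d" by (simp add: d_def)
  have y2: "y2 = y1 + m * d" using m(1) unfolding d_def by algebra
  have c: "c = y1^2 - x1^3" using on by simp
  have r: "r = 0" using m(2) unfolding r_def x2 y2 by algebra
  have x3': "x3 = m^2 - x1 - (x1 + d)" by (simp add: x3 x2)
  have y3': "y3 = m * (x1 - (m^2 - x1 - (x1 + d))) - y1" by (simp add: y3 x3')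
  have "ec_law1 c u v 1 - ec_law1 c u v 0 * x3 = (d * m^2 - 3 * d * x1) * r"
    unfolding u v ec_law1_affine x3' y3' x2 y2 c r_def by algebra
  then show "ec_law1 c u v 1 = ec_law1 c u v 0 * x3" by (simp add: r)
  have "ec_law1 c u v 2 - ec_law1 c u v 0 * y3 = (3 * d * x1 * m - d * m^3) * r"
    unfolding u v ec_law1_affine x3' y3' x2 y2 c r_def by algebra
  then show "ec_law1 c u v 2 = ec_law1 c u v 0 * y3" by (simp add: r)
  have "ec_law2 c u v 1 - ec_law2 c u v 0 * x3 = (3 * d * x1^2 * m + 3 * d * x1 * y1 + d * m^2 * y1
      + 6 * x1^2 * y1 + 4 * m * y1^2) * r"
    unfolding u v ec_law2_affine x3' y3' x2 y2 c r_def by algebra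
  then show "ec_law2 c u v 1 = ec_law2 c u v 0 * x3" by (simp add: r)
  have "ec_law2 c u v 2 - ec_law2 c u v 0 * y3 = (12 * x1 * y1^2 - 3 * d * x1^2 * m^2
      - 3 * d * x1 * m * y1 - d * m^3 * y1 - 9 * x1^4 - 6 * x1^2 * m * y1 - 4 * m^2 * y1^2) * r"
    unfolding u v ec_law2_affine x3' y3' x2 y2 c r_def by algebra
  then show "ec_law2 c u v 2 = ec_law2 c u v 0 * y3" by (simp add: r)
qed

lemma ec_coord_proportionalI:
  assumes "L 1 = L 0 * x" "L 2 = L 0 * y" "\<And>j. j > 2 \<Longrightarrow> L j = 0"
  shows "\<exists>t. \<forall>j. L j = t * ec_coord (Pt x y) j"
proof (intro exI[of _ "L 0"] allI)
  fix j :: nat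
  consider "j = 0" | "j = 1" | "j = 2" | "j > 2" by linarith
  then show "L j = L 0 * ec_coord (Pt x y) j" by cases (use assms in auto)
qed

lemma ec_law_proportional:
  assumes "L = ec_law1 c \<or> L = ec_law2 c" and P: "P \<in> ec_points c" "Q \<in> ec_points c"
  shows "\<exists>t. \<forall>j. L (ec_coord P) (ec_coord Q) j = t * ec_coord (ec_add P Q) j"
proof (cases P)
  case (Pt x1 y1)
  show ?thesis
  proof (cases Q)
    case Q: (Pt x2 y2)
    have on: "y1^2 = x1 ^ 3 + c" "y2^2 = x2 ^ 3 + c" using P Pt Q by auto
    show ?thesis
    proof (cases "x1 = x2 \<and> y1 = - y2")
      case True
      then show ?thesis using assms(1)
        by (intro exI[of _ "L (ec_coord P) (ec_coord Q) 2"])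
          (auto simp add: Pt Q ec_law1_def ec_law2_def)
    next
      case False
      obtain m where m: "y2 - y1 = m * (x2 - x1)" "m * (y1 + y2) = x1^2 + x1 * x2 + x2^2"
        "ec_add (Pt x1 y1) (Pt x2 y2) = Pt (m^2 - x1 - x2) (m * (x1 - (m^2 - x1 - x2)) - y1)"
        using ec_add_affine[OF on False] by blast
      note slope = ec_laws_slope[OF on(1) m(1,2) refl refl refl refl]
      have "ec_law1 c u v j = 0" "ec_law2 c u v j = 0" if "j > 2" for j u v
        using that by (simp_all add: ec_law1_def ec_law2_def)
      then show ?thesis
        using assms(1) ec_coord_proportionalI[OF slope(1,2)] ec_coord_proportionalI[OF slope(3,4)]
        unfolding Pt Q m(3) by blast
    qed
  next
    case EInf
    have "ec_law1 c (ec_coord P) (ec_coord Q) j = 1 * ec_coord (ec_add P Q) j"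
      "ec_law2 c (ec_coord P) (ec_coord Q) j = y1 * ec_coord (ec_add P Q) j" for j
      by (simp_all add: Pt EInf ec_law1_def ec_law2_def)
    then show ?thesis using assms(1) by blast
  qed
next
  case EInf
  have "ec_law1 c (ec_coord P) (ec_coord Q) j =
      (case Q of EInf \<Rightarrow> 0 | Pt x y \<Rightarrow> - 1) * ec_coord (ec_add P Q) j"
    "ec_law2 c (ec_coord P) (ec_coord Q) j =
      (case Q of EInf \<Rightarrow> 1 | Pt x y \<Rightarrow> y) * ec_coord (ec_add P Q) j" for j
    unfolding EInf by (cases Q, simp_all add: ec_law1_def ec_law2_def)+
  then show ?thesis using assms(1) by blast
qed

lemma poly_fun_ec_law:
  assumes "\<And>j. poly_fun (\<lambda>v. u v j)" "\<And>j. poly_fun (\<lambda>v. w v j)"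
  shows "poly_fun (\<lambda>v. ec_law1 c (u v) (w v) j)" "poly_fun (\<lambda>v. ec_law2 c (u v) (w v) j)"
  unfolding ec_law1_def ec_law2_def
  by (intro poly_fun_if poly_fun_diff poly_fun.add poly_fun.mult poly_fun.const assms)+

lemma ec_law_scale:
  "ec_law1 c (\<lambda>j. t * u j) v j = t^2 * ec_law1 c u v j" "ec_law1 c u (\<lambda>j. t * v j) j = t^2 * ec_law1 c u v j"
  "ec_law2 c (\<lambda>j. t * u j) v j = t^2 * ec_law2 c u v j" "ec_law2 c u (\<lambda>j. t * v j) j = t^2 * ec_law2 c u v j"
  unfolding ec_law1_def ec_law2_def by (simp_all add: algebra_simps power2_eq_square)

lemma ec_law1_nonzero:
  assumes P: "P \<in> ec_points c" "Q \<in> ec_points c" "P \<noteq> Q" and c: "c \<noteq> 0"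
  shows "\<exists>j. ec_law1 c (ec_coord P) (ec_coord Q) j \<noteq> 0"
proof (cases P)
  case (Pt x1 y1)
  show ?thesis
  proof (cases Q)
    case Q: (Pt x2 y2)
    have on: "y1^2 = x1 ^ 3 + c" "y2^2 = x2 ^ 3 + c" using P Pt Q by auto
    show ?thesis
    proof (cases "x1 = x2")
      case True
      then have "(y1 - y2) * (y1 + y2) = 0"
        using on by (simp add: power2_eq_square algebra_simps)
      then have y2: "y2 = - y1" and y1: "y1 \<noteq> 0"
        using P(3) True Pt Q by (auto simp: add_eq_0_iff)
      have "ec_law1 c (ec_coord P) (ec_coord Q) 2 = 8 * y1 ^ 3"
        unfolding Pt Q ec_law1_affine True[symmetric] y2 using on(1) by algebra
      then show ?thesis using y1 by (metis mult_eq_0_iff power_not_zero zero_neq_numeral)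
    next
      case False
      have "ec_law1 c (ec_coord P) (ec_coord Q) 0 = (x2 - x1) ^ 3"
        unfolding Pt Q ec_law1_affine using on by algebra
      then show ?thesis using False by (metis eq_iff_diff_eq_0 power_not_zero)
    qed
  next
    case EInf
    then show ?thesis by (intro exI[of _ 0]) (simp add: Pt ec_law1_def)
  qed
next
  case EInf
  then show ?thesis using P(3) by (intro exI[of _ 0]) (cases Q; simp add: ec_law1_def)
qed

lemma ec_law2_nonzero:
  assumes P: "P \<in> ec_points c" and c: "c \<noteq> 0"
  shows "\<exists>j. ec_law2 c (ec_coord P) (ec_coord P) j \<noteq> 0"
proof (cases P)
  case (Pt x y)
  have on: "y^2 = x ^ 3 + c" using P Pt by auto
  show ?thesis
  proof (cases "y = 0")
    case True
    then have "ec_law2 c (ec_coord P) (ec_coord P) 2 = - 27 * c^2"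
      unfolding Pt ec_law2_affine using on by algebra
    then show ?thesis using c by (intro exI[of _ 2]) simp
  next
    case False
    have "ec_law2 c (ec_coord P) (ec_coord P) 0 = 8 * y ^ 3"
      unfolding Pt ec_law2_affine using on by algebra
    then show ?thesis using False by (intro exI[of _ 0]) simp
  qed
next
  case EInf
  then show ?thesis by (intro exI[of _ 2]) (simp add: ec_law2_def)
qed

lemma ec_law_nonzero:
  assumes "P \<in> ec_points c" "Q \<in> ec_points c" "c \<noteq> 0"
  shows "\<exists>L. (L = ec_law1 c \<or> L = ec_law2 c) \<and> (\<exists>j. L (ec_coord P) (ec_coord Q) j \<noteq> 0)"
  using ec_law1_nonzero[OF assms(1,2) _ assms(3)] ec_law2_nonzero[OF assms(1,3)] by metis

lemma polynomial_map_at_ec_add: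
  assumes "P \<in> ec_points c" "Q \<in> ec_points c" "c \<noteq> 0"
  shows "polynomial_map_at (ec_points c \<times> ec_points c) (\<lambda>(p, q). [ec_coord p, ec_coord q])
    (ec_var c) (\<lambda>(p, q). ec_add p q) (P, Q)"
proof -
  obtain L where L: "L = ec_law1 c \<or> L = ec_law2 c" and nz: "\<exists>j. L (ec_coord P) (ec_coord Q) j \<noteq> 0"
    using ec_law_nonzero[OF assms] by blast
  have blocks: "coord_blocks [u, v] 0 = u" "coord_blocks [u, v] (Suc 0) = v" for u v
    by (simp_all add: coord_blocks_def)
  show ?thesis
    unfolding polynomial_map_at_def
  proof (intro exI[of _ "\<lambda>i. if i < 2 then 2 else 0"] exI[of _ "\<lambda>j v. L (v 0) (v 1) j"]
      conjI allI ballI)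
    show "multihomogeneous (\<lambda>i. if i < 2 then 2 else 0) (\<lambda>v. L (v 0) (v 1) j)" for j
      unfolding multihomogeneous_def
    proof (intro conjI allI)
      show "poly_fun (\<lambda>v. L (v 0) (v 1) j)"
        using L poly_fun_ec_law[of "\<lambda>v. v 0" "\<lambda>v. v 1", OF poly_fun.coord poly_fun.coord] by auto
      fix v :: "nat \<Rightarrow> nat \<Rightarrow> complex" and i :: nat and t :: complex
      consider "i = 0" | "i = 1" | "i > 1" by linarith
      then show "L ((v(i := \<lambda>j. t * v i j)) 0) ((v(i := \<lambda>j. t * v i j)) 1) j =
          t ^ (if i < 2 then 2 else 0) * L (v 0) (v 1) j"
        using L by cases (auto simp: ec_law_scale)
    qed
    show "\<exists>j. L (coord_blocks (case (P, Q) of (p, q) \<Rightarrow> [ec_coord p, ec_coord q]) 0)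
        (coord_blocks (case (P, Q) of (p, q) \<Rightarrow> [ec_coord p, ec_coord q]) 1) j \<noteq> 0"
      using nz by (simp add: blocks)
    fix q assume "q \<in> ec_points c \<times> ec_points c"
    then show "\<exists>t. \<forall>j. L (coord_blocks (case q of (p, q) \<Rightarrow> [ec_coord p, ec_coord q]) 0)
        (coord_blocks (case q of (p, q) \<Rightarrow> [ec_coord p, ec_coord q]) 1) j =
        t * hcoord (ec_var c) (case q of (p, q) \<Rightarrow> ec_add p q) j"
      using ec_law_proportional[OF L] by (cases q) (auto simp: blocks)
  qed
qed

lemma polynomial_map_at_ec_translation:
  assumes "A \<in> ec_points c" "Q \<in> ec_points c" "c \<noteq> 0"
  shows "polynomial_map_at (ec_points c) (\<lambda>p. [ec_coord p]) (ec_var c) (ec_add A) Q"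
proof -
  obtain L where L: "L = ec_law1 c \<or> L = ec_law2 c" and nz: "\<exists>j. L (ec_coord A) (ec_coord Q) j \<noteq> 0"
    using ec_law_nonzero[OF assms] by blast
  have blocks: "coord_blocks [u] 0 = u" for u
    by (simp add: coord_blocks_def)
  show ?thesis
    unfolding polynomial_map_at_def
  proof (intro exI[of _ "\<lambda>i. if i = 0 then 2 else 0"] exI[of _ "\<lambda>j v. L (ec_coord A) (v 0) j"]
      conjI allI ballI)
    show "multihomogeneous (\<lambda>i. if i = 0 then 2 else 0) (\<lambda>v. L (ec_coord A) (v 0) j)" for j
      unfolding multihomogeneous_def
    proof (intro conjI allI)
      show "poly_fun (\<lambda>v. L (ec_coord A) (v 0) j)"
        using L poly_fun_ec_law[of "\<lambda>v. ec_coord A" "\<lambda>v. v 0", OF poly_fun.const poly_fun.coord]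
        by auto
      fix v :: "nat \<Rightarrow> nat \<Rightarrow> complex" and i :: nat and t :: complex
      show "L (ec_coord A) ((v(i := \<lambda>j. t * v i j)) 0) j =
          t ^ (if i = 0 then 2 else 0) * L (ec_coord A) (v 0) j"
        using L by (auto simp: ec_law_scale)
    qed
    show "\<exists>j. L (ec_coord A) (coord_blocks [ec_coord Q] 0) j \<noteq> 0"
      using nz by (simp add: blocks)
    fix q assume "q \<in> ec_points c"
    then show "\<exists>t. \<forall>j. L (ec_coord A) (coord_blocks [ec_coord q] 0) j =
        t * hcoord (ec_var c) (ec_add A q) j"
      using ec_law_proportional[OF L assms(1)] by (simp add: blocks)
  qed
qed

section \<open>Polynomial maps on the curve agree if they agree off a finite set\<close>

lemma ec_affine_point_limit:
  assumes "Pt x y \<in> ec_points c" "finite F"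
  obtains xs ys where "\<And>k. Pt (xs k) (ys k) \<in> ec_points c" "xs \<longlonglongrightarrow> x" "ys \<longlonglongrightarrow> y"
    "eventually (\<lambda>k. Pt (xs k) (ys k) \<notin> F) sequentially"
proof -
  have on: "y^2 = x ^ 3 + c" using assms(1) by simp
  define xs where "xs = (\<lambda>k. x + of_real (inverse (real (Suc k))))"
  have "(\<lambda>k. x + of_real (inverse (real (Suc k)))) \<longlonglongrightarrow> x + of_real 0"
    by (intro tendsto_intros LIMSEQ_inverse_real_of_nat)
  then have xs: "xs \<longlonglongrightarrow> x" unfolding xs_def by simp
  \<comment> \<open>Of the two square roots, the one closer to \<open>y\<close> converges to \<open>y\<close>.\<close>
  have "\<exists>w. w^2 = xs k ^ 3 + c \<and> norm (w - y) \<le> norm (w + y)" for k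
  proof -
    define s where "s = csqrt (xs k ^ 3 + c)"
    have s: "s^2 = xs k ^ 3 + c" by (simp add: s_def)
    show ?thesis
    proof (cases "norm (s - y) \<le> norm (s + y)")
      case True
      then show ?thesis using s by blast
    next
      case False
      then have "norm (- s - y) \<le> norm (- s + y)"
        by (metis add_uminus_conv_diff linear minus_add_distrib minus_diff_eq norm_minus_commute
            norm_minus_cancel uminus_add_conv_diff)
      then show ?thesis using s by (intro exI[of _ "- s"]) simp
    qed
  qed
  then obtain ys where ys: "\<And>k. (ys k)^2 = xs k ^ 3 + c" "\<And>k. norm (ys k - y) \<le> norm (ys k + y)"
    by metis
  have bound: "norm (ys k - y) ^ 2 \<le> norm ((xs k ^ 3 + c) - y^2)" for k
  proof -
    have "norm (ys k - y) ^ 2 \<le> norm (ys k - y) * norm (ys k + y)"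
      unfolding power2_eq_square by (rule mult_left_mono[OF ys(2)]) simp
    also have "\<dots> = norm ((xs k ^ 3 + c) - y^2)"
      unfolding ys(1)[symmetric] norm_mult[symmetric] by (simp add: power2_eq_square algebra_simps)
    finally show ?thesis .
  qed
  have "(\<lambda>k. (xs k ^ 3 + c) - y^2) \<longlonglongrightarrow> (x ^ 3 + c) - y^2" by (intro tendsto_intros xs)
  then have "(\<lambda>k. (xs k ^ 3 + c) - y^2) \<longlonglongrightarrow> 0" by (simp add: on)
  then have "(\<lambda>k. norm (ys k - y) ^ 2) \<longlonglongrightarrow> 0"
    by (rule Lim_null_comparison[rotated, OF tendsto_norm_zero]) (simp add: bound)
  then have "(\<lambda>k. sqrt (norm (ys k - y) ^ 2)) \<longlonglongrightarrow> sqrt 0" by (intro tendsto_intros)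
  then have "(\<lambda>k. norm (ys k - y)) \<longlonglongrightarrow> 0" by simp
  then have y: "ys \<longlonglongrightarrow> y" by (simp add: LIM_zero_iff tendsto_norm_zero_iff)
  have "inj xs" by (auto simp: inj_def xs_def)
  then have "inj (\<lambda>k. Pt (xs k) (ys k))" by (auto simp: inj_def)
  then have "finite ((\<lambda>k. Pt (xs k) (ys k)) -` F)" using assms(2) by (intro finite_vimageI)
  then have ev: "eventually (\<lambda>k. Pt (xs k) (ys k) \<notin> F) sequentially"
    unfolding cofinite_eq_sequentially[symmetric] eventually_cofinite by (simp add: vimage_def)
  show ?thesis by (rule that[OF _ xs y ev]) (simp add: ys(1))
qed

text \<open>
  The two-by-two minors of the coordinates of both maps are polynomials. They vanish off \<open>F\<close>, and by
  continuity they vanish at every affine point, which is a limit of points off \<open>F\<close>.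
\<close>

lemma ec_polynomial_maps_eqI:
  assumes p: "Pt x y \<in> ec_points c" and F: "finite F"
    and f: "polynomial_map_at (ec_points c) (\<lambda>p. [ec_coord p]) (ec_var c) f (Pt x y)"
    and g: "polynomial_map_at (ec_points c) (\<lambda>p. [ec_coord p]) (ec_var c) g (Pt x y)"
    and eq: "\<And>q. q \<in> ec_points c - F \<Longrightarrow> f q = g q"
  shows "f (Pt x y) = g (Pt x y)"
proof -
  let ?h = "\<lambda>p. coord_blocks [ec_coord p]"
  obtain d P where P: "\<And>j. multihomogeneous d (P j)" "\<exists>j. P j (?h (Pt x y)) \<noteq> 0"
    "\<And>q. q \<in> ec_points c \<Longrightarrow> \<exists>t. \<forall>j. P j (?h q) = t * ec_coord (f q) j"
    using f unfolding polynomial_map_at_def ec_var_simps by blast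
  obtain e Q where Q: "\<And>j. multihomogeneous e (Q j)" "\<exists>j. Q j (?h (Pt x y)) \<noteq> 0"
    "\<And>q. q \<in> ec_points c \<Longrightarrow> \<exists>t. \<forall>j. Q j (?h q) = t * ec_coord (g q) j"
    using g unfolding polynomial_map_at_def ec_var_simps by blast
  obtain xs ys where s: "\<And>k. Pt (xs k) (ys k) \<in> ec_points c" "xs \<longlonglongrightarrow> x" "ys \<longlonglongrightarrow> y"
    "eventually (\<lambda>k. Pt (xs k) (ys k) \<notin> F) sequentially"
    using ec_affine_point_limit[OF p F] by blast
  have lim: "(\<lambda>k. ?h (Pt (xs k) (ys k)) i j) \<longlonglongrightarrow> ?h (Pt x y) i j" for i j
    using s(2,3) by (cases "i = 0"; cases "j = 0"; cases "j = 1"; cases "j = 2")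
      (simp_all add: coord_blocks_def)
  have cross: "P i (?h (Pt x y)) * Q j (?h (Pt x y)) = P j (?h (Pt x y)) * Q i (?h (Pt x y))" for i j
  proof -
    define A where "A v = P i v * Q j v - P j v * Q i v" for v
    have "poly_fun A"
      unfolding A_def
      by (intro poly_fun_diff poly_fun.mult multihomogeneous_poly_fun[OF P(1)]
          multihomogeneous_poly_fun[OF Q(1)])
    then have "(\<lambda>k. A (?h (Pt (xs k) (ys k)))) \<longlonglongrightarrow> A (?h (Pt x y))"
      by (rule poly_fun_tendsto) (rule lim)
    moreover have "A (?h q) = 0" if q: "q \<in> ec_points c - F" for q
    proof -
      obtain t t' where "\<forall>j. P j (?h q) = t * ec_coord (f q) j" "\<forall>j. Q j (?h q) = t' * ec_coord (g q) j"
        using P(3)[of q] Q(3)[of q] q by blast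
      then show ?thesis using eq[OF q] by (simp add: A_def)
    qed
    then have "eventually (\<lambda>k. A (?h (Pt (xs k) (ys k))) = 0) sequentially"
      using s(1) by (intro eventually_mono[OF s(4)]) auto
    then have "(\<lambda>k. A (?h (Pt (xs k) (ys k)))) \<longlonglongrightarrow> 0" by (rule tendsto_eventually)
    ultimately have "A (?h (Pt x y)) = 0" using LIMSEQ_unique by blast
    then show ?thesis by (simp add: A_def)
  qed
  obtain t where t: "\<forall>j. P j (?h (Pt x y)) = t * ec_coord (f (Pt x y)) j" using P(3)[OF p] by blast
  obtain t' where t': "\<forall>j. Q j (?h (Pt x y)) = t' * ec_coord (g (Pt x y)) j" using Q(3)[OF p]
    by blast
  have nz: "t \<noteq> 0" "t' \<noteq> 0" using t P(2) t' Q(2) by auto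
  obtain k where k: "ec_coord (g (Pt x y)) k \<noteq> 0" using ec_coord_nonzero by blast
  have "ec_coord (f (Pt x y)) = (\<lambda>j. ec_coord (f (Pt x y)) k / ec_coord (g (Pt x y)) k * ec_coord (g (Pt x y)) j)"
  proof
    fix j
    have "t * t' * (ec_coord (f (Pt x y)) j * ec_coord (g (Pt x y)) k) =
        t * t' * (ec_coord (f (Pt x y)) k * ec_coord (g (Pt x y)) j)"
      using cross[of j k] t t' by (simp add: mult_ac)
    then show "ec_coord (f (Pt x y)) j = ec_coord (f (Pt x y)) k / ec_coord (g (Pt x y)) k * ec_coord (g (Pt x y)) j"
      using nz k by (simp add: field_simps)
  qed
  then show ?thesis by (rule ec_coord_inj)
qed

section \<open>Associativity\<close>

fun ec_neg :: "ecpoint \<Rightarrow> ecpoint" where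
  "ec_neg (Pt x y) = Pt x (- y)"
| "ec_neg EInf = EInf"

lemma ec_neg_points [simp]: "ec_neg P \<in> ec_points c \<longleftrightarrow> P \<in> ec_points c"
  by (cases P) auto

lemma ec_add_neg: "ec_add P (ec_neg P) = EInf" "ec_add (ec_neg P) P = EInf"
  by (cases P; simp)+

lemma finite_ec_points_over:
  assumes "finite X" shows "finite {Pt x y |x y. Pt x y \<in> ec_points c \<and> x \<in> X}"
proof (rule finite_subset)
  show "{Pt x y |x y. Pt x y \<in> ec_points c \<and> x \<in> X} \<subseteq>
      (\<lambda>x. Pt x (csqrt (x ^ 3 + c))) ` X \<union> (\<lambda>x. Pt x (- csqrt (x ^ 3 + c))) ` X"
  proof
    fix q assume "q \<in> {Pt x y |x y. Pt x y \<in> ec_points c \<and> x \<in> X}"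
    then obtain x y where q: "q = Pt x y" "y^2 = x ^ 3 + c" "x \<in> X" by auto
    then have "y^2 = (csqrt (x ^ 3 + c))^2" by simp
    then have "y = csqrt (x ^ 3 + c) \<or> y = - csqrt (x ^ 3 + c)" by (simp only: power2_eq_iff)
    then show "q \<in> (\<lambda>x. Pt x (csqrt (x ^ 3 + c))) ` X \<union> (\<lambda>x. Pt x (- csqrt (x ^ 3 + c))) ` X"
      using q by blast
  qed
qed (use assms in simp)

lemma ec_add_chord:
  fixes x1 :: complex
  assumes "x1 \<noteq> x2" "y2 - y1 = m * (x2 - x1)"
  shows "ec_add (Pt x1 y1) (Pt x2 y2) = Pt (m^2 - x1 - x2) (m * (x1 - (m^2 - x1 - x2)) - y1)"
proof -
  have "(y2 - y1) / (x2 - x1) = m" using assms by simp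
  then show ?thesis using assms(1) by (simp add: Let_def ec_add.simps)
qed

text \<open>
  When all four sums are formed by chords, the sum of the slopes of the two chords that lead to
  \<open>(P + Q) + R\<close> equals \<open>(r - p) / (m\<^sub>3 - m\<^sub>1)\<close> in terms of the slopes \<open>m\<^sub>1\<close>, \<open>m\<^sub>3\<close> of the chords
  \<open>PQ\<close> and \<open>QR\<close>. The corresponding sum for \<open>P + (Q + R)\<close> has the same value, since the expression is
  symmetric under the exchange of \<open>P\<close> and \<open>R\<close>.
\<close>

lemma ec_add_assoc_chords:
  assumes on: "yp^2 = p ^ 3 + c" "yq^2 = q ^ 3 + c" "yr^2 = r ^ 3 + c"
    and ne: "p \<noteq> q" "q \<noteq> r" "p \<noteq> r"
    and A: "ec_add (Pt p yp) (Pt q yq) = Pt a ya" "a \<noteq> r"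
    and B: "ec_add (Pt q yq) (Pt r yr) = Pt b yb" "b \<noteq> p"
  shows "ec_add (Pt a ya) (Pt r yr) = ec_add (Pt p yp) (Pt b yb)"
proof -
  define m1 m2 m3 m4 where "m1 = (yq - yp) / (q - p)" and "m2 = (yr - ya) / (r - a)"
    and "m3 = (yr - yq) / (r - q)" and "m4 = (yb - yp) / (b - p)"
  have m1: "yq - yp = m1 * (q - p)" and m2: "yr - ya = m2 * (r - a)"
    and m3: "yr - yq = m3 * (r - q)" and m4: "yb - yp = m4 * (b - p)"
    using ne A(2) B(2) by (simp_all add: m1_def m2_def m3_def m4_def)
  have a: "a = m1^2 - p - q" and ya: "ya = m1 * (p - a) - yp"
    using A(1) ec_add_chord[OF ne(1) m1] by auto
  have b: "b = m3^2 - q - r" and yb: "yb = m3 * (q - b) - yq"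
    using B(1) ec_add_chord[OF ne(2) m3] by auto
  have "(m1 * (yp + yq) - (p^2 + p * q + q^2)) * (q - p) = 0" using on(1,2) m1 by algebra
  then have t1: "m1 * (yp + yq) = p^2 + p * q + q^2" using ne(1) by simp
  have "(m3 * (yq + yr) - (q^2 + q * r + r^2)) * (r - q) = 0" using on(2,3) m3 by algebra
  then have t3: "m3 * (yq + yr) = q^2 + q * r + r^2" using ne(2) by simp
  \<comment> \<open>The line of slope \<open>m1\<close> meets the curve over \<open>p\<close>, \<open>q\<close>, \<open>a\<close>.\<close>
  have "(yr - (yp + m1 * (r - p))) * (yr + (yp + m1 * (r - p))) = (r - p) * (r - q) * (r - a)"
    using on(1,3) m1 t1 a by algebra
  moreover have "yr - (yp + m1 * (r - p)) = (m3 - m1) * (r - q)" using m1 m3 by algebra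
  moreover have "yr + (yp + m1 * (r - p)) = (m1 + m2) * (r - a)" using m2 ya by algebra
  ultimately have "((m1 + m2) * (m3 - m1)) * ((r - q) * (r - a)) = (r - p) * ((r - q) * (r - a))"
    by (simp add: mult_ac)
  then have n1: "(m1 + m2) * (m3 - m1) = r - p" using ne(2) A(2) by simp
  have "(yp - (yq + m3 * (p - q))) * (yp + (yq + m3 * (p - q))) = (p - q) * (p - r) * (p - b)"
    using on(1,2) m3 t3 b by algebra
  moreover have "yp - (yq + m3 * (p - q)) = (m1 - m3) * (p - q)" using m1 m3 by algebra
  moreover have "yp + (yq + m3 * (p - q)) = (m3 + m4) * (p - b)" using m4 yb by algebra
  ultimately have "((m3 + m4) * (m1 - m3)) * ((p - q) * (p - b)) = (p - r) * ((p - q) * (p - b))"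
    by (simp add: mult_ac)
  then have n2: "(m3 + m4) * (m1 - m3) = p - r" using ne(1) B(2) by simp
  have "m1 \<noteq> m3" using n1 ne(3) by auto
  have "((m1 + m2) - (m3 + m4)) * (m3 - m1) = 0" using n1 n2 by algebra
  then have n: "m1 + m2 = m3 + m4" using \<open>m1 \<noteq> m3\<close> by simp
  define s where "s = m2^2 - a - r"
  have s: "s = m4^2 - p - b" using n n1 a b unfolding s_def by algebra
  have y: "m2 * (a - s) - ya = m4 * (p - s) - yp"
    using n n1 a m1 m2 m3 unfolding s_def by algebra
  have "ec_add (Pt a ya) (Pt r yr) = Pt s (m2 * (a - s) - ya)"
    using ec_add_chord[OF A(2) m2] by (simp add: s_def)
  moreover have "ec_add (Pt p yp) (Pt b yb) = Pt s (m4 * (p - s) - yp)"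
    using ec_add_chord[OF B(2)[symmetric] m4] by (simp add: s)
  ultimately show ?thesis using y by simp
qed

text \<open>
  The opposites of the points on a chord lie on a chord of the opposite slope.
\<close>

lemma ec_neg_add_cancel_chord:
  assumes "q \<noteq> r" "ec_add (Pt q yq) (Pt r yr) = Pt b yb" "b \<noteq> q"
  shows "ec_add (ec_neg (Pt q yq)) (Pt b yb) = Pt r yr"
proof -
  define m where "m = (yr - yq) / (r - q)"
  have m: "yr - yq = m * (r - q)" using assms(1) by (simp add: m_def)
  have b: "b = m^2 - q - r" and yb: "yb = m * (q - b) - yq"
    using assms(2) ec_add_chord[OF assms(1) m] by auto
  have "yb - (- yq) = (- m) * (b - q)" using yb by algebra
  note sum = ec_add_chord[OF assms(3)[symmetric] this]
  have x3: "(- m)^2 - q - b = r" using b by algebra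
  have y3: "(- m) * (q - r) - (- yq) = yr" using m by algebra
  show ?thesis using sum unfolding x3 y3 by simp
qed

text \<open>
  Associativity for all \<open>R\<close> follows by continuation from the \<open>R\<close> for which all sums are chords;
  this settles the case of different \<open>\<zeta>\<close>-coordinates of \<open>P\<close> and \<open>Q\<close>, which continuation in \<open>Q\<close>
  removes.
\<close>

lemma ec_add_assoc:
  assumes P: "P \<in> ec_points c" "Q \<in> ec_points c" "R \<in> ec_points c" and c: "c \<noteq> 0"
  shows "ec_add (ec_add P Q) R = ec_add P (ec_add Q R)"
proof -
  note closed = ec_add_closed[where c = c]
  have comp: "polynomial_map_at (ec_points c) (\<lambda>p. [ec_coord p]) (ec_var c) (\<lambda>X. ec_add A (ec_add B X)) X"
    if "A \<in> ec_points c" "B \<in> ec_points c" "X \<in> ec_points c" for A B X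
  proof (rule polynomial_map_at_compose[where Y = "ec_var c" and f = "ec_add B"])
    show "ec_add B ` ec_points c \<subseteq> points (ec_var c)" using closed that by auto
    show "polynomial_map_at (points (ec_var c)) (\<lambda>y. [hcoord (ec_var c) y]) (ec_var c) (ec_add A) (ec_add B X)"
      using polynomial_map_at_ec_translation[OF that(1) closed[OF that(2,3)] c] by simp
  qed (use polynomial_map_at_ec_translation[OF that(2,3) c] that in auto)
  have distinct: "ec_add (ec_add (Pt p yp) (Pt q yq)) (Pt r yr) =
      ec_add (Pt p yp) (ec_add (Pt q yq) (Pt r yr))"
    if on: "Pt p yp \<in> ec_points c" "Pt q yq \<in> ec_points c" "Pt r yr \<in> ec_points c" and pq: "p \<noteq> q"
    for p yp q yq r yr
  proof -
    obtain a ya where A: "ec_add (Pt p yp) (Pt q yq) = Pt a ya"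
      using ec_add_chord[OF pq, of yq yp "(yq - yp) / (q - p)"] pq by simp
    define F where "F = {Pt x y |x y. Pt x y \<in> ec_points c \<and> x \<in> {p, q, a}} \<union>
      {EInf, ec_add (ec_neg (Pt q yq)) (Pt p yp), ec_add (ec_neg (Pt q yq)) (Pt p (- yp))}"
    have "finite F" unfolding F_def using finite_ec_points_over[of "{p, q, a}" c] by simp
    have "ec_add (ec_add (Pt p yp) (Pt q yq)) X = ec_add (Pt p yp) (ec_add (Pt q yq) X)"
      if X: "X \<in> ec_points c - F" for X
    proof (cases X)
      case (Pt x y)
      have x: "x \<noteq> p" "x \<noteq> q" "x \<noteq> a" and Xon: "Pt x y \<in> ec_points c" using X Pt
        by (auto simp: F_def)
      obtain b yb where B: "ec_add (Pt q yq) (Pt x y) = Pt b yb"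
        using ec_add_chord[of q x y yq "(y - yq) / (x - q)"] x by simp
      have "b \<noteq> p"
      proof
        assume b: "b = p"
        have "Pt b yb \<in> ec_points c" using closed[OF on(2) Xon] B by simp
        then have "yb^2 = yp^2" using on(1) b by simp
        then have "yb = yp \<or> yb = - yp" by (simp only: power2_eq_iff)
        moreover have "ec_add (ec_neg (Pt q yq)) (Pt b yb) = X"
          using ec_neg_add_cancel_chord[OF _ B] x(2) b pq Pt by simp
        ultimately show False using X b by (auto simp: F_def)
      qed
      then have "ec_add (Pt a ya) (Pt x y) = ec_add (Pt p yp) (Pt b yb)"
        using on Xon pq x by (intro ec_add_assoc_chords[OF _ _ _ pq _ _ A _ B]) auto
      then show ?thesis by (simp add: A B Pt)
    qed (use X in \<open>auto simp: F_def\<close>)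
    then show ?thesis
      using ec_polynomial_maps_eqI[OF on(3) \<open>finite F\<close>
          polynomial_map_at_ec_translation[OF closed[OF on(1,2)] on(3) c] comp[OF on]] by blast
  qed
  show ?thesis
  proof (cases P)
    case P': (Pt p yp)
    show ?thesis
    proof (cases Q)
      case Q': (Pt q yq)
      show ?thesis
      proof (cases R)
        case R': (Pt r yr)
        define F where "F = {Pt x y |x y. Pt x y \<in> ec_points c \<and> x \<in> {p}} \<union> {EInf}"
        have "finite F" unfolding F_def using finite_ec_points_over[of "{p}" c] by simp
        have "ec_add R (ec_add P X) = ec_add P (ec_add R X)" if X: "X \<in> ec_points c - F" for X
        proof (cases X)
          case (Pt x y)
          have "ec_add (ec_add P X) R = ec_add P (ec_add X R)"
            unfolding P' R' Pt by (rule distinct) (use P X P' R' Pt in \<open>auto simp: F_def\<close>)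
          then show ?thesis using P X by (metis Diff_iff closed ec_add_commute)
        qed (use X in \<open>auto simp: F_def\<close>)
        then have "ec_add R (ec_add P Q) = ec_add P (ec_add R Q)"
          unfolding Q' using ec_polynomial_maps_eqI[OF _ \<open>finite F\<close> comp[OF P(3,1)] comp[OF P(1,3)]]
            P(2) Q' by blast
        then show ?thesis using P by (metis closed ec_add_commute)
      qed simp
    qed simp
  qed simp
qed

lemma ec_group_simps [simp]:
  "carrier (ec_group c) = ec_points c" "mult (ec_group c) = ec_add" "one (ec_group c) = EInf"
  by (simp_all add: ec_group_def)

lemma group_ec_group: "c \<noteq> 0 \<Longrightarrow> group (ec_group c)"
proof (rule groupI)
  fix P assume "P \<in> carrier (ec_group c)"
  then show "\<exists>Q\<in>carrier (ec_group c). Q \<otimes>\<^bsub>ec_group c\<^esub> P = \<one>\<^bsub>ec_group c\<^esub>"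
    by (intro bexI[of _ "ec_neg P"]) (simp_all add: ec_add_neg)
qed (simp_all add: ec_add_closed ec_add_assoc)

lemma inv_ec_group:
  assumes "c \<noteq> 0" "P \<in> ec_points c"
  shows "m_inv (ec_group c) P = ec_neg P"
  using group.inv_equality[OF group_ec_group[OF assms(1)], of "ec_neg P" P] assms(2) ec_add_neg(2)
    by simp

lemma var_space_ec_var: "var_space (ec_var c) = zariski_space (ec_points c) (\<lambda>p. [ec_coord p])"
  by (simp add: var_space_def)

text \<open>
  The point at infinity has only one nonzero coordinate, so a diagonal matrix fixes it and acts on the
  affine points as \<open>ec_scale\<close>.
\<close>

lemma morphism_ec_scale:
  assumes "\<alpha> ^ 3 = \<beta>^2" "c' = \<beta>^2 * c" "\<beta> \<noteq> 0"
  shows "morphism (var_space (ec_var c)) (var_space (ec_var c')) (ec_scale \<alpha> \<beta>)"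
  unfolding morphism_def var_space_ec_var[of c] topspace_zariski_space
proof (rule regular_on_polynomial_map)
  fix p assume p: "p \<in> ec_points c"
  show "ec_scale \<alpha> \<beta> p \<in> points (ec_var c')" using ec_scale_points[OF assms(1,2) p] by simp
  have \<alpha>: "\<alpha> \<noteq> 0" using assms by auto
  define w where "w = (\<lambda>j :: nat. if j = 0 then 1 else if j = 1 then \<alpha> else \<beta>)"
  have w: "w j \<noteq> 0" for j using \<alpha> assms(3) by (simp add: w_def)
  have scale: "\<exists>t. t \<noteq> 0 \<and> (\<forall>j. w j * ec_coord q j = t * ec_coord (ec_scale \<alpha> \<beta> q) j)" for q
  proof (cases q)
    case (Pt x y)
    then show ?thesis by (intro exI[of _ 1]) (auto simp: w_def)
  next
    case EInf
    then show ?thesis using assms(3) by (intro exI[of _ \<beta>]) (auto simp: w_def)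
  qed
  show "polynomial_map_at (ec_points c) (\<lambda>p. [ec_coord p]) (ec_var c') (ec_scale \<alpha> \<beta>) p"
    unfolding polynomial_map_at_def
  proof (intro exI[of _ "\<lambda>k. if k = 0 then 1 else 0"] exI[of _ "\<lambda>j v. w j * v 0 j"] conjI allI ballI)
    show "multihomogeneous (\<lambda>k. if k = 0 then 1 else 0) (\<lambda>v. w j * v 0 j)" for j
      by (intro multihomogeneous_cmult multihomogeneous_coord)
    show "\<exists>j. w j * coord_blocks [ec_coord p] 0 j \<noteq> 0"
      using ec_coord_nonzero[of p] w by (auto simp: coord_blocks_def)
    show "\<exists>t. \<forall>j. w j * coord_blocks [ec_coord q] 0 j = t * hcoord (ec_var c') (ec_scale \<alpha> \<beta> q) j" for q
      using scale[of q] by (auto simp: coord_blocks_def)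
  qed
qed

lemma ec_scale_inverse: "\<alpha> * \<alpha>' = 1 \<Longrightarrow> \<beta> * \<beta>' = 1 \<Longrightarrow> ec_scale \<alpha> \<beta> (ec_scale \<alpha>' \<beta>' P) = P"
  by (cases P) (auto simp flip: mult.assoc)

lemma variety_iso_ec_scale:
  assumes "\<alpha> ^ 3 = \<beta>^2" "c' = \<beta>^2 * c" "\<beta> \<noteq> 0"
  shows "variety_iso (ec_var c) (ec_var c') (ec_scale \<alpha> \<beta>)"
proof -
  have \<alpha>: "\<alpha> \<noteq> 0" using assms by auto
  have recip: "(inverse \<alpha>) ^ 3 = (inverse \<beta>)^2" "c = (inverse \<beta>)^2 * c'"
    using assms by (simp_all add: power_inverse)
  have cancel: "ec_scale (inverse \<alpha>) (inverse \<beta>) (ec_scale \<alpha> \<beta> P) = P"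
    "ec_scale \<alpha> \<beta> (ec_scale (inverse \<alpha>) (inverse \<beta>) P) = P" for P
    using \<alpha> assms(3) by (auto intro: ec_scale_inverse)
  have bij: "bij_betw (ec_scale \<alpha> \<beta>) (ec_points c) (ec_points c')"
    by (rule bij_betw_byWitness[where f' = "ec_scale (inverse \<alpha>) (inverse \<beta>)"])
      (auto simp: cancel intro: ec_scale_points[OF assms(1,2)] ec_scale_points[OF recip])
  have "morphism (var_space (ec_var c')) (var_space (ec_var c)) (inv_into (ec_points c) (ec_scale \<alpha> \<beta>))"
    unfolding morphism_def var_space_ec_var[of c'] topspace_zariski_space
  proof (rule regular_on_zariski_space_cong[rotated])
    show "regular_on (zariski_space (ec_points c') (\<lambda>p. [ec_coord p])) (ec_points c')
        (var_space (ec_var c)) (ec_scale (inverse \<alpha>) (inverse \<beta>))"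
      using morphism_ec_scale[OF recip] assms(3)
      unfolding morphism_def var_space_ec_var[of c'] topspace_zariski_space by simp
    fix P assume "P \<in> ec_points c'"
    then show "ec_scale (inverse \<alpha>) (inverse \<beta>) P = inv_into (ec_points c) (ec_scale \<alpha> \<beta>) P"
      using bij ec_scale_points[OF recip] cancel by (metis bij_betw_inv_into_left)
  qed
  then show ?thesis
    unfolding variety_iso_def using bij morphism_ec_scale[OF assms] by simp
qed

section \<open>The polynomial of the six-valued multiplication\<close>

text \<open>
  The entry \<open>(k, e0, e1, e2, e3)\<close> stands for the term \<open>k \<sigma>\<^sub>1\<^bsup>e1\<^esup> \<sigma>\<^sub>2\<^bsup>e2\<^esup> \<sigma>\<^sub>3\<^bsup>e3\<^esup>\<close> of \<open>p6\<close>, and \<open>e0\<close> is the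
  exponent of the additional variable \<open>\<sigma>\<^sub>0\<close> that makes the polynomial homogeneous of degree six.
  Each \<open>\<sigma>\<^sub>i\<close> has degree one in each of the variables \<open>x\<close>, \<open>y\<close>, \<open>z\<close>, so this homogenization amounts to the
  trihomogenization with \<open>\<sigma>\<^sub>0 = x\<^sub>0y\<^sub>0z\<^sub>0\<close>.
\<close>

definition p6_terms :: "complex \<Rightarrow> (complex \<times> nat \<times> nat \<times> nat \<times> nat) list" where
  "p6_terms c =
    [(1, 0, 6, 0, 0), (- (2^2 * 3), 1, 4, 1, 0), (2^4 * 3, 2, 2, 2, 0), (- (2^6), 3, 0, 3, 0),
     (- (2 * 3^4 * 17), 2, 3, 0, 1), (- (2^3 * 3^4 * 19), 3, 1, 1, 1),
     (3^3 * 19^3, 4, 0, 0, 2), (- (2^5 * 3^2 * 11 * c), 1, 4, 0, 1),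
     (- (2^2 * 3^3 * 5 * c^2), 0, 5, 0, 1), (- (2^4 * 3^2 * 211 * c), 2, 2, 1, 1),
     (- (2^2 * 3^3 * 197 * c^2), 1, 3, 1, 1), (- (2^3 * 3^5 * c^3), 0, 4, 1, 1),
     (- (2^6 * 3^2 * 5^2 * c), 3, 0, 2, 1), (- (2^4 * 3^3 * 107 * c^2), 2, 1, 2, 1),
     (- (2^4 * 3^7 * c^3), 1, 2, 2, 1), (- (2 * 3^6 * c^4), 0, 3, 2, 1),
     (- (2^6 * 3^5 * c^3), 2, 0, 3, 1), (- (2^3 * 3^7 * c^4), 1, 1, 3, 1),
     (2^4 * 3^3 * 7^2 * 19 * c, 3, 1, 0, 2), (2^2 * 3^3 * 47 * 53 * c^2, 2, 2, 0, 2),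
     (2^3 * 3^5 * 61 * c^3, 1, 3, 0, 2), (2 * 3^7 * 17 * c^4, 0, 4, 0, 2),
     (2^2 * 3^4 * 701 * c^2, 3, 0, 1, 2), (2^3 * 3^6 * 7 * 13 * c^3, 2, 1, 1, 2),
     (2^10 * 3^6 * c^4, 1, 2, 1, 2), (2^4 * 3^8 * 5 * c^5, 0, 3, 1, 2),
     (2 * 3^7 * 5 * 17 * c^4, 2, 0, 2, 2), (2^5 * 3^8 * 7 * c^5, 1, 1, 2, 2),
     (2^2 * 3^9 * 17 * c^6, 0, 2, 2, 2), (2^2 * 3^9 * 11 * c^6, 1, 0, 3, 2),
     (2^3 * 3^11 * c^7, 0, 1, 3, 2), (3^12 * c^8, 0, 0, 4, 2),
     (- (2^3 * 3^12 * c^3), 3, 0, 0, 3), (- (2 * 3^9 * 5 * 47 * c^4), 2, 1, 0, 3),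
     (- (2^4 * 3^9 * 17 * c^5), 1, 2, 0, 3), (- (2^2 * 3^9 * 5 * c^6), 0, 3, 0, 3),
     (- (2^6 * 3^11 * c^5), 2, 0, 1, 3), (- (2^2 * 3^10 * 5 * 11 * c^6), 1, 1, 1, 3),
     (- (2^3 * 3^11 * c^7), 0, 2, 1, 3), (- (2^3 * 3^11 * 5 * c^7), 1, 0, 2, 3),
     (- (2 * 3^12 * c^8), 0, 1, 2, 3), (- (2^3 * 3^12 * c^6), 2, 0, 0, 4),
     (- (2^3 * 3^12 * c^7), 1, 1, 0, 4), (3^12 * c^8, 0, 2, 0, 4),
     (- (2^2 * 3^13 * c^8), 1, 0, 1, 4)]"

definition p6_form :: "complex \<Rightarrow> complex \<Rightarrow> complex \<Rightarrow> complex \<Rightarrow> complex \<Rightarrow> complex" where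
  "p6_form c s0 s1 s2 s3 =
    (\<Sum>(k, e0, e1, e2, e3)\<leftarrow>p6_terms c. k * s0 ^ e0 * s1 ^ e1 * s2 ^ e2 * s3 ^ e3)"

lemma p6_eq_form: "p6 c z x y = p6_form c 1 (x + y + z) (x * y + y * z + z * x) (x * y * z)"
  unfolding p6_def p6_form_def p6_terms_def Let_def list.map sum_list.Cons sum_list.Nil prod.case
    power_one mult_1_right
  by algebra

text \<open>
  The right-hand side is the norm of \<open>A + B \<zeta>\<zeta>'\<^sup>2 + C \<zeta>\<^sup>2\<zeta>'\<close> with respect to the multiplication of \<open>\<zeta>'\<close> by
  cube roots of unity, where \<open>m = \<zeta>\<^sup>3\<close> and \<open>n = \<zeta>'\<^sup>3\<close>. On the left, \<open>\<sigma>\<^sub>0, ..., \<sigma>\<^sub>3\<close> are evaluated at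
  \<open>(x\<^sub>1 : x\<^sub>0) = (-1 : X)\<close>, \<open>(y\<^sub>1 : y\<^sub>0) = (-1 : Y)\<close> and \<open>(z : w)\<close>.
\<close>

lemma p6_form_norm:
  fixes c X Y z w :: complex
  assumes "m = X - c" "n = Y - c"
    and "A = z^2 * (X^2*Y^2 + 144*X*Y*c^2 - 162*X*c^3 - 162*Y*c^3 + 243*c^4) +
      z * w * (2*X^2*Y + 2*X*Y^2 + 24*X*Y*c + 18*X*c^2 + 18*Y*c^2) +
      w^2 * (X^2 - 20*X*Y + 18*X*c + Y^2 + 18*Y*c - 18*c^2)"
    and "B = z^2 * (18*X*Y*c + 81*X*c^2 - 243*c^3) + z * w * (30*X*Y + 36*X*c - 18*Y*c) +
      w^2 * (15*X - 6*Y - 9*c)"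
    and "C = z^2 * (18*X*Y*c + 81*Y*c^2 - 243*c^3) + z * w * (30*X*Y - 18*X*c + 36*Y*c) +
      w^2 * (15*Y - 6*X - 9*c)"
  shows "p6_form c (X*Y*w) (X*Y*z - Y*w - X*w) (w - X*z - Y*z) z =
    A^3 + B^3 * (m * n^2) + C^3 * (m^2 * n) - 3 * A * B * C * (m * n)"
  unfolding p6_form_def p6_terms_def assms list.map sum_list.Cons sum_list.Nil prod.case
  by algebra

lemma p6_form_scale: "p6_form c (t * s0) (t * s1) (t * s2) (t * s3) = t ^ 6 * p6_form c s0 s1 s2 s3"
  unfolding p6_form_def p6_terms_def list.map sum_list.Cons sum_list.Nil prod.case
  by algebra

lemma p6_form_zero: "p6_form c s0 s1 s2 0 = (s1^2 - 4 * s0 * s2) ^ 3"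
  unfolding p6_form_def p6_terms_def list.map sum_list.Cons sum_list.Nil prod.case
    power_0 power_one_right power_zero_numeral mult_zero_right add_0_left mult_1_right
  by algebra

text \<open>
  The coefficients are bound inside the definition, so that a polynomial and its homogenization can be
  built up together.
\<close>

definition trihomogenization :: "nat \<Rightarrow> (complex \<Rightarrow> complex \<Rightarrow> complex \<Rightarrow> complex) \<Rightarrow>
    (complex \<Rightarrow> complex \<Rightarrow> complex \<Rightarrow> complex \<Rightarrow> complex \<Rightarrow> complex \<Rightarrow> complex) \<Rightarrow> bool" where
  "trihomogenization n P H \<longleftrightarrow> (\<exists>a.
     (\<forall>z x y. P z x y = (\<Sum>i\<le>n. \<Sum>j\<le>n. \<Sum>k\<le>n. a i j k * z ^ i * x ^ j * y ^ k)) \<and>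
     (\<forall>z1 z0 x1 x0 y1 y0. H z1 z0 x1 x0 y1 y0 =
        (\<Sum>i\<le>n. \<Sum>j\<le>n. \<Sum>k\<le>n. a i j k * (z1 ^ i * z0 ^ (n - i)) *
           (x1 ^ j * x0 ^ (n - j)) * (y1 ^ k * y0 ^ (n - k)))))"

lemma trihomogenization_const: "trihomogenization 0 (\<lambda>z x y. a) (\<lambda>z1 z0 x1 x0 y1 y0. a)"
  unfolding trihomogenization_def by (intro exI[of _ "\<lambda>i j k. a"]) simp

lemma trihomogenization_zero: "trihomogenization n (\<lambda>z x y. 0) (\<lambda>z1 z0 x1 x0 y1 y0. 0)"
  unfolding trihomogenization_def by (intro exI[of _ "\<lambda>i j k. 0"]) simp

lemma trihomogenization_add:
  assumes "trihomogenization n P H" "trihomogenization n P' H'"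
  shows "trihomogenization n (\<lambda>z x y. P z x y + P' z x y)
    (\<lambda>z1 z0 x1 x0 y1 y0. H z1 z0 x1 x0 y1 y0 + H' z1 z0 x1 x0 y1 y0)"
proof -
  obtain a where a: "\<forall>z x y. P z x y = (\<Sum>i\<le>n. \<Sum>j\<le>n. \<Sum>k\<le>n. a i j k * z ^ i * x ^ j * y ^ k)"
    "\<forall>z1 z0 x1 x0 y1 y0. H z1 z0 x1 x0 y1 y0 =
        (\<Sum>i\<le>n. \<Sum>j\<le>n. \<Sum>k\<le>n. a i j k * (z1 ^ i * z0 ^ (n - i)) *
           (x1 ^ j * x0 ^ (n - j)) * (y1 ^ k * y0 ^ (n - k)))"
    using assms(1) unfolding trihomogenization_def by blast
  obtain b where b: "\<forall>z x y. P' z x y = (\<Sum>i\<le>n. \<Sum>j\<le>n. \<Sum>k\<le>n. b i j k * z ^ i * x ^ j * y ^ k)"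
    "\<forall>z1 z0 x1 x0 y1 y0. H' z1 z0 x1 x0 y1 y0 =
        (\<Sum>i\<le>n. \<Sum>j\<le>n. \<Sum>k\<le>n. b i j k * (z1 ^ i * z0 ^ (n - i)) *
           (x1 ^ j * x0 ^ (n - j)) * (y1 ^ k * y0 ^ (n - k)))"
    using assms(2) unfolding trihomogenization_def by blast
  show ?thesis
    unfolding trihomogenization_def a[rule_format] b[rule_format]
    by (intro exI[of _ "\<lambda>i j k. a i j k + b i j k"])
      (simp only: distrib_right sum.distrib simp_thms)
qed

lemma sum_shift_index:
  fixes F :: "nat \<Rightarrow> nat \<Rightarrow> complex"
  assumes "e \<le> 1"
  shows "(\<Sum>i\<le>Suc n. if e \<le> i \<and> i - e \<le> n then F (i - e) i else 0) = (\<Sum>i\<le>n. F i (i + e))"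
proof -
  have "(\<Sum>i\<le>Suc n. if e \<le> i \<and> i - e \<le> n then F (i - e) i else 0) =
      (\<Sum>i\<in>{i \<in> {..Suc n}. e \<le> i \<and> i - e \<le> n}. F (i - e) i)"
    by (rule sum.inter_filter[symmetric]) simp
  also have "\<dots> = (\<Sum>i\<le>n. F i (i + e))"
    by (rule sum.reindex_bij_witness[where i = "\<lambda>i. i + e" and j = "\<lambda>i. i - e"]) (use assms in auto)
  finally show ?thesis .
qed

text \<open>
  Multiplication by a squarefree monomial raises the bound on the degrees
    by one; a variable that does
  not occur in the monomial contributes its second homogeneous coordinate.
\<close>

lemma trihomogenization_mult_monomial:
  assumes P: "trihomogenization n P H" and e: "e1 \<le> 1" "e2 \<le> 1" "e3 \<le> 1"
  shows "trihomogenization (Suc n) (\<lambda>z x y. z ^ e1 * x ^ e2 * y ^ e3 * P z x y)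
    (\<lambda>z1 z0 x1 x0 y1 y0. (z1 ^ e1 * z0 ^ (1 - e1)) * (x1 ^ e2 * x0 ^ (1 - e2)) *
      (y1 ^ e3 * y0 ^ (1 - e3)) * H z1 z0 x1 x0 y1 y0)"
proof -
  obtain a where a: "\<forall>z x y. P z x y = (\<Sum>i\<le>n. \<Sum>j\<le>n. \<Sum>k\<le>n. a i j k * z ^ i * x ^ j * y ^ k)"
    "\<forall>z1 z0 x1 x0 y1 y0. H z1 z0 x1 x0 y1 y0 =
        (\<Sum>i\<le>n. \<Sum>j\<le>n. \<Sum>k\<le>n. a i j k * (z1 ^ i * z0 ^ (n - i)) *
           (x1 ^ j * x0 ^ (n - j)) * (y1 ^ k * y0 ^ (n - k)))"
    using P unfolding trihomogenization_def by blast
  define c where "c e i \<longleftrightarrow> e \<le> i \<and> i - e \<le> n" for e i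
  define b where "b i j k = (if c e1 i then if c e2 j then if c e3 k
    then a (i - e1) (j - e2) (k - e3) else 0 else 0 else 0)" for i j k
  have shift: "(\<Sum>i\<le>Suc n. \<Sum>j\<le>Suc n. \<Sum>k\<le>Suc n. b i j k * Z i * X j * Y k) =
      (\<Sum>i\<le>n. \<Sum>j\<le>n. \<Sum>k\<le>n. a i j k * Z (i + e1) * X (j + e2) * Y (k + e3))" for Z X Y
  proof -
    have "(\<Sum>i\<le>Suc n. \<Sum>j\<le>Suc n. \<Sum>k\<le>Suc n. b i j k * Z i * X j * Y k) =
      (\<Sum>i\<le>Suc n. if c e1 i then \<Sum>j\<le>Suc n. if c e2 j then \<Sum>k\<le>Suc n. if c e3 k then
        a (i - e1) (j - e2) (k - e3) * Z i * X j * Y k else 0 else 0 else 0)"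
      by (auto simp: b_def simp del: sum.atMost_Suc intro!: sum.cong)
    also have "\<dots> = (\<Sum>i\<le>n. \<Sum>j\<le>n. \<Sum>k\<le>n. a i j k * Z (i + e1) * X (j + e2) * Y (k + e3))"
      unfolding c_def
        sum_shift_index[OF e(3), of n "\<lambda>k' k. a i j k' * z * x * Y k" for i j z x]
        sum_shift_index[OF e(2), of n "\<lambda>j' j. \<Sum>k\<le>n. a i j' k * z * X j * Y (k + e3)" for i z]
        sum_shift_index[OF e(1), of n
          "\<lambda>i' i. \<Sum>j\<le>n. \<Sum>k\<le>n. a i' j k * Z i * X (j + e2) * Y (k + e3)"] ..
    finally show ?thesis .
  qed
  show ?thesis
    unfolding trihomogenization_def
  proof (intro exI[of _ b] conjI allI)
    fix z x y
    show "z ^ e1 * x ^ e2 * y ^ e3 * P z x y =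
        (\<Sum>i\<le>Suc n. \<Sum>j\<le>Suc n. \<Sum>k\<le>Suc n. b i j k * z ^ i * x ^ j * y ^ k)"
      unfolding shift a[rule_format] sum_distrib_left
        by (intro sum.cong refl) (simp add: power_add mult_ac)
  next
    fix z1 z0 x1 x0 y1 y0
    have pow: "s ^ (Suc n - (i + e)) = s ^ (1 - e) * s ^ (n - i)" if "i \<in> {..n}" "e \<le> 1" for s :: complex and i e
    proof -
      have "Suc n - (i + e) = (1 - e) + (n - i)" using that by auto
      then show ?thesis by (simp add: power_add)
    qed
    show "(z1 ^ e1 * z0 ^ (1 - e1)) * (x1 ^ e2 * x0 ^ (1 - e2)) * (y1 ^ e3 * y0 ^ (1 - e3)) *
        H z1 z0 x1 x0 y1 y0 =
      (\<Sum>i\<le>Suc n. \<Sum>j\<le>Suc n. \<Sum>k\<le>Suc n. b i j k * (z1 ^ i * z0 ^ (Suc n - i)) *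
           (x1 ^ j * x0 ^ (Suc n - j)) * (y1 ^ k * y0 ^ (Suc n - k)))"
      unfolding shift[of "\<lambda>i. z1 ^ i * z0 ^ (Suc n - i)" "\<lambda>j. x1 ^ j * x0 ^ (Suc n - j)"
          "\<lambda>k. y1 ^ k * y0 ^ (Suc n - k)"] a[rule_format] sum_distrib_left
      by (intro sum.cong refl) (simp only: pow[OF _ e(1)] pow[OF _ e(2)] pow[OF _ e(3)] power_add mult_ac)
  qed
qed

lemma trihomogenization_mult_sigma:
  assumes P: "trihomogenization n P H"
  shows "trihomogenization (Suc n) P
      (\<lambda>z1 z0 x1 x0 y1 y0. x0 * y0 * z0 * H z1 z0 x1 x0 y1 y0)" (is ?s0)
    and "trihomogenization (Suc n) (\<lambda>z x y. (x + y + z) * P z x y)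
      (\<lambda>z1 z0 x1 x0 y1 y0. (x1 * y0 * z0 + x0 * y1 * z0 + x0 * y0 * z1) * H z1 z0 x1 x0 y1 y0)" (is ?s1)
    and "trihomogenization (Suc n) (\<lambda>z x y. (x * y + y * z + z * x) * P z x y)
      (\<lambda>z1 z0 x1 x0 y1 y0. (x1 * y1 * z0 + x0 * y1 * z1 + x1 * y0 * z1) * H z1 z0 x1 x0 y1 y0)" (is ?s2)
    and "trihomogenization (Suc n) (\<lambda>z x y. x * y * z * P z x y)
      (\<lambda>z1 z0 x1 x0 y1 y0. x1 * y1 * z1 * H z1 z0 x1 x0 y1 y0)" (is ?s3)
proof -
  note M = trihomogenization_mult_monomial[OF P]
  show ?s0 using M[of 0 0 0] by (simp add: mult_ac)
  show ?s3 using M[of 1 1 1] by (simp add: mult_ac)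
  show ?s1
    using trihomogenization_add[OF trihomogenization_add[OF M[of 0 1 0] M[of 0 0 1]] M[of 1 0 0]]
    by (simp add: algebra_simps)
  show ?s2
    using trihomogenization_add[OF trihomogenization_add[OF M[of 0 1 1] M[of 1 0 1]] M[of 1 1 0]]
    by (simp add: algebra_simps)
qed

lemma trihomogenization_sigma_monomial:
  "trihomogenization (e0 + e1 + e2 + e3)
    (\<lambda>z x y. k * (x + y + z) ^ e1 * (x * y + y * z + z * x) ^ e2 * (x * y * z) ^ e3)
    (\<lambda>z1 z0 x1 x0 y1 y0. k * (x0 * y0 * z0) ^ e0 * (x1 * y0 * z0 + x0 * y1 * z0 + x0 * y0 * z1) ^ e1 *
      (x1 * y1 * z0 + x0 * y1 * z1 + x1 * y0 * z1) ^ e2 * (x1 * y1 * z1) ^ e3)"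
proof -
  have 0: "trihomogenization e0 (\<lambda>z x y. k) (\<lambda>z1 z0 x1 x0 y1 y0. k * (x0 * y0 * z0) ^ e0)"
  proof (induction e0)
    case (Suc e)
    show ?case using trihomogenization_mult_sigma(1)[OF Suc] by (simp only: power_Suc mult_ac)
  qed (use trihomogenization_const in simp)
  have 1: "trihomogenization (e0 + e1) (\<lambda>z x y. k * (x + y + z) ^ e1)
    (\<lambda>z1 z0 x1 x0 y1 y0. k * (x0 * y0 * z0) ^ e0 * (x1 * y0 * z0 + x0 * y1 * z0 + x0 * y0 * z1) ^ e1)"
  proof (induction e1)
    case (Suc e)
    show ?case using trihomogenization_mult_sigma(2)[OF Suc]
      by (simp only: power_Suc mult_ac add_Suc_right)
  qed (use 0 in simp)
  have 2: "trihomogenization (e0 + e1 + e2) (\<lambda>z x y. k * (x + y + z) ^ e1 * (x * y + y * z + z * x) ^ e2)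
    (\<lambda>z1 z0 x1 x0 y1 y0. k * (x0 * y0 * z0) ^ e0 * (x1 * y0 * z0 + x0 * y1 * z0 + x0 * y0 * z1) ^ e1 *
      (x1 * y1 * z0 + x0 * y1 * z1 + x1 * y0 * z1) ^ e2)"
  proof (induction e2)
    case (Suc e)
    show ?case using trihomogenization_mult_sigma(3)[OF Suc]
      by (simp only: power_Suc mult_ac add_Suc_right)
  qed (use 1 in simp)
  show ?thesis
  proof (induction e3)
    case (Suc e)
    show ?case using trihomogenization_mult_sigma(4)[OF Suc]
      by (simp only: power_Suc mult_ac add_Suc_right)
  qed (use 2 in simp)
qed

lemma trihomogenization_p6:
  "trihomogenization 6 (p6 c) (\<lambda>z1 z0 x1 x0 y1 y0. p6_form c (x0 * y0 * z0)
    (x1 * y0 * z0 + x0 * y1 * z0 + x0 * y0 * z1) (x1 * y1 * z0 + x0 * y1 * z1 + x1 * y0 * z1)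
    (x1 * y1 * z1))"
proof -
  have sum: "trihomogenization 6
    (\<lambda>z x y. \<Sum>(k, e0, e1, e2, e3)\<leftarrow>L. k * 1 ^ e0 * (x + y + z) ^ e1 *
      (x * y + y * z + z * x) ^ e2 * (x * y * z) ^ e3)
    (\<lambda>z1 z0 x1 x0 y1 y0. \<Sum>(k, e0, e1, e2, e3)\<leftarrow>L. k * (x0 * y0 * z0) ^ e0 *
      (x1 * y0 * z0 + x0 * y1 * z0 + x0 * y0 * z1) ^ e1 *
      (x1 * y1 * z0 + x0 * y1 * z1 + x1 * y0 * z1) ^ e2 * (x1 * y1 * z1) ^ e3)"
    if "\<forall>(k, e0, e1, e2, e3)\<in>set L. e0 + e1 + e2 + e3 = 6" for L
    using that
  proof (induction L)
    case (Cons x L)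
    obtain k e0 e1 e2 e3 where x: "x = (k, e0, e1, e2, e3)" by (cases x)
    then have e: "e0 + e1 + e2 + e3 = 6" using Cons.prems by simp
    show ?case
      using trihomogenization_add[OF
          trihomogenization_sigma_monomial[of e0 e1 e2 e3 k, unfolded e] Cons.IH] Cons.prems
      by (simp add: x)
  qed (simp add: trihomogenization_zero)
  have "\<forall>(k, e0, e1, e2, e3)\<in>set (p6_terms c). e0 + e1 + e2 + e3 = 6"
    by (simp add: p6_terms_def)
  from sum[OF this] show ?thesis
    by (simp only: p6_eq_form[abs_def] p6_form_def)
qed

definition root3 :: complex where
  "root3 = exp (2 * pi * \<i> / 3)"

lemma root3_cubed: "root3 ^ 3 = 1"
proof -
  have "root3 ^ 3 = exp (of_nat 3 * (2 * pi * \<i> / 3))"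
    unfolding root3_def by (rule exp_of_nat_mult[symmetric])
  also have "of_nat 3 * (2 * pi * \<i> / 3) = 2 * of_real pi * \<i>" by simp
  finally show ?thesis by (simp only: exp_two_pi_i)
qed

lemma root3_sum: "1 + root3 + root3^2 = 0"
proof -
  have "root3 \<noteq> 1"
  proof
    assume "root3 = 1"
    then obtain n :: int where "2 * pi / 3 = of_int (2 * n) * pi"
      unfolding root3_def exp_eq_1 by auto
    then have "real_of_int (3 * n) = 1" by simp
    then have "3 * n = 1" by linarith
    then show False by presburger
  qed
  moreover have "(root3 - 1) * (1 + root3 + root3^2) = 0" using root3_cubed by algebra
  ultimately show ?thesis by simp
qed

lemma root3_nonzero: "root3 \<noteq> 0"
  by (simp add: root3_def)

text \<open>
  The binary form of the pair of points \<open>\<pi>(P + Q)\<close>, \<open>\<pi>(P - Q)\<close> in terms of the \<open>\<zeta>\<close>-coordinates of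
  \<open>P\<close> and \<open>Q\<close>. When these differ, its coefficients are \<open>D\<^sup>6\<close>, \<open>(\<eta>\<^sub>+\<^sup>2 + \<eta>\<^sub>-\<^sup>2)D\<^sup>6\<close> and \<open>\<eta>\<^sub>+\<^sup>2\<eta>\<^sub>-\<^sup>2D\<^sup>6\<close>, where \<open>D\<close> is the difference
  of the \<open>\<zeta>\<close>-coordinates and \<open>\<eta>\<^sub>+\<close>, \<open>\<eta>\<^sub>-\<close> belong to \<open>P + Q\<close> and \<open>P - Q\<close>.
\<close>

definition pair_form :: "complex \<Rightarrow> complex \<Rightarrow> complex \<Rightarrow> complex \<Rightarrow> complex \<Rightarrow> complex" where
  "pair_form c x1 x2 z w =
    z^2 * (9 * c^2 - (x1 ^ 3 + c) * (x2 ^ 3 + c) - 9 * c * x1 * x2 * (x1 + x2))^2 +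
    z * w * (2 * ((x1 ^ 3 + c) * (3 * x1 * x2^2 + x2 ^ 3 + 4 * c)^2 +
      (x2 ^ 3 + c) * (x1 ^ 3 + 3 * x1^2 * x2 + 4 * c)^2)) +
    w^2 * (x1 - x2) ^ 6"

definition linear_form :: "complex \<Rightarrow> complex \<Rightarrow> cp1 \<Rightarrow> complex" where
  "linear_form z w p = z * coord0 p - w * coord1 p"

text \<open>
  The projection of \<open>(\<zeta>, \<eta>)\<close> has homogeneous coordinates \<open>(-1 : \<eta>\<^sup>2)\<close>, also when \<open>\<eta> = 0\<close>.
\<close>

lemma linear_form_ec_proj:
  "\<exists>k. k \<noteq> 0 \<and> (\<forall>z w. z * y^2 + w = k * linear_form z w (ec_proj (Pt x y)))"
proof (cases "y = 0")
  case True
  then show ?thesis by (intro exI[of _ "-1"]) (simp add: linear_form_def)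
next
  case False
  then show ?thesis by (intro exI[of _ "y^2"]) (simp add: linear_form_def field_simps)
qed

text \<open>
  When \<open>P = Q\<close> the coefficient \<open>D\<^sup>6\<close> of \<open>w\<^sup>2\<close> vanishes, which accounts for the zero \<open>\<pi>(P - P)\<close>. The
  duplication formula gives the other zero.
\<close>

lemma pair_form_double:
  assumes c: "c \<noteq> 0" and on: "y^2 = x ^ 3 + c"
  shows "\<exists>k. k \<noteq> 0 \<and> (\<forall>z w. pair_form c x x z w =
    k * (linear_form z w (ec_proj (ec_add (Pt x y) (Pt x y))) * linear_form z w (Aff 0)))"
proof -
  define n where "n = 27 * c^2 - 18 * c * y^2 - y ^ 4"
  have form: "pair_form c x x z w = z^2 * n^2 + z * w * (64 * y ^ 6)" for z w
  proof -
    have "x ^ 3 = y^2 - c" using on by simp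
    then have "9 * c^2 - (x ^ 3 + c) * (x ^ 3 + c) - 9 * c * x * x * (x + x) = n"
      "2 * ((x ^ 3 + c) * (3 * x * x^2 + x ^ 3 + 4 * c)^2 +
        (x ^ 3 + c) * (x ^ 3 + 3 * x^2 * x + 4 * c)^2) = 64 * y ^ 6"
      unfolding n_def by algebra+
    then show ?thesis unfolding pair_form_def by simp
  qed
  show ?thesis
  proof (cases "y = 0")
    case True
    then have "ec_add (Pt x y) (Pt x y) = EInf" using ec_add_opposite(1)[of x y] by simp
    moreover have "n \<noteq> 0" using c True by (simp add: n_def)
    ultimately show ?thesis
      unfolding form using True
      by (intro exI[of _ "n^2"]) (simp add: linear_form_def power2_eq_square)
  next
    case False
    define m where "m = 3 * x^2 / (2 * y)"
    define y3 where "y3 = m * (x - (m^2 - x - x)) - y"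
    have m: "m * (y + y) = x^2 + x * x + x^2"
      using False by (simp add: m_def power2_eq_square)
    have add: "ec_add (Pt x y) (Pt x y) = Pt (m^2 - x - x) y3"
      unfolding y3_def by (rule ec_add_slope_eq[OF on on _ disjI2[OF m]]) (use False in auto)
    have "2 * y * m = 3 * x^2" using m by algebra
    then have "8 * y ^ 3 * y3 = - n" unfolding y3_def n_def using on by algebra
    then have n: "n^2 = 64 * y ^ 6 * y3^2" by algebra
    obtain k where k: "k \<noteq> 0" "\<And>z w. z * y3^2 + w =
        k * linear_form z w (ec_proj (ec_add (Pt x y) (Pt x y)))"
      unfolding add using linear_form_ec_proj by blast
    have "pair_form c x x z w = (64 * y ^ 6 * k) *
        (linear_form z w (ec_proj (ec_add (Pt x y) (Pt x y))) * linear_form z w (Aff 0))" for z w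
    proof -
      have "pair_form c x x z w = 64 * y ^ 6 * ((z * y3^2 + w) * z)"
        unfolding form n by algebra
      also have "z = linear_form z w (Aff 0)" by (simp add: linear_form_def)
      finally show ?thesis unfolding k(2) by (simp add: linear_form_def)
    qed
    then show ?thesis using k(1) False by (intro exI[of _ "64 * y ^ 6 * k"]) simp
  qed
qed

lemma pair_form_zeros:
  assumes c: "c \<noteq> 0" and on: "y1^2 = x1 ^ 3 + c" "y2^2 = x2 ^ 3 + c"
  shows "\<exists>k. k \<noteq> 0 \<and> (\<forall>z w. pair_form c x1 x2 z w =
    k * (linear_form z w (ec_proj (ec_add (Pt x1 y1) (Pt x2 y2))) *
      linear_form z w (ec_proj (ec_add (Pt x1 y1) (Pt x2 (- y2))))))"
proof (cases "x1 = x2")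
  case True
  then have "y1^2 = y2^2" using on by simp
  then consider "y1 = y2" | "y1 = - y2" by (auto simp only: power2_eq_iff)
  then show ?thesis
  proof cases
    case 1
    then show ?thesis using pair_form_double[OF c on(1)] True by simp
  next
    case 2
    then have y2: "y2 = - y1" by simp
    show ?thesis
      using pair_form_double[OF c on(1)]
        unfolding True[symmetric] y2 minus_minus ec_add_opposite ec_proj.simps
      by (simp add: mult.commute)
  qed
next
  case False
  define d where "d = x1 - x2"
  define a1 where "a1 = 3 * x1 * x2^2 + x2 ^ 3 + 4 * c"
  define a2 where "a2 = x1 ^ 3 + 3 * x1^2 * x2 + 4 * c"
  have chord: "\<exists>y3. ec_add (Pt x1 y1) (Pt x2 y) = Pt ((m^2 - x1 - x2)) y3 \<and> y3 * d ^ 3 = y * a2 - y1 * a1"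
    if y: "y^2 = x2 ^ 3 + c" and m: "m = (y - y1) / (x2 - x1)" for y m
  proof -
    have m': "y - y1 = m * (x2 - x1)" using m False by simp
    have "(m * (x1 - (m^2 - x1 - x2)) - y1) * d ^ 3 = y * a2 - y1 * a1"
    proof -
      have "(m * (x1 - (m^2 - x1 - x2)) - y1) * d ^ 3 =
          (m * d) * (2 * x1 + x2) * d^2 - (m * d) ^ 3 - y1 * d ^ 3" by algebra
      also have "m * d = y1 - y" using m' unfolding d_def by algebra
      also have "(y1 - y) * (2 * x1 + x2) * d^2 - (y1 - y) ^ 3 - y1 * d ^ 3 = y * a2 - y1 * a1"
        unfolding d_def a1_def a2_def using y on(1) by algebra
      finally show ?thesis .
    qed
    then show ?thesis using ec_add_chord[OF False m'] by blast
  qed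
  obtain x3 y3 where add: "ec_add (Pt x1 y1) (Pt x2 y2) = Pt x3 y3" and y3: "y3 * d ^ 3 = y2 * a2 - y1 * a1"
    using chord[OF on(2) refl] by blast
  obtain x4 y4 where sub: "ec_add (Pt x1 y1) (Pt x2 (- y2)) = Pt x4 y4"
    and y4: "y4 * d ^ 3 = (- y2) * a2 - y1 * a1"
    using chord[of "- y2"] on(2) by auto
  have d: "d \<noteq> 0" using False by (simp add: d_def)
  have "(y3 * d ^ 3) * (y4 * d ^ 3) = (9 * c^2 - (x1 ^ 3 + c) * (x2 ^ 3 + c) - 9 * c * x1 * x2 * (x1 + x2)) * d ^ 3"
    unfolding y3 y4 unfolding d_def a1_def a2_def using on by algebra
  then have "(y3 * y4 * d ^ 3) * d ^ 3 =
      (9 * c^2 - (x1 ^ 3 + c) * (x2 ^ 3 + c) - 9 * c * x1 * x2 * (x1 + x2)) * d ^ 3" by (simp add: mult_ac)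
  then have prod: "y3 * y4 * d ^ 3 = 9 * c^2 - (x1 ^ 3 + c) * (x2 ^ 3 + c) - 9 * c * x1 * x2 * (x1 + x2)"
    using d by simp
  have "(y3^2 + y4^2) * d ^ 6 = (y3 * d ^ 3)^2 + (y4 * d ^ 3)^2" by algebra
  also have "\<dots> = 2 * (y1^2 * a1^2 + y2^2 * a2^2)" unfolding y3 y4 by algebra
  finally have sum: "(y3^2 + y4^2) * d ^ 6 = 2 * ((x1 ^ 3 + c) * a1^2 + (x2 ^ 3 + c) * a2^2)"
    unfolding on .
  have form: "pair_form c x1 x2 z w = d ^ 6 * ((z * y3^2 + w) * (z * y4^2 + w))" for z w
    unfolding pair_form_def prod[symmetric] a1_def[symmetric] a2_def[symmetric] sum[symmetric]
      d_def[symmetric] by algebra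
  obtain k where k: "k \<noteq> 0" "\<And>z w. z * y3^2 + w = k * linear_form z w (ec_proj (Pt x3 y3))"
    using linear_form_ec_proj by blast
  obtain l where l: "l \<noteq> 0" "\<And>z w. z * y4^2 + w = l * linear_form z w (ec_proj (Pt x4 y4))"
    using linear_form_ec_proj by blast
  show ?thesis
    unfolding form add sub k(2) l(2) using d k(1) l(1)
    by (intro exI[of _ "d ^ 6 * k * l"]) (simp add: mult_ac)
qed

text \<open>
  The quadratic form is a combination of \<open>1\<close>, \<open>\<zeta>\<zeta>'\<^sup>2\<close> and \<open>\<zeta>\<^sup>2\<zeta>'\<close> with polynomials in the cubes of \<open>\<zeta>\<close>
  and \<open>\<zeta>'\<close> as coefficients. Multiplying \<open>\<zeta>'\<close> by a cube root of unity changes only the three monomials,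
  by its zeroth, second and first power, so the product is the norm in \<open>p6_form_norm\<close>.
\<close>

lemma prod_pair_form:
  assumes X: "X = x1 ^ 3 + c" and Y: "Y = x2 ^ 3 + c"
  shows "pair_form c x1 x2 z w * pair_form c x1 (root3 * x2) z w * pair_form c x1 (root3^2 * x2) z w =
    p6_form c (X * Y * w) (X * Y * z - Y * w - X * w) (w - X * z - Y * z) z"
proof -
  define A where "A = z^2 * (X^2*Y^2 + 144*X*Y*c^2 - 162*X*c^3 - 162*Y*c^3 + 243*c^4) +
      z * w * (2*X^2*Y + 2*X*Y^2 + 24*X*Y*c + 18*X*c^2 + 18*Y*c^2) +
      w^2 * (X^2 - 20*X*Y + 18*X*c + Y^2 + 18*Y*c - 18*c^2)"
  define B where "B = z^2 * (18*X*Y*c + 81*X*c^2 - 243*c^3) + z * w * (30*X*Y + 36*X*c - 18*Y*c) +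
      w^2 * (15*X - 6*Y - 9*c)"
  define C where "C = z^2 * (18*X*Y*c + 81*Y*c^2 - 243*c^3) + z * w * (30*X*Y - 18*X*c + 36*Y*c) +
      w^2 * (15*Y - 6*X - 9*c)"
  have split: "pair_form c x1 x z w = A + B * (x1 * x^2) + C * (x1^2 * x)" if "x ^ 3 = x2 ^ 3" for x
    unfolding pair_form_def A_def B_def C_def X Y that[symmetric] by algebra
  have cubes: "(root3 * x2) ^ 3 = x2 ^ 3" "(root3^2 * x2) ^ 3 = x2 ^ 3"
    using root3_cubed by algebra+
  define \<alpha> \<beta> where "\<alpha> = x1 * x2^2" and "\<beta> = x1^2 * x2"
  have "pair_form c x1 x2 z w = A + B * \<alpha> + C * \<beta>" unfolding \<alpha>_def \<beta>_def by (rule split) simp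
  moreover have "pair_form c x1 (root3 * x2) z w = A + B * root3^2 * \<alpha> + C * root3 * \<beta>"
    unfolding split[OF cubes(1)] \<alpha>_def \<beta>_def by algebra
  moreover have "pair_form c x1 (root3^2 * x2) z w = A + B * root3 * \<alpha> + C * root3^2 * \<beta>"
    unfolding split[OF cubes(2)] \<alpha>_def \<beta>_def using root3_cubed by algebra
  moreover have "(A + B * \<alpha> + C * \<beta>) * (A + B * root3^2 * \<alpha> + C * root3 * \<beta>) *
      (A + B * root3 * \<alpha> + C * root3^2 * \<beta>) = A ^ 3 + B ^ 3 * \<alpha> ^ 3 + C ^ 3 * \<beta> ^ 3 - 3 * A * B * C * (\<alpha> * \<beta>)"
    using root3_sum by algebra
  moreover have "\<alpha> ^ 3 = (X - c) * (Y - c)^2" "\<beta> ^ 3 = (X - c)^2 * (Y - c)" "\<alpha> * \<beta> = (X - c) * (Y - c)"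
    unfolding \<alpha>_def \<beta>_def X Y by algebra+
  ultimately show ?thesis
    using p6_form_norm[OF refl refl A_def B_def C_def] by simp
qed

text \<open>
  Powers of the automorphism of order six, in closed form.
\<close>

definition ec_rot :: "nat \<Rightarrow> ecpoint \<Rightarrow> ecpoint" where
  "ec_rot k = ec_scale (root3 ^ k) ((-1) ^ k)"

lemma ec_rot_Pt: "ec_rot k (Pt x y) = Pt (root3 ^ k * x) ((-1) ^ k * y)"
  and ec_rot_EInf [simp]: "ec_rot k EInf = EInf"
  by (simp_all add: ec_rot_def)

lemma ec_proj_rot [simp]: "ec_proj (ec_rot k P) = ec_proj P"
  by (cases P) (simp_all add: ec_rot_Pt power_mult_distrib flip: power_mult)

definition p6_form_at :: "complex \<Rightarrow> cp1 \<Rightarrow> cp1 \<Rightarrow> complex \<Rightarrow> complex \<Rightarrow> complex" where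
  "p6_form_at c p q z1 z0 = p6_form c (coord0 p * coord0 q * z0)
    (coord1 p * coord0 q * z0 + coord0 p * coord1 q * z0 + coord0 p * coord0 q * z1)
    (coord1 p * coord1 q * z0 + coord0 p * coord1 q * z1 + coord1 p * coord0 q * z1)
    (coord1 p * coord1 q * z1)"

lemma p6_form_at_proportional:
  assumes "coord0 p = s * x0" "coord1 p = s * x1" "coord0 q = t * y0" "coord1 q = t * y1"
  shows "p6_form_at c p q z1 z0 = (s * t) ^ 6 * p6_form c (x0 * y0 * z0)
    (x1 * y0 * z0 + x0 * y1 * z0 + x0 * y0 * z1) (x1 * y1 * z0 + x0 * y1 * z1 + x1 * y0 * z1)
    (x1 * y1 * z1)"
proof -
  have "(s * x0) * (t * y0) * z0 = (s * t) * (x0 * y0 * z0)"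
    "(s * x1) * (t * y0) * z0 + (s * x0) * (t * y1) * z0 + (s * x0) * (t * y0) * z1 =
      (s * t) * (x1 * y0 * z0 + x0 * y1 * z0 + x0 * y0 * z1)"
    "(s * x1) * (t * y1) * z0 + (s * x0) * (t * y1) * z1 + (s * x1) * (t * y0) * z1 =
      (s * t) * (x1 * y1 * z0 + x0 * y1 * z1 + x1 * y0 * z1)"
    "(s * x1) * (t * y1) * z1 = (s * t) * (x1 * y1 * z1)"
    by algebra+
  then show ?thesis unfolding p6_form_at_def assms by (simp only: p6_form_scale)
qed

lemma ec_proj_coords:
  "\<exists>s. s \<noteq> 0 \<and> coord0 (ec_proj (Pt x y)) = s * y^2 \<and> coord1 (ec_proj (Pt x y)) = s * (- 1)"
proof (cases "y = 0")
  case True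
  then show ?thesis by (intro exI[of _ "-1"]) simp
next
  case False
  then show ?thesis by (intro exI[of _ "1 / y^2"]) simp
qed

lemma lessThan_6: "{..<6 :: nat} = {0, 1, 2, 3, 4, 5}"
  by auto

text \<open>
  The third power of the automorphism is the inversion, so the exponents \<open>j\<close> and \<open>j + 3\<close> together give the zeros
  of one of the three quadratic forms.
\<close>

lemma p6_form_at_zeros:
  assumes c: "c \<noteq> 0" and u: "u \<in> ec_points c" and v: "v \<in> ec_points c"
  shows "\<exists>k. k \<noteq> 0 \<and> (\<forall>z1 z0. p6_form_at c (ec_proj u) (ec_proj v) z1 z0 =
    k * (\<Prod>j<6. linear_form z1 z0 (ec_proj (ec_add u (ec_rot j v)))))"
proof (cases u)
  case EInf
  have "p6_form_at c (ec_proj u) (ec_proj v) z1 z0 = (linear_form z1 z0 (ec_proj v)) ^ 6" for z1 z0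
    unfolding p6_form_at_def EInf linear_form_def by (simp add: p6_form_zero) algebra
  then show ?thesis by (intro exI[of _ 1]) (simp add: EInf)
next
  case u': (Pt x1 y1)
  show ?thesis
  proof (cases v)
    case EInf
    have "p6_form_at c (ec_proj u) (ec_proj v) z1 z0 = (linear_form z1 z0 (ec_proj u)) ^ 6" for z1 z0
      unfolding p6_form_at_def EInf linear_form_def by (simp add: p6_form_zero) algebra
    then show ?thesis by (intro exI[of _ 1]) (simp add: EInf)
  next
    case v': (Pt x2 y2)
    have on: "y1^2 = x1 ^ 3 + c" "y2^2 = x2 ^ 3 + c" using u v u' v' by auto
    obtain s where s: "s \<noteq> 0" "coord0 (ec_proj u) = s * y1^2" "coord1 (ec_proj u) = s * (- 1)"
      using ec_proj_coords u' by metis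
    obtain t where t: "t \<noteq> 0" "coord0 (ec_proj v) = t * y2^2" "coord1 (ec_proj v) = t * (- 1)"
      using ec_proj_coords v' by metis
    have form: "p6_form_at c (ec_proj u) (ec_proj v) z1 z0 = (s * t) ^ 6 *
      (pair_form c x1 x2 z1 z0 * pair_form c x1 (root3 * x2) z1 z0 * pair_form c x1 (root3^2 * x2) z1 z0)"
      for z1 z0
      unfolding p6_form_at_proportional[OF s(2,3) t(2,3)] prod_pair_form[OF on]
      by (simp add: algebra_simps)
    have pair: "\<exists>k. k \<noteq> 0 \<and> (\<forall>z w. pair_form c x1 (root3 ^ j * x2) z w =
      k * (linear_form z w (ec_proj (ec_add u (ec_rot j v))) *
        linear_form z w (ec_proj (ec_add u (ec_rot (j + 3) v)))))" for j
    proof -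
      have "((-1) ^ j * y2)^2 = (root3 ^ j * x2) ^ 3 + c"
        using on(2) root3_cubed by (simp add: power_mult_distrib flip: power_mult)
          (simp add: mult.commute[of j] power_mult)
      from pair_form_zeros[OF c on(1) this]
      show ?thesis by (simp add: u' v' ec_rot_Pt power_add root3_cubed)
    qed
    obtain k0 where k0: "k0 \<noteq> 0" "\<And>z w. pair_form c x1 x2 z w =
      k0 * (linear_form z w (ec_proj (ec_add u (ec_rot 0 v))) *
        linear_form z w (ec_proj (ec_add u (ec_rot 3 v))))" using pair[of 0] by auto
    obtain k1 where k1: "k1 \<noteq> 0" "\<And>z w. pair_form c x1 (root3 * x2) z w =
      k1 * (linear_form z w (ec_proj (ec_add u (ec_rot 1 v))) *
        linear_form z w (ec_proj (ec_add u (ec_rot 4 v))))" using pair[of 1] by auto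
    obtain k2 where k2: "k2 \<noteq> 0" "\<And>z w. pair_form c x1 (root3^2 * x2) z w =
      k2 * (linear_form z w (ec_proj (ec_add u (ec_rot 2 v))) *
        linear_form z w (ec_proj (ec_add u (ec_rot 5 v))))" using pair[of 2] by auto
    show ?thesis
      unfolding form k0(2) k1(2) k2(2) lessThan_6 using s(1) t(1) k0(1) k1(1) k2(1)
      by (intro exI[of _ "(s * t) ^ 6 * k0 * k1 * k2"]) (simp add: mult_ac)
  qed
qed

section \<open>The coset group\<close>

lemma ec_rot_scalars: "(root3 ^ k) ^ 3 = ((-1) ^ k)^2" "((-1 :: complex) ^ k)^2 = 1"
proof -
  show "((-1 :: complex) ^ k)^2 = 1" by (simp flip: power_mult add: mult.commute)
  have "(root3 ^ k) ^ 3 = (root3 ^ 3) ^ k" by (simp only: power_mult[symmetric] mult.commute)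
  then show "(root3 ^ k) ^ 3 = ((-1) ^ k)^2"
    using \<open>((-1 :: complex) ^ k)^2 = 1\<close> by (simp add: root3_cubed)
qed

lemma ec_rot_points: "P \<in> ec_points c \<Longrightarrow> ec_rot k P \<in> ec_points c"
  unfolding ec_rot_def by (rule ec_scale_points[OF ec_rot_scalars(1)]) (simp_all add: ec_rot_scalars(2))

lemma ec_rot_add:
  "P \<in> ec_points c \<Longrightarrow> Q \<in> ec_points c \<Longrightarrow> ec_rot k (ec_add P Q) = ec_add (ec_rot k P) (ec_rot k Q)"
  unfolding ec_rot_def by (rule ec_scale_add[OF ec_rot_scalars(1)]) simp_all

lemma ec_rot_rot: "ec_rot j (ec_rot k P) = ec_rot (j + k) P"
  by (cases P) (simp_all add: ec_rot_Pt power_add mult_ac)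

lemma ec_rot_0 [simp]: "ec_rot 0 P = P"
  by (cases P) (simp_all add: ec_rot_Pt)

lemma ec_rot_6: "ec_rot (k + 6) P = ec_rot k P"
proof -
  have "root3 ^ 6 = (root3 ^ 3)^2" by (simp flip: power_mult)
  then have "root3 ^ 6 = 1" by (simp add: root3_cubed)
  then show ?thesis by (cases P) (simp_all add: ec_rot_Pt power_add)
qed

lemma ec_rot_mod_6: "ec_rot (k mod 6) P = ec_rot k P"
proof -
  have "ec_rot (j + 6 * m) P = ec_rot j P" for j m
  proof (induction m)
    case (Suc m)
    have "j + 6 * Suc m = (j + 6 * m) + 6" by simp
    then show ?case using Suc ec_rot_6 by metis
  qed simp
  from this[of "k mod 6" "k div 6"] show ?thesis by simp
qed

lemma phi6_eq_rot: "phi6 P = ec_rot 1 P"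
  by (cases P) (simp_all add: ec_rot_Pt root3_def)

lemma ec_rot_3: "ec_rot 3 P = ec_neg P"
  by (cases P) (simp_all add: ec_rot_Pt root3_cubed)

lemma ec_proj_neg [simp]: "ec_proj (ec_neg P) = ec_proj P"
  by (simp flip: ec_rot_3)

lemma cube_eq_cases:
  assumes "a ^ 3 = b ^ 3"
  shows "\<exists>j<3. a = root3 ^ j * b"
proof -
  have "(a - b) * (a - root3 * b) * (a - root3^2 * b) = 0"
    using assms root3_sum by algebra
  then consider "a = root3 ^ 0 * b" | "a = root3 ^ 1 * b" | "a = root3 ^ 2 * b" by auto
  then show ?thesis
  proof cases
    case 1 then show ?thesis by (intro exI[of _ 0]) simp
  next
    case 2 then show ?thesis by (intro exI[of _ 1]) simp
  next
    case 3 then show ?thesis by (intro exI[of _ 2]) simp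
  qed
qed

lemma ec_proj_eq_iff:
  assumes "u \<in> ec_points c" "v \<in> ec_points c"
  shows "ec_proj u = ec_proj v \<longleftrightarrow> (\<exists>k<6. v = ec_rot k u)"
proof
  assume eq: "ec_proj u = ec_proj v"
  show "\<exists>k<6. v = ec_rot k u"
  proof (cases u)
    case EInf
    then have "v = EInf" using eq by (cases v) (auto split: if_splits)
    then show ?thesis using EInf by (intro exI[of _ 0]) simp
  next
    case (Pt x y)
    then obtain x' y' where v: "v = Pt x' y'" using eq by (cases v) (auto split: if_splits)
    have y: "y'^2 = y^2" using eq Pt v by (auto split: if_splits)
    then have "x' ^ 3 = x ^ 3" using assms Pt v by simp
    then obtain j where j: "j < 3" "x' = root3 ^ j * x" using cube_eq_cases by blast
    have j3: "x' = root3 ^ (j + 3) * x" using j(2) by (simp add: power_add root3_cubed)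
    have "y' = (-1) ^ j * y \<or> y' = - ((-1) ^ j * y)"
      using y by (cases "even j") (auto simp: power2_eq_iff)
    then have "y' = (-1) ^ j * y \<or> y' = (-1) ^ (j + 3) * y" by (simp add: power_add)
    then show ?thesis
    proof
      assume "y' = (-1) ^ j * y"
      then show ?thesis using j by (intro exI[of _ j]) (simp add: Pt v ec_rot_Pt)
    next
      assume "y' = (-1) ^ (j + 3) * y"
      then show ?thesis using j(1) j3 by (intro exI[of _ "j + 3"]) (simp only: Pt v ec_rot_Pt, simp)
    qed
  qed
qed auto

lemma ec_proj_surj: "\<exists>u. u \<in> ec_points c \<and> ec_proj u = p"
proof -
  have point: "\<exists>x. Pt x y \<in> ec_points c" for y
  proof -
    obtain x where "y^2 - c = x ^ 3" by (rule exists_complex_root[of 3 "y^2 - c"]) simp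
    then have "y^2 = x ^ 3 + c" by algebra
    then show ?thesis by (intro exI[of _ x]) simp
  qed
  show ?thesis
  proof (cases p)
    case (Aff a)
    show ?thesis
    proof (cases "a = 0")
      case True
      then show ?thesis using Aff by (intro exI[of _ EInf]) simp
    next
      case False
      obtain x where x: "Pt x (csqrt (- 1 / a)) \<in> ec_points c" using point by blast
      have "csqrt (- 1 / a) \<noteq> 0" "- 1 / (csqrt (- 1 / a))^2 = a" using False by simp_all
      then have "ec_proj (Pt x (csqrt (- 1 / a))) = Aff a" by (simp only: ec_proj.simps if_False)
      then show ?thesis using x Aff by blast
    qed
  next
    case Infty
    obtain x where "Pt x 0 \<in> ec_points c" using point by blast
    then show ?thesis using Infty by (intro exI[of _ "Pt x 0"]) simp
  qed
qed

text \<open>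
  The product of the orbits of \<open>u\<close> and \<open>v\<close>, indexed
    by exponents modulo six: changes of representatives
  become shifts of the summation index.
\<close>

definition orbit_sum :: "ecpoint \<Rightarrow> ecpoint \<Rightarrow> cp1 multiset" where
  "orbit_sum u v = (\<Sum>k<6. {#ec_proj (ec_add u (ec_rot k v))#})"

lemma sum_periodic_shift:
  fixes F :: "nat \<Rightarrow> 'a :: comm_monoid_add"
  assumes "\<And>k. F (k + 6) = F k"
  shows "(\<Sum>k<6. F (k + b)) = (\<Sum>k<6. F k)"
proof (induction b)
  case (Suc b)
  have "F (6 + b) = F b" using assms[of b] by (simp add: add.commute)
  then have "(\<Sum>k<6. F (k + Suc b)) = (\<Sum>k<6. F (k + b))"
    by (simp add: lessThan_6 add_ac eval_nat_numeral)
  then show ?case using Suc by simp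
qed simp

lemma sum_periodic_neg:
  fixes F :: "nat \<Rightarrow> 'a :: comm_monoid_add"
  assumes "\<And>k. F (k + 6) = F k"
  shows "(\<Sum>k<6. F (5 * k)) = (\<Sum>k<6. F k)"
proof -
  have "F 10 = F 4" "F 15 = F 3" "F 20 = F 2" "F 25 = F 1"
    using assms[of 4] assms[of 9] assms[of 3] assms[of 14] assms[of 8] assms[of 2]
      assms[of 19] assms[of 13] assms[of 7] assms[of 1] by simp_all
  then show ?thesis by (simp add: lessThan_6 add_ac)
qed

lemma orbit_sum_rot:
  assumes "u \<in> ec_points c" "v \<in> ec_points c"
  shows "orbit_sum (ec_rot a u) (ec_rot b v) = orbit_sum u v"
proof -
  have left: "ec_proj (ec_add (ec_rot a u) (ec_rot k v)) = ec_proj (ec_add u (ec_rot (k + 5 * a) v))" for k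
  proof -
    have "ec_rot a (ec_rot (k + 5 * a) v) = ec_rot k v"
    proof -
      have "a + (k + 5 * a) = k + 6 * a" by simp
      then show ?thesis
        unfolding ec_rot_rot by (metis ec_rot_mod_6 mod_mult_self2)
    qed
    then have "ec_add (ec_rot a u) (ec_rot k v) = ec_rot a (ec_add u (ec_rot (k + 5 * a) v))"
      using ec_rot_add[OF assms(1) ec_rot_points[OF assms(2)]] by simp
    then show ?thesis by simp
  qed
  have "orbit_sum (ec_rot a u) (ec_rot b v) = (\<Sum>k<6. {#ec_proj (ec_add u (ec_rot (k + b + 5 * a) v))#})"
    unfolding orbit_sum_def ec_rot_rot left ..
  also have "\<dots> = (\<Sum>k<6. {#ec_proj (ec_add u (ec_rot (k + (b + 5 * a)) v))#})"
    by (simp only: add.assoc)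
  also have "\<dots> = orbit_sum u v"
    unfolding orbit_sum_def by (rule sum_periodic_shift) (simp only: ec_rot_6)
  finally show ?thesis .
qed

lemma orbit_sum_commute:
  assumes "u \<in> ec_points c" "v \<in> ec_points c"
  shows "orbit_sum u v = orbit_sum v u"
proof -
  have "ec_proj (ec_add u (ec_rot k v)) = ec_proj (ec_add v (ec_rot (5 * k) u))" for k
  proof -
    have "ec_rot k (ec_rot (5 * k) u) = u"
      unfolding ec_rot_rot using ec_rot_mod_6[of "k + 5 * k" u] by simp
    then have "ec_add u (ec_rot k v) = ec_rot k (ec_add (ec_rot (5 * k) u) v)"
      using ec_rot_add[OF ec_rot_points[OF assms(1)] assms(2)] by simp
    also have "ec_add (ec_rot (5 * k) u) v = ec_add v (ec_rot (5 * k) u)"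
      using ec_add_commute ec_rot_points assms by blast
    finally show ?thesis by simp
  qed
  then have "orbit_sum u v = (\<Sum>k<6. {#ec_proj (ec_add v (ec_rot (5 * k) u))#})"
    by (simp add: orbit_sum_def)
  also have "\<dots> = orbit_sum v u"
    unfolding orbit_sum_def by (rule sum_periodic_neg) (simp only: ec_rot_6)
  finally show ?thesis .
qed

lemma set_orbit_sum: "set_mset (orbit_sum u v) = {ec_proj (ec_add u (ec_rot k v)) |k. k < 6}"
  unfolding orbit_sum_def by (auto simp: set_mset_sum)

text \<open>
  Orbits are represented by chosen points; \<open>nmult_G6\<close> shows that the choice does not matter.
\<close>

definition G6 :: "complex \<Rightarrow> cp1 nvgroup" where
  "G6 c = \<lparr>nmult = (\<lambda>p q. Some (orbit_sum (SOME u. u \<in> ec_points c \<and> ec_proj u = p)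
      (SOME v. v \<in> ec_points c \<and> ec_proj v = q))), nunit = Aff 0, ninv = Some\<rparr>"

lemma nmult_G6:
  assumes "u \<in> ec_points c" "v \<in> ec_points c"
  shows "nmult (G6 c) (ec_proj u) (ec_proj v) = Some (orbit_sum u v)"
proof -
  have rep: "\<exists>k. (SOME w. w \<in> ec_points c \<and> ec_proj w = ec_proj u) = ec_rot k u" if "u \<in> ec_points c" for u
  proof -
    have "(SOME w. w \<in> ec_points c \<and> ec_proj w = ec_proj u) \<in> ec_points c \<and>
        ec_proj (SOME w. w \<in> ec_points c \<and> ec_proj w = ec_proj u) = ec_proj u"
      by (rule someI[of _ u]) (use that in simp)
    then show ?thesis using ec_proj_eq_iff[OF that] by metis
  qed
  obtain a b where "(SOME w. w \<in> ec_points c \<and> ec_proj w = ec_proj u) = ec_rot a u"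
    "(SOME w. w \<in> ec_points c \<and> ec_proj w = ec_proj v) = ec_rot b v" using rep assms by metis
  then show ?thesis using orbit_sum_rot[OF assms] by (simp add: G6_def)
qed

lemma nmult_G6_obtain:
  obtains u v where "u \<in> ec_points c" "v \<in> ec_points c" "p = ec_proj u" "q = ec_proj v"
    "nmult (G6 c) p q = Some (orbit_sum u v)"
  using ec_proj_surj[of c p] ec_proj_surj[of c q] nmult_G6 by metis

lemma nunit_G6 [simp]: "nunit (G6 c) = Aff 0" and ninv_G6 [simp]: "ninv (G6 c) = Some"
  by (simp_all add: G6_def)

lemma nv_associative_G6:
  assumes c: "c \<noteq> 0"
  shows "nv_associative CP1 (G6 c)"
  unfolding nv_associative_def
proof (intro ballI allI impI)
  fix x y z M N
  assume "nmult (G6 c) y z = Some M \<and> nmult (G6 c) x y = Some N \<and>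
    (\<forall>w\<in>#M. nmult (G6 c) x w \<noteq> None) \<and> (\<forall>w\<in>#N. nmult (G6 c) w z \<noteq> None)"
  then have M: "nmult (G6 c) y z = Some M" and N: "nmult (G6 c) x y = Some N" by simp_all
  obtain u v where u: "u \<in> ec_points c" "x = ec_proj u" and v: "v \<in> ec_points c" "y = ec_proj v"
    using ec_proj_surj by metis
  obtain t where t: "t \<in> ec_points c" "z = ec_proj t" using ec_proj_surj by metis
  note [simp] = ec_rot_points ec_add_closed
  have sum_image: "(\<Sum>w\<in>#(\<Sum>k<6. {#g k#}). f w) = (\<Sum>k<6. f (g k))"
    for f :: "cp1 \<Rightarrow> cp1 multiset" and g :: "nat \<Rightarrow> cp1"
    by (simp add: lessThan_6)
  have M': "M = orbit_sum v t" and N': "N = orbit_sum u v"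
    using M N u v t by (simp_all add: nmult_G6)
  have "(\<Sum>w\<in>#M. the (nmult (G6 c) x w)) = (\<Sum>k<6. orbit_sum u (ec_add v (ec_rot k t)))"
    unfolding M' orbit_sum_def[of v t] sum_image using u v t by (simp add: nmult_G6)
  also have "\<dots> = (\<Sum>k<6. \<Sum>j<6. {#ec_proj (ec_add (ec_add u (ec_rot j v)) (ec_rot (k + j) t))#})"
    using u v t by (simp add: orbit_sum_def ec_rot_add[of v c "ec_rot _ t"] ec_rot_rot
        ec_add_assoc[OF _ _ _ c] add.commute)
  also have "\<dots> = (\<Sum>j<6. \<Sum>k<6. {#ec_proj (ec_add (ec_add u (ec_rot j v)) (ec_rot (k + j) t))#})"
    by (rule sum.swap)
  also have "\<dots> = (\<Sum>j<6. orbit_sum (ec_add u (ec_rot j v)) t)"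
    unfolding orbit_sum_def
    by (intro sum.cong refl sum_periodic_shift) (simp only: ec_rot_6)
  also have "\<dots> = (\<Sum>w\<in>#N. the (nmult (G6 c) w z))"
    unfolding N' orbit_sum_def[of u v] sum_image using u v t by (simp add: nmult_G6)
  finally show "(\<Sum>w\<in>#M. the (nmult (G6 c) x w)) = (\<Sum>w\<in>#N. the (nmult (G6 c) w z))" .
qed

lemma form_zeros_orbit_sum:
  assumes "c \<noteq> 0" "u \<in> ec_points c" "v \<in> ec_points c"
  shows "form_zeros 6 (p6_form_at c (ec_proj u) (ec_proj v)) (orbit_sum u v)"
proof -
  obtain k where k: "k \<noteq> 0" "\<forall>z1 z0. p6_form_at c (ec_proj u) (ec_proj v) z1 z0 =
    k * (\<Prod>j<6. linear_form z1 z0 (ec_proj (ec_add u (ec_rot j v))))"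
    using p6_form_at_zeros[OF assms] by blast
  have "size (orbit_sum u v) = 6" by (simp add: orbit_sum_def lessThan_6)
  moreover have "(\<Prod>p\<in>#orbit_sum u v. z1 * coord0 p - z0 * coord1 p) =
      (\<Prod>j<6. linear_form z1 z0 (ec_proj (ec_add u (ec_rot j v))))" for z1 z0
    by (simp add: orbit_sum_def lessThan_6 linear_form_def)
  ultimately show ?thesis unfolding form_zeros_def using k by auto
qed

lemma form_zeros_nmult_G6:
  assumes "c \<noteq> 0"
  shows "\<exists>M. nmult (G6 c) p q = Some M \<and> form_zeros 6 (p6_form_at c p q) M"
proof -
  obtain u v where "u \<in> ec_points c" "v \<in> ec_points c" "p = ec_proj u" "q = ec_proj v"
    "nmult (G6 c) p q = Some (orbit_sum u v)" by (rule nmult_G6_obtain)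
  then show ?thesis using form_zeros_orbit_sum[OF assms] by auto
qed

lemma p6_coefficients:
  obtains a where "\<forall>z x y. p6 c z x y = (\<Sum>i\<le>6. \<Sum>j\<le>6. \<Sum>k\<le>6. a i j k * z ^ i * x ^ j * y ^ k)"
    "\<And>p q z1 z0. p6_form_at c p q z1 z0 = (\<Sum>i\<le>6. \<Sum>j\<le>6. \<Sum>k\<le>6. a i j k * (z1 ^ i * z0 ^ (6 - i)) *
       (coord1 p ^ j * coord0 p ^ (6 - j)) * (coord1 q ^ k * coord0 q ^ (6 - k)))"
  using trihomogenization_p6[of c] unfolding trihomogenization_def p6_form_at_def by blast

lemma mult_defined_by_G6:
  assumes "c \<noteq> 0"
  shows "mult_defined_by 6 (p6 c) (G6 c)"
proof -
  obtain a where a: "\<forall>z x y. p6 c z x y = (\<Sum>i\<le>6. \<Sum>j\<le>6. \<Sum>k\<le>6. a i j k * z ^ i * x ^ j * y ^ k)"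
    "\<And>p q z1 z0. p6_form_at c p q z1 z0 = (\<Sum>i\<le>6. \<Sum>j\<le>6. \<Sum>k\<le>6. a i j k * (z1 ^ i * z0 ^ (6 - i)) *
       (coord1 p ^ j * coord0 p ^ (6 - j)) * (coord1 q ^ k * coord0 q ^ (6 - k)))"
    by (rule p6_coefficients[of c]) blast
  have "p6_form_at c p q = (\<lambda>z1 z0. \<Sum>i\<le>6. \<Sum>j\<le>6. \<Sum>k\<le>6. a i j k * (z1 ^ i * z0 ^ (6 - i)) *
       (coord1 p ^ j * coord0 p ^ (6 - j)) * (coord1 q ^ k * coord0 q ^ (6 - k)))" for p q
    by (intro ext a(2))
  then show ?thesis
    unfolding mult_defined_by_def using form_zeros_nmult_G6[OF assms]
    by (intro exI[of _ a] conjI a(1)) simp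
qed

text \<open>
  The zeros of \<open>p6\<close> are the values of the multiplication, and its coefficients as a form in \<open>z\<close> are
  bihomogeneous of bidegree \<open>(6, 6)\<close>.
\<close>

lemma regular_on_nmult_G6:
  assumes c: "c \<noteq> 0"
  shows "regular_on (square_space CP1) UNIV (sym_space 6 CP1) (\<lambda>(p, q). the (nmult (G6 c) p q))"
proof -
  obtain a where a: "\<And>p q z1 z0. p6_form_at c p q z1 z0 =
      (\<Sum>i\<le>6. \<Sum>j\<le>6. \<Sum>k\<le>6. a i j k * (z1 ^ i * z0 ^ (6 - i)) *
       (coord1 p ^ j * coord0 p ^ (6 - j)) * (coord1 q ^ k * coord0 q ^ (6 - k)))"
    by (rule p6_coefficients[of c]) blast
  define \<Phi> :: "complex \<Rightarrow> complex \<Rightarrow> (nat \<Rightarrow> nat \<Rightarrow> complex) \<Rightarrow> complex" where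
    "\<Phi> z1 z0 v = (\<Sum>i\<le>6. \<Sum>j\<le>6. \<Sum>k\<le>6. a i j k * (z1 ^ i * z0 ^ (6 - i)) *
       ((v 0 1 ^ j * v 0 0 ^ (6 - j)) * (v 1 1 ^ k * v 1 0 ^ (6 - k))))" for z1 z0 v
  let ?h = "\<lambda>(p, q). [hcoord CP1 p, hcoord CP1 q]"
  interpret form_zeros_map "UNIV \<times> UNIV" ?h "\<lambda>(p, q). the (nmult (G6 c) p q)" 6
    "\<lambda>i. if i < 2 then 6 else 0" \<Phi>
  proof
    show "multihomogeneous (\<lambda>i. if i < 2 then 6 else 0) (\<Phi> z1 z0)" for z1 z0
      unfolding \<Phi>_def
    proof (intro multihomogeneous_sum multihomogeneous_cmult finite_atMost)
      fix j k :: nat assume jk: "j \<in> {..6}" "k \<in> {..6}"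
      show "multihomogeneous (\<lambda>i. if i < 2 then 6 else 0)
          (\<lambda>v. (v 0 1 ^ j * v 0 0 ^ (6 - j)) * (v 1 1 ^ k * v 1 0 ^ (6 - k)))"
        by (rule multihomogeneous_cong[OF multihomogeneous_mult[OF
              multihomogeneous_mult[OF multihomogeneous_power[OF multihomogeneous_coord[of 0 1], of j]
                multihomogeneous_power[OF multihomogeneous_coord[of 0 0], of "6 - j"]]
              multihomogeneous_mult[OF multihomogeneous_power[OF multihomogeneous_coord[of 1 1], of k]
                multihomogeneous_power[OF multihomogeneous_coord[of 1 0], of "6 - k"]]]])
          (use jk in auto)
    qed
    fix pq :: "cp1 \<times> cp1"
    obtain p q where pq: "pq = (p, q)" by (cases pq)
    have "\<Phi> z1 z0 (coord_blocks (?h pq)) = p6_form_at c p q z1 z0" for z1 z0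
      unfolding \<Phi>_def a pq by (simp add: coord_blocks_def hcoord_CP1 mult.assoc)
    then show "form_zeros 6 (\<lambda>z1 z0. \<Phi> z1 z0 (coord_blocks (?h pq)))
        (case pq of (p, q) \<Rightarrow> the (nmult (G6 c) p q))"
      using form_zeros_nmult_G6[OF c, of p q] pq by auto
  qed
  show ?thesis using regular_on_form_zeros_map by (simp add: square_space_def)
qed

lemma projective_variety_CP1: "projective_variety CP1"
proof -
  have inj: "p = q" if "hcoord CP1 p = (\<lambda>j. t * hcoord CP1 q j)" for p q t
    using fun_cong[OF that, of 0] fun_cong[OF that, of 1]
    by (cases p; cases q) (auto simp: hcoord_CP1)
  have "(\<exists>p\<in>UNIV. \<exists>t. t \<noteq> 0 \<and> v = (\<lambda>j. t * hcoord CP1 p j)) \<longleftrightarrow>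
      v \<noteq> (\<lambda>j. 0) \<and> (\<forall>j>1. v j = 0) \<and> (\<forall>A\<in>{}. A (coord_blocks [v]) = 0)" for v
  proof
    assume "\<exists>p\<in>UNIV. \<exists>t. t \<noteq> 0 \<and> v = (\<lambda>j. t * hcoord CP1 p j)"
    then obtain p t where t: "t \<noteq> 0" and v: "v = (\<lambda>j. t * hcoord CP1 p j)" by blast
    have "v 0 \<noteq> 0 \<or> v 1 \<noteq> 0" using t unfolding v by (cases p) (auto simp: hcoord_CP1)
    then have "v \<noteq> (\<lambda>j. 0)" by auto
    then show "v \<noteq> (\<lambda>j. 0) \<and> (\<forall>j>1. v j = 0) \<and> (\<forall>A\<in>{}. A (coord_blocks [v]) = 0)"
      by (simp add: v hcoord_CP1)
  next
    assume v: "v \<noteq> (\<lambda>j. 0) \<and> (\<forall>j>1. v j = 0) \<and> (\<forall>A\<in>{}. A (coord_blocks [v]) = 0)"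
    have split: "j = 0 \<or> j = 1 \<or> j > 1" for j :: nat by linarith
    show "\<exists>p\<in>UNIV. \<exists>t. t \<noteq> 0 \<and> v = (\<lambda>j. t * hcoord CP1 p j)"
    proof (cases "v 0 = 0")
      case True
      then have "v 1 \<noteq> 0" using v split by (metis ext)
      moreover have "v = (\<lambda>j. v 1 * hcoord CP1 Infty j)"
      proof
        fix j show "v j = v 1 * hcoord CP1 Infty j"
          using split[of j] True v by (auto simp: hcoord_CP1)
      qed
      ultimately show ?thesis by blast
    next
      case False
      have "v = (\<lambda>j. v 0 * hcoord CP1 (Aff (v 1 / v 0)) j)"
      proof
        fix j show "v j = v 0 * hcoord CP1 (Aff (v 1 / v 0)) j"
          using split[of j] False v by (auto simp: hcoord_CP1)
      qed
      then show ?thesis using False by blast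
    qed
  qed
  then have "\<exists>N F. (\<forall>A\<in>F. \<exists>d. multihomogeneous d A) \<and>
       (\<forall>v. (\<exists>p\<in>UNIV. \<exists>t. t \<noteq> 0 \<and> v = (\<lambda>j. t * hcoord CP1 p j)) \<longleftrightarrow>
            v \<noteq> (\<lambda>j. 0) \<and> (\<forall>j>N. v j = 0) \<and> (\<forall>A\<in>F. A (coord_blocks [v]) = 0))"
    by (intro exI[of _ 1] exI[of _ "{}"]) simp
  moreover have "\<forall>p\<in>UNIV. \<forall>q\<in>UNIV. \<forall>t. hcoord CP1 p = (\<lambda>j. t * hcoord CP1 q j) \<longrightarrow> p = q"
    using inj by (intro ballI allI impI)
  ultimately show ?thesis unfolding projective_variety_def points_CP1 by (rule conjI[rotated])
qed

lemma var_space_CP1: "var_space CP1 = zariski_space UNIV (\<lambda>p. [hcoord CP1 p])"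
  by (simp add: var_space_def)

fun cp1_scale :: "complex \<Rightarrow> cp1 \<Rightarrow> cp1" where
  "cp1_scale s (Aff x) = Aff (s * x)"
| "cp1_scale s Infty = Infty"

lemma morphism_cp1_scale:
  assumes "s \<noteq> 0"
  shows "morphism (var_space CP1) (var_space CP1) (cp1_scale s)"
  unfolding morphism_def var_space_CP1 topspace_zariski_space
proof (subst (2) var_space_CP1[symmetric], rule regular_on_polynomial_map)
  fix p
  show "cp1_scale s p \<in> points CP1" by simp
  define w where "w = (\<lambda>j :: nat. if j = 0 then 1 else s)"
  have w: "w j \<noteq> 0" for j using assms by (simp add: w_def)
  have scale: "\<exists>t. \<forall>j. w j * hcoord CP1 q j = t * hcoord CP1 (cp1_scale s q) j" for q
  proof (cases q)
    case (Aff x)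
    then show ?thesis by (intro exI[of _ 1]) (simp add: w_def hcoord_CP1)
  next
    case Infty
    then show ?thesis by (intro exI[of _ s]) (simp add: w_def hcoord_CP1)
  qed
  show "polynomial_map_at UNIV (\<lambda>p. [hcoord CP1 p]) CP1 (cp1_scale s) p"
    unfolding polynomial_map_at_def
  proof (intro exI[of _ "\<lambda>k. if k = 0 then 1 else 0"] exI[of _ "\<lambda>j v. w j * v 0 j"] conjI allI ballI)
    show "multihomogeneous (\<lambda>k. if k = 0 then 1 else 0) (\<lambda>v. w j * v 0 j)" for j
      by (intro multihomogeneous_cmult multihomogeneous_coord)
    have "hcoord CP1 p 0 \<noteq> 0 \<or> hcoord CP1 p 1 \<noteq> 0" by (cases p) (simp_all add: hcoord_CP1)
    then show "\<exists>j. w j * coord_blocks [hcoord CP1 p] 0 j \<noteq> 0"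
      using w by (auto simp: coord_blocks_def)
    show "\<exists>t. \<forall>j. w j * coord_blocks [hcoord CP1 q] 0 j = t * hcoord CP1 (cp1_scale s q) j" for q
      using scale[of q] by (simp add: coord_blocks_def)
  qed
qed

lemma variety_iso_cp1_scale:
  assumes "s \<noteq> 0"
  shows "variety_iso CP1 CP1 (cp1_scale s)"
proof -
  have cancel: "cp1_scale (inverse s) (cp1_scale s p) = p" "cp1_scale s (cp1_scale (inverse s) p) = p" for p
    using assms by (cases p; simp)+
  have bij: "bij (cp1_scale s)" by (rule o_bij[of "cp1_scale (inverse s)"]) (auto simp: cancel)
  have "inv_into UNIV (cp1_scale s) = cp1_scale (inverse s)"
    by (rule inv_equality) (auto simp: cancel)
  then show ?thesis
    using bij morphism_cp1_scale[OF assms] morphism_cp1_scale[of "inverse s"] assms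
    by (simp add: variety_iso_def)
qed

lemma morphism_identity_CP1: "morphism (var_space CP1) (var_space CP1) (\<lambda>p. p)"
proof -
  have "cp1_scale 1 = (\<lambda>p. p)"
  proof
    fix p show "cp1_scale 1 p = p" by (cases p) simp_all
  qed
  then show ?thesis using morphism_cp1_scale[of 1] by simp
qed

lemma morphism_ec_proj: "morphism (var_space (ec_var c)) (var_space CP1) ec_proj"
  unfolding morphism_def var_space_ec_var topspace_zariski_space
proof (rule regular_on_polynomial_map)
  fix p assume p: "p \<in> ec_points c"
  show "ec_proj p \<in> points CP1" by simp
  define P :: "nat \<Rightarrow> (nat \<Rightarrow> nat \<Rightarrow> complex) \<Rightarrow> complex" where
    "P j v = (if j = 0 then 1 else if j = 1 then - 1 else 0) * (if j = 0 then v 0 2 else v 0 0) ^ 2" for j v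
  show "polynomial_map_at (ec_points c) (\<lambda>p. [ec_coord p]) CP1 ec_proj p"
    unfolding polynomial_map_at_def
  proof (intro exI[of _ "\<lambda>k. 2 * (if k = 0 then 1 else 0)"] exI[of _ P] conjI allI ballI)
    show "multihomogeneous (\<lambda>k. 2 * (if k = 0 then 1 else 0)) (P j)" for j
    proof (cases "j = 0")
      case True
      then show ?thesis unfolding P_def
        using multihomogeneous_power[OF multihomogeneous_coord[of 0 2], of 2] by simp
    next
      case False
      then show ?thesis unfolding P_def
        using multihomogeneous_cmult[OF multihomogeneous_power[OF multihomogeneous_coord[of 0 0], of 2],
            of "if j = 1 then - 1 else 0"] by simp
    qed
    show "\<exists>j. P j (coord_blocks [ec_coord p]) \<noteq> 0"
    proof (cases p)
      case (Pt x y)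
      then show ?thesis by (intro exI[of _ 1]) (simp add: P_def coord_blocks_def)
    next
      case EInf
      then show ?thesis by (intro exI[of _ 0]) (simp add: P_def coord_blocks_def)
    qed
    fix q assume "q \<in> ec_points c"
    show "\<exists>t. \<forall>j. P j (coord_blocks [ec_coord q]) = t * hcoord CP1 (ec_proj q) j"
    proof (cases q)
      case (Pt x y)
      obtain s where s: "s \<noteq> 0" "coord0 (ec_proj (Pt x y)) = s * y^2" "coord1 (ec_proj (Pt x y)) = s * (- 1)"
        using ec_proj_coords by metis
      show ?thesis
        unfolding Pt hcoord_CP1 s(2,3) using s(1)
        by (intro exI[of _ "1 / s"]) (simp add: P_def coord_blocks_def)
    next
      case EInf
      then show ?thesis by (intro exI[of _ 1]) (simp add: P_def coord_blocks_def hcoord_CP1)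
    qed
  qed
qed

lemma algebraic_group_ec:
  assumes c: "c \<noteq> 0"
  shows "algebraic_group (ec_var c) (ec_group c)"
  unfolding algebraic_group_def
proof (intro conjI)
  show "projective_variety (ec_var c)" by (rule projective_variety_ec_var)
  show "group (ec_group c)" by (rule group_ec_group[OF c])
  show "carrier (ec_group c) = points (ec_var c)" by simp
  have square: "square_space (ec_var c) =
      zariski_space (ec_points c \<times> ec_points c) (\<lambda>(p, q). [ec_coord p, ec_coord q])"
    by (simp add: square_space_def)
  show "morphism (square_space (ec_var c)) (var_space (ec_var c)) (\<lambda>(u, v). u \<otimes>\<^bsub>ec_group c\<^esub> v)"
    unfolding morphism_def square topspace_zariski_space
  proof (rule regular_on_polynomial_map)
    fix pq assume "pq \<in> ec_points c \<times> ec_points c"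
    then obtain p q where pq: "pq = (p, q)" "p \<in> ec_points c" "q \<in> ec_points c" by blast
    show "(case pq of (u, v) \<Rightarrow> u \<otimes>\<^bsub>ec_group c\<^esub> v) \<in> points (ec_var c)"
      using pq by (simp add: ec_add_closed)
    show "polynomial_map_at (ec_points c \<times> ec_points c) (\<lambda>(p, q). [ec_coord p, ec_coord q])
        (ec_var c) (\<lambda>(u, v). u \<otimes>\<^bsub>ec_group c\<^esub> v) pq"
      using polynomial_map_at_ec_add[OF pq(2,3) c] pq(1) by simp
  qed
  have neg: "ec_scale 1 (- 1) P = ec_neg P" for P by (cases P) simp_all
  show "morphism (var_space (ec_var c)) (var_space (ec_var c)) (\<lambda>u. inv\<^bsub>ec_group c\<^esub> u)"
    unfolding morphism_def
    unfolding var_space_ec_var[of c] topspace_zariski_space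
  proof (rule regular_on_zariski_space_cong)
    show "regular_on (zariski_space (ec_points c) (\<lambda>p. [ec_coord p])) (ec_points c)
        (zariski_space (ec_points c) (\<lambda>p. [ec_coord p])) (ec_scale 1 (- 1))"
      using morphism_ec_scale[of 1 "-1" c c]
      unfolding morphism_def var_space_ec_var topspace_zariski_space by simp
    show "ec_scale 1 (- 1) u = inv\<^bsub>ec_group c\<^esub> u" if "u \<in> ec_points c" for u
      using inv_ec_group[OF c that] neg by simp
  qed
qed

section \<open>The automorphism group of order six\<close>

definition rot_auto :: "complex \<Rightarrow> nat \<Rightarrow> ecpoint \<Rightarrow> ecpoint" where
  "rot_auto c k = restrict (ec_rot k) (ec_points c)"

lemma rot_auto_apply [simp]: "u \<in> ec_points c \<Longrightarrow> rot_auto c k u = ec_rot k u"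
  by (simp add: rot_auto_def)

lemma rot_auto_auto: "rot_auto c k \<in> auto (ec_group c)"
proof -
  have bij: "bij_betw (rot_auto c k) (ec_points c) (ec_points c)"
  proof (rule bij_betw_byWitness[where f' = "rot_auto c (5 * k)"])
    have "ec_rot (5 * k + k) u = u" "ec_rot (k + 5 * k) u = u" for u
      using ec_rot_mod_6[of "6 * k" u] by simp_all
    then show "\<forall>u\<in>ec_points c. rot_auto c (5 * k) (rot_auto c k u) = u"
      "\<forall>u\<in>ec_points c. rot_auto c k (rot_auto c (5 * k) u) = u"
      by (simp_all add: ec_rot_points ec_rot_rot)
  qed (auto simp: ec_rot_points)
  have "rot_auto c k \<in> hom (ec_group c) (ec_group c)"
    by (auto simp: hom_def ec_rot_points ec_rot_add ec_add_closed)
  then show ?thesis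
    using bij by (simp add: auto_def Bij_def) (simp add: rot_auto_def)
qed

lemma rot_auto_mult:
  "rot_auto c j \<otimes>\<^bsub>AutoGroup (ec_group c)\<^esub> rot_auto c k = rot_auto c (j + k)"
proof -
  have "rot_auto c i \<in> Bij (ec_points c)" for i
    using rot_auto_auto[of c i] by (simp add: auto_def)
  then have "rot_auto c j \<otimes>\<^bsub>AutoGroup (ec_group c)\<^esub> rot_auto c k =
      compose (ec_points c) (rot_auto c j) (rot_auto c k)"
    by (simp add: AutoGroup_def BijGroup_def)
  also have "\<dots> = rot_auto c (j + k)"
    by (auto simp: fun_eq_iff compose_def rot_auto_def ec_rot_points ec_rot_rot)
  finally show ?thesis .
qed

lemma rot_auto_0: "rot_auto c 0 = \<one>\<^bsub>AutoGroup (ec_group c)\<^esub>"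
  by (auto simp: AutoGroup_def BijGroup_def rot_auto_def fun_eq_iff)

lemma rot_auto_mod_6: "rot_auto c (k mod 6) = rot_auto c k"
  by (auto simp: rot_auto_def fun_eq_iff ec_rot_mod_6)

lemma auts_ec_coset_data:
  assumes c: "c \<noteq> 0"
  shows "auts (ec_coset_data c) = rot_auto c ` {..<6}"
proof -
  let ?A = "AutoGroup (ec_group c)"
  interpret A: group ?A by (rule group.AutoGroup[OF group_ec_group[OF c]])
  have gen: "restrict phi6 (ec_points c) = rot_auto c 1"
    by (auto simp: rot_auto_def fun_eq_iff phi6_eq_rot)
  have carrier: "rot_auto c k \<in> carrier ?A" for k
    using rot_auto_auto by (simp add: AutoGroup_def)
  have inv1: "inv\<^bsub>?A\<^esub> (rot_auto c 1) = rot_auto c 5"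
  proof (rule A.inv_equality)
    have "rot_auto c 6 = rot_auto c 0" using rot_auto_mod_6[of c 6] by simp
    then show "rot_auto c 5 \<otimes>\<^bsub>?A\<^esub> rot_auto c 1 = \<one>\<^bsub>?A\<^esub>" by (simp add: rot_auto_mult rot_auto_0)
  qed (rule carrier)+
  have "h \<in> range (rot_auto c)" if "h \<in> generate ?A {rot_auto c 1}" for h
    using that
  proof induction
    case (inv h)
    then show ?case using inv1 by auto
  next
    case (eng h1 h2)
    then show ?case using rot_auto_mult by fastforce
  qed (auto simp flip: rot_auto_0)
  moreover have "rot_auto c k \<in> generate ?A {rot_auto c 1}" for k
  proof (induction k)
    case 0
    show ?case unfolding rot_auto_0 by (rule generate.one)
  next
    case (Suc k)
    have "rot_auto c 1 \<in> generate ?A {rot_auto c 1}" by (rule generate.incl) simp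
    from generate.eng[OF this Suc] show ?case by (simp add: rot_auto_mult)
  qed
  ultimately have "generate ?A {rot_auto c 1} = range (rot_auto c)" by blast
  also have "\<dots> = rot_auto c ` {..<6}"
  proof
    show "range (rot_auto c) \<subseteq> rot_auto c ` {..<6}"
    proof
      fix h assume "h \<in> range (rot_auto c)"
      then obtain k where "h = rot_auto c (k mod 6)" using rot_auto_mod_6 by auto
      then show "h \<in> rot_auto c ` {..<6}" by simp
    qed
  qed auto
  finally show ?thesis by (simp add: ec_coset_data_def gen)
qed

text \<open>The powers of the automorphism differ on a point with nonzero coordinates.\<close>

lemma inj_on_rot_auto:
  assumes c: "c \<noteq> 0"
  shows "inj_on (rot_auto c) {..<6}"
proof (rule inj_onI)
  fix j k :: nat assume jk: "j \<in> {..<6}" "k \<in> {..<6}" and eq: "rot_auto c j = rot_auto c k"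
  obtain x where x: "c = x ^ 3" by (rule exists_complex_root[of 3 c]) simp
  define y where "y = csqrt (2 * c)"
  have nz: "x \<noteq> 0" "y \<noteq> 0" using c x by (auto simp: y_def)
  have "y^2 = x ^ 3 + c" using x by (simp add: y_def)
  then have "Pt x y \<in> ec_points c" by simp
  then have "ec_rot j (Pt x y) = ec_rot k (Pt x y)" using fun_cong[OF eq, of "Pt x y"] by simp
  then have pow: "root3 ^ j = root3 ^ k" "(-1 :: complex) ^ j = (-1) ^ k"
    using nz by (auto simp: ec_rot_Pt)
  have r1: "root3 \<noteq> 1" using root3_sum by auto
  have r2: "root3^2 \<noteq> 1"
  proof
    assume "root3^2 = 1"
    then have "root3 ^ 3 = root3" by (simp add: power3_eq_cube power2_eq_square)
    then show False using r1 root3_cubed by simp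
  qed
  have r3: "root3^2 \<noteq> root3" using r1 root3_nonzero by (simp add: power2_eq_square)
  have r4: "root3 ^ 4 = root3" "root3 ^ 5 = root3^2"
    using power_add[of root3 3 1] power_add[of root3 3 2] root3_cubed by simp_all
  show "j = k"
    using jk pow r1 r2 r3 r1[symmetric] r2[symmetric] r3[symmetric] unfolding lessThan_6
    by (auto simp: r4 root3_cubed)
qed

lemma image_mset_auts:
  assumes c: "c \<noteq> 0" and v: "v \<in> ec_points c"
  shows "{#F (h v). h \<in># mset_set (auts (ec_coset_data c))#} = (\<Sum>k<6. {#F (ec_rot k v)#})"
proof -
  have "mset_set (auts (ec_coset_data c)) = image_mset (rot_auto c) (mset_set {..<6})"
    unfolding auts_ec_coset_data[OF c]
      by (rule image_mset_mset_set[symmetric, OF inj_on_rot_auto[OF c]])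
  then show ?thesis using v by (simp add: lessThan_6)
qed

lemma ec_coset_data_simps [simp]:
  "cover_var (ec_coset_data c) = ec_var c" "cover (ec_coset_data c) = ec_group c"
  "orbits (ec_coset_data c) = CP1" "proj (ec_coset_data c) = ec_proj"
  by (simp_all add: ec_coset_data_def)

lemma variety_iso_restrict:
  assumes "variety_iso X Y f"
  shows "variety_iso X Y (restrict f (points X))"
proof -
  have "inv_into (points X) (restrict f (points X)) = inv_into (points X) f"
    unfolding inv_into_def by (intro ext arg_cong[of _ _ Eps]) auto
  moreover have "morphism (var_space X) (var_space Y) (restrict f (points X))"
    using assms unfolding variety_iso_def morphism_def var_space_def[of X] topspace_zariski_space
    by (auto intro: regular_on_zariski_space_cong[where f = f])
  moreover have "bij_betw (restrict f (points X)) (points X) (points Y)"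
    using assms unfolding variety_iso_def by (simp cong: bij_betw_cong)
  ultimately show ?thesis using assms unfolding variety_iso_def by simp
qed

lemma coset_group_G6:
  assumes c: "c \<noteq> 0"
  shows "coset_group 6 (ec_coset_data c) (G6 c)"
  unfolding coset_group_def ec_coset_data_simps ec_group_simps
proof (intro conjI ballI)
  show "algebraic_group (ec_var c) (ec_group c)" by (rule algebraic_group_ec[OF c])
  interpret A: group "AutoGroup (ec_group c)" by (rule group.AutoGroup[OF group_ec_group[OF c]])
  have "restrict phi6 (ec_points c) = rot_auto c 1"
    by (auto simp: rot_auto_def fun_eq_iff phi6_eq_rot)
  then have "{restrict phi6 (ec_points c)} \<subseteq> carrier (AutoGroup (ec_group c))"
    using rot_auto_auto[of c 1] by (simp add: AutoGroup_def)
  then show "subgroup (auts (ec_coset_data c)) (AutoGroup (ec_group c))"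
    unfolding ec_coset_data_def using A.generate_is_subgroup by simp
  show "finite (auts (ec_coset_data c))" "card (auts (ec_coset_data c)) = 6"
    by (simp_all add: auts_ec_coset_data[OF c] card_image[OF inj_on_rot_auto[OF c]])
  show "variety_iso (ec_var c) (ec_var c) h" if auts: "h \<in> auts (ec_coset_data c)" for h
  proof -
    obtain k where h: "h = rot_auto c k" using auts auts_ec_coset_data[OF c] by auto
    have "variety_iso (ec_var c) (ec_var c) (ec_rot k)"
      unfolding ec_rot_def
      by (rule variety_iso_ec_scale[OF ec_rot_scalars(1)]) (simp_all add: ec_rot_scalars(2))
    then show ?thesis unfolding h rot_auto_def using variety_iso_restrict by fastforce
  qed
  show "morphism (var_space (ec_var c)) (var_space CP1) ec_proj" by (rule morphism_ec_proj)
  show "ec_proj ` ec_points c = points CP1" using ec_proj_surj[of c] by auto (metis image_eqI)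
  fix u v assume u: "u \<in> ec_points c" and v: "v \<in> ec_points c"
  show "(ec_proj u = ec_proj v) = (\<exists>h\<in>auts (ec_coset_data c). v = h u)"
    unfolding ec_proj_eq_iff[OF u v] auts_ec_coset_data[OF c] using u by auto
  show "nmult (G6 c) (ec_proj u) (ec_proj v) =
      Some {#ec_proj (ec_add u (h v)). h \<in># mset_set (auts (ec_coset_data c))#}"
    unfolding nmult_G6[OF u v] image_mset_auts[OF c v, of "\<lambda>w. ec_proj (ec_add u w)"] orbit_sum_def ..
next
  show "nunit (G6 c) = ec_proj EInf" by simp
  fix u assume "u \<in> ec_points c"
  then show "ninv (G6 c) (ec_proj u) = Some (ec_proj (inv\<^bsub>ec_group c\<^esub> u))"
    by (simp add: inv_ec_group[OF c])
qed

lemma zero_in_orbit_sum: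
  assumes u: "u \<in> ec_points c" and v: "v \<in> ec_points c" and zero: "Aff 0 \<in># orbit_sum u v"
  shows "ec_proj v = ec_proj u"
proof -
  obtain k where k: "ec_proj (ec_add u (ec_rot k v)) = Aff 0"
    using zero by (auto simp: set_orbit_sum)
  have sum: "ec_add u (ec_rot k v) = EInf"
    using k by (cases "ec_add u (ec_rot k v)") (auto split: if_splits)
  have "ec_rot k v = ec_neg u"
  proof (cases u)
    case (Pt x y)
    obtain x' y' where r: "ec_rot k v = Pt x' y'"
      using sum Pt by (cases "ec_rot k v") auto
    show ?thesis using sum unfolding Pt r by (auto simp: ec_add.simps Let_def split: if_splits)
  qed (use sum in simp)
  then have "ec_proj (ec_rot k v) = ec_proj (ec_neg u)" by simp
  then show ?thesis by simp
qed

lemma rational_morphism_Some_CP1: "rational_morphism (var_space CP1) (var_space CP1) Some"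
proof -
  have "dom (Some :: cp1 \<Rightarrow> cp1 option) = UNIV" by auto
  moreover have "the \<circ> Some = (\<lambda>p :: cp1. p)" by auto
  moreover have "topspace (ftop (var_space CP1)) = UNIV"
    by (simp add: var_space_CP1 topspace_zariski_space)
  ultimately show ?thesis
    using morphism_identity_CP1 closure_of_topspace[of "ftop (var_space CP1)"]
    unfolding rational_morphism_def morphism_def by auto
qed

lemma nv_inverse_map_G6: "nv_inverse_map CP1 (G6 c) Some"
  unfolding nv_inverse_map_def
proof (intro conjI rational_morphism_Some_CP1 allI impI)
  fix x y :: cp1 assume "Some x = Some y"
  obtain u where u: "u \<in> ec_points c" "x = ec_proj u" using ec_proj_surj by metis
  have "Aff 0 \<in># orbit_sum u u"
    unfolding set_orbit_sum using ec_add_neg(1)[of u] ec_rot_3[of u]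
    by (intro CollectI exI[of _ 3]) simp
  then show "\<exists>M M'. nmult (G6 c) x y = Some M \<and> nunit (G6 c) \<in># M \<and>
      nmult (G6 c) y x = Some M' \<and> nunit (G6 c) \<in># M'"
    using \<open>Some x = Some y\<close> nmult_G6[OF u(1) u(1)] u(2) by auto
qed

text \<open>
  The neutral element belongs to \<open>x * y\<close> only if \<open>y = x\<close>. Hence any inverse map is a restriction of the
  identity, and as the identity is regular everywhere, maximality of the domain leaves no other choice.
\<close>

lemma nv_inverse_map_G6_unique:
  assumes "nv_inverse_map CP1 (G6 c) j"
  shows "j = Some"
proof -
  have j: "j x = Some x" if x: "x \<in> dom j" for x
  proof -
    obtain y where y: "j x = Some y" using x by blast
    then obtain M where M: "nmult (G6 c) x y = Some M" "Aff 0 \<in># M"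
      using assms unfolding nv_inverse_map_def by (metis nunit_G6)
    obtain u v where uv: "u \<in> ec_points c" "v \<in> ec_points c" "x = ec_proj u" "y = ec_proj v"
      "nmult (G6 c) x y = Some (orbit_sum u v)" by (rule nmult_G6_obtain)
    then have "y = x" using M zero_in_orbit_sum by auto
    then show ?thesis using y by simp
  qed
  have top: "topspace (ftop (var_space CP1)) = UNIV"
    by (simp add: var_space_CP1 topspace_zariski_space)
  have "regular_on (var_space CP1) UNIV (var_space CP1) (\<lambda>p. p)"
    using morphism_identity_CP1 unfolding morphism_def top .
  then have "UNIV = dom j"
    using assms j unfolding nv_inverse_map_def rational_morphism_def by blast
  then show ?thesis using j by (auto simp: fun_eq_iff)
qed

lemma is_G6_G6:
  assumes c: "c \<noteq> 0"
  shows "is_G6 c (G6 c)"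
proof -
  have top: "topspace (ftop (square_space CP1)) = UNIV"
    by (simp add: square_space_def topspace_zariski_space)
  have total: "nmult (G6 c) x y \<noteq> None" for x y by (simp add: G6_def)
  have dom: "dom (\<lambda>(x, y). nmult (G6 c) x y) = UNIV" using total by auto
  have the: "the \<circ> (\<lambda>(x, y). nmult (G6 c) x y) = (\<lambda>(x, y). the (nmult (G6 c) x y))" by auto
  have rational: "rational_morphism (square_space CP1) (sym_space 6 CP1) (\<lambda>(x, y). nmult (G6 c) x y)"
    unfolding rational_morphism_def dom the
    using regular_on_nmult_G6[OF c] closure_of_topspace[of "ftop (square_space CP1)"] top by auto
  have comm: "nmult (G6 c) x y = nmult (G6 c) y x" for x y
  proof -
    obtain u v where uv: "u \<in> ec_points c" "v \<in> ec_points c" "x = ec_proj u" "y = ec_proj v"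
      "nmult (G6 c) x y = Some (orbit_sum u v)" by (rule nmult_G6_obtain)
    then show ?thesis using nmult_G6[of v c u] orbit_sum_commute[of u c v] by simp
  qed
  have unit: "nmult (G6 c) x (Aff 0) = Some (replicate_mset 6 x)" for x
  proof -
    obtain u where u: "u \<in> ec_points c" "x = ec_proj u" using ec_proj_surj by metis
    have "orbit_sum u EInf = replicate_mset 6 x"
      unfolding orbit_sum_def u(2) by (simp add: lessThan_6 eval_nat_numeral)
    then show ?thesis using nmult_G6[OF u(1) EInf_ec_points] u(2) by simp
  qed
  show ?thesis
    unfolding is_G6_def
  proof (intro conjI)
    show "algebraic_nvgroup 6 CP1 (G6 c)"
      unfolding algebraic_nvgroup_def
      using projective_variety_CP1 rational nv_associative_G6[OF c] unit comm nv_inverse_map_G6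
      by auto
    show "nv_regular CP1 (G6 c)" using total by (simp add: nv_regular_def)
    show "nv_commutative CP1 (G6 c)" using comm by (simp add: nv_commutative_def)
    show "nv_involutive CP1 (G6 c)"
      using nv_inverse_map_G6_unique by (simp add: nv_involutive_def)
    show "coset_group 6 (ec_coset_data c) (G6 c)" by (rule coset_group_G6[OF c])
    show "mult_defined_by 6 (p6 c) (G6 c)" by (rule mult_defined_by_G6[OF c])
  qed simp
qed

section \<open>All the coset groups are isomorphic\<close>

lemma ec_proj_scale:
  assumes "\<beta> \<noteq> 0"
  shows "ec_proj (ec_scale \<alpha> \<beta> u) = cp1_scale (1 / \<beta>^2) (ec_proj u)"
  using assms by (cases u) (auto simp: power_mult_distrib)

lemma ec_scale_rot: "ec_scale \<alpha> \<beta> (ec_rot k u) = ec_rot k (ec_scale \<alpha> \<beta> u)"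
  by (cases u) (simp_all add: ec_rot_Pt mult_ac)

lemma nmult_coset_group:
  assumes c: "c \<noteq> 0" and G: "coset_group 6 (ec_coset_data c) G"
    and u: "u \<in> ec_points c" and v: "v \<in> ec_points c"
  shows "nmult G (ec_proj u) (ec_proj v) = Some (orbit_sum u v)"
proof -
  have "nmult G (ec_proj u) (ec_proj v) =
      Some {#ec_proj (ec_add u (h v)). h \<in># mset_set (auts (ec_coset_data c))#}"
    using G u v unfolding coset_group_def by simp
  then show ?thesis unfolding image_mset_auts[OF c v, of "\<lambda>w. ec_proj (ec_add u w)"] orbit_sum_def .
qed

text \<open>
  Scaling by \<open>(t\<^sup>2, t\<^sup>3)\<close> commutes with the automorphism of order six, hence induces a map of the orbit
  spaces, which is \<open>z \<mapsto> z / t\<^sup>6\<close>.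
\<close>

lemma coset_isomorphic_ec:
  assumes c: "c \<noteq> 0" "c' \<noteq> 0"
    and G: "coset_group 6 (ec_coset_data c) G" "coset_group 6 (ec_coset_data c') G'"
  shows "coset_isomorphic (ec_coset_data c) G (ec_coset_data c') G'"
proof -
  obtain t where t: "c' / c = t ^ 6" by (rule exists_complex_root[of 6 "c' / c"]) simp
  define \<alpha> \<beta> where "\<alpha> = t^2" and "\<beta> = t ^ 3"
  have "t \<noteq> 0" using t c by auto
  then have \<beta>: "\<beta> \<noteq> 0" by (simp add: \<beta>_def)
  have scale: "\<alpha> ^ 3 = \<beta>^2" by (simp add: \<alpha>_def \<beta>_def flip: power_mult)
  have "\<beta>^2 = t ^ 6" by (simp add: \<beta>_def flip: power_mult)
  then have c': "c' = \<beta>^2 * c" using t c(1) by (simp add: field_simps)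
  define f where "f = ec_scale \<alpha> \<beta>"
  define g where "g = cp1_scale (1 / \<beta>^2)"
  have f_points: "f u \<in> ec_points c'" if "u \<in> ec_points c" for u
    unfolding f_def by (rule ec_scale_points[OF scale c' that])
  have f_add: "f (ec_add u (ec_rot k v)) = ec_add (f u) (ec_rot k (f v))"
    if "u \<in> ec_points c" "v \<in> ec_points c" for u v k
    unfolding f_def ec_scale_rot[symmetric] using that ec_rot_points
    by (intro ec_scale_add[OF scale \<beta>]) auto
  have proj: "g (ec_proj u) = ec_proj (f u)" for u
    by (simp add: f_def g_def ec_proj_scale[OF \<beta>])
  have iso_f: "variety_iso (ec_var c) (ec_var c') f"
    unfolding f_def by (rule variety_iso_ec_scale[OF scale c' \<beta>])
  show ?thesis
    unfolding coset_isomorphic_def ec_coset_data_simps ec_group_simps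
  proof (intro exI[of _ f] exI[of _ g] conjI ballI)
    show "f \<in> iso (ec_group c) (ec_group c')"
      using iso_f f_points ec_scale_add[OF scale \<beta>]
      unfolding iso_def hom_def variety_iso_def by (auto simp: f_def)
    show "variety_iso (ec_var c) (ec_var c') f" by (rule iso_f)
    show "variety_iso CP1 CP1 g" unfolding g_def by (rule variety_iso_cp1_scale) (use \<beta> in simp)
    show "g (ec_proj u) = ec_proj (f u)" for u by (rule proj)
    show "{#f (ec_add u (a v)). a \<in># mset_set (auts (ec_coset_data c))#} =
        {#ec_add (f u) (b (f v)). b \<in># mset_set (auts (ec_coset_data c'))#}"
      if "u \<in> ec_points c" "v \<in> ec_points c" for u v
      unfolding image_mset_auts[OF c(1) that(2), of "\<lambda>x. f (ec_add u x)"]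
        image_mset_auts[OF c(2) f_points[OF that(2)], of "ec_add (f u)"] f_add[OF that] ..
    show "map_option (image_mset g) (nmult G x y) = nmult G' (g x) (g y)" for x y
    proof -
      obtain u where u: "u \<in> ec_points c" "x = ec_proj u" using ec_proj_surj by metis
      obtain v where v: "v \<in> ec_points c" "y = ec_proj v" using ec_proj_surj by metis
      have "image_mset g (orbit_sum u v) = orbit_sum (f u) (f v)"
        unfolding orbit_sum_def f_add[OF u(1) v(1), symmetric] proj[symmetric]
          by (simp add: lessThan_6)
      then show ?thesis
        unfolding u(2) v(2) proj nmult_coset_group[OF c(1) G(1) u(1) v(1)]
          nmult_coset_group[OF c(2) G(2) f_points[OF u(1)] f_points[OF v(1)]] by simp
    qed
  qed
qed

theorem theorem5:
  shows "(\<forall>c. c \<noteq> 0 \<longrightarrow> (\<exists>G. is_G6 c G)) \<and>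
    (\<forall>c c' G G'. c \<noteq> 0 \<and> c' \<noteq> 0 \<and> is_G6 c G \<and> is_G6 c' G' \<longrightarrow>
       coset_isomorphic (ec_coset_data c) G (ec_coset_data c') G')"
  using is_G6_G6 coset_isomorphic_ec unfolding is_G6_def by blast

end
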